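(* Let $(G,\rho)$ be a rooted triangulation with boundary and set $V=V(G)$. For any $v\in V$ distinct from $\rho$, $$\mathrm{VEL}(\Gamma_{\rho,v})\le 4\,\mathrm{rad}_\rho(v)^{-1}.$$ Furthermore, for any $v\in V$, $$\mathrm{VEL}(\Gamma_v^{\partial})\le 1+\frac12\log\left(\frac{1}{\mathrm{rad}_\rho(v)}\right).$$
   Context: A triangulation with boundary is a finite simple connected planar map (a graph drawn in the plane, up to orientation-preserving homeomorphism) in which all faces are triangles except for the outer face, whose boundary is a simple cycle. A rooted triangulation with boundary is a pair $(G,\rho)$ where $G$ is a triangulation with boundary and $\rho\in V=V(G)$ is a vertex not belonging to the outer face. A circle packing of a simple connected planar map $G$ with vertex set $V$ is a collection $\{C_v\}_{v\in V}$ of circles in the plane with disjoint interiors such that $C_v$ is tangent to $C_u$ if and only if $u$ and $v$ form an edge, and such that for each $v$ the cyclic order of the circles tangent to $C_v$ agrees with the cyclic order of the neighbors of $v$ in $G$. Let $\mathbb D=\{z:|z|<1\}$. A circle packing of a triangulation with boundary in $\mathbb D$ is a circle packing in which the circles corresponding to vertices of the outer face are internally tangent to the unit circle $\partial\mathbb D$ and all other circles are contained in $\mathbb D$. Such a packing exists and is unique up to Möbius transformations of $\mathbb D$ onto itself. For a rooted triangulation with boundary $(G,\rho)$, let $\mathcal P_\rho=\{C_v\}_{v\in V}$ be a circle packing of $G$ in $\mathbb D$ such that $C_\rho$ is centered at the origin; it is unique up to rotations, so the radius of $C_v$, denoted $\mathrm{rad}_\rho(v)$, is well defined. For a function $m:V\to[0,\infty)$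 and a finite path $\gamma$ in $G$, let $\mathrm{len}_m(\gamma)=\sum_{v\in\gamma}m(v)$ (sum over the vertices visited by $\gamma$, each counted once; in particular the common start and end vertex of a closed path is counted once). For a set $\Gamma$ of finite paths, $\mathrm{len}_m(\Gamma)=\inf_{\gamma\in\Gamma}\mathrm{len}_m(\gamma)$. With $\mathrm{area}(m)=\sum_{v\in V}m(v)^2$, the vertex extremal length of $\Gamma$ is $$\mathrm{VEL}(\Gamma)=\sup_{m}\frac{\mathrm{len}_m(\Gamma)^2}{\mathrm{area}(m)},$$ the supremum being over all $m:V\to[0,\infty)$ that are not identically zero. For $v\ne\rho$, $\Gamma_{\rho,v}$ is the set of paths in $G$ starting and ending at $v$ that have winding number $1$ around $\rho$: the path, viewed as a closed curve in the planar drawing of $G$, does not pass through $\rho$ and has winding number $1$ around the point representing $\rho$. For any vertex $v$, $\Gamma_v^{\partial}$ is the set of paths in $G$ starting at $v$ and ending at a vertex of the outer face (a path consisting of the single vertex $v$ is allowed if $v$ is on the outer face). *)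

theory Defs
  imports
    "HOL-Complex_Analysis.Complex_Analysis"
    "Graph_Theory.Pair_Digraph"
    "Graph_Theory.Digraph_Component"
    "Graph_Theory.Vertex_Walk"
begin

section \<open>Plane drawings\<close>

text \<open>
  A planar map is given by a representative of its homeomorphism class: a finite simple graph
  whose vertices are points of the plane, with a family \<open>dr\<close> of curves such that \<open>dr u v\<close> is the
  edge between \<open>u\<close> and \<open>v\<close>, oriented from \<open>u\<close> to \<open>v\<close>. The edges are arbitrary Jordan arcs.
\<close>

type_synonym drawing = "complex \<Rightarrow> complex \<Rightarrow> real \<Rightarrow> complex"

definition support :: "complex pair_pre_digraph \<Rightarrow> drawing \<Rightarrow> complex set" where
  "support G dr = pverts G \<union> (\<Union>(u, v)\<in>parcs G. path_image (dr u v))"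

fun walk_curve :: "drawing \<Rightarrow> complex list \<Rightarrow> real \<Rightarrow> complex" where
  "walk_curve dr [] = (\<lambda>_. 0)"
| "walk_curve dr [u] = linepath u u"
| "walk_curve dr (u # v # p) = dr u v +++ walk_curve dr (v # p)"

text \<open>\<open>pair_graph\<close>: finite, symmetric, loop-free, without parallel edges.\<close>

locale planar_map = pair_graph G for G :: "complex pair_pre_digraph" +
  fixes dr :: drawing
  assumes graph_connected: "Digraph_Component.connected (with_proj G)"
    and edge_arc: "(u, v) \<in> parcs G \<Longrightarrow> Path_Connected.arc (dr u v)"
    and edge_start: "(u, v) \<in> parcs G \<Longrightarrow> pathstart (dr u v) = u"
    and edge_finish: "(u, v) \<in> parcs G \<Longrightarrow> pathfinish (dr u v) = v"
    and edge_reverse: "(u, v) \<in> parcs G \<Longrightarrow> dr v u = reversepath (dr u v)"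
    and edge_verts: "(u, v) \<in> parcs G \<Longrightarrow> path_image (dr u v) \<inter> pverts G = {u, v}"
    and edge_disjoint: "\<lbrakk>(u, v) \<in> parcs G; (x, y) \<in> parcs G; {u, v} \<noteq> {x, y}\<rbrakk>
          \<Longrightarrow> path_image (dr u v) \<inter> path_image (dr x y) \<subseteq> {u, v} \<inter> {x, y}"

text \<open>
  The faces are the components of the complement of the drawing; the outer face is the unbounded
  one, \<open>outside (support G dr)\<close>. A face \<open>F\<close> is bounded by the simple cycle through the vertices
  \<open>cs\<close> if its frontier is the closed curve drawn by that cycle. (In a symmetric digraph the
  length condition is needed to rule out an edge traversed back and forth.)
\<close>

definition bounded_by_cycle ::
  "complex pair_pre_digraph \<Rightarrow> drawing \<Rightarrow> complex set \<Rightarrow> complex list \<Rightarrow> bool" where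
  "bounded_by_cycle G dr F cs \<longleftrightarrow>
     3 \<le> length cs \<and> distinct cs \<and> vwalk (cs @ [hd cs]) (with_proj G) \<and>
     frontier F = path_image (walk_curve dr (cs @ [hd cs]))"

definition outer_verts :: "complex pair_pre_digraph \<Rightarrow> drawing \<Rightarrow> complex set" where
  "outer_verts G dr = pverts G \<inter> frontier (outside (support G dr))"

locale triangulation_with_boundary = planar_map +
  assumes inner_faces: "\<lbrakk>F \<in> components (- support G dr); bounded F\<rbrakk>
          \<Longrightarrow> \<exists>cs. length cs = 3 \<and> bounded_by_cycle G dr F cs"
    and outer_face: "\<exists>cs. bounded_by_cycle G dr (outside (support G dr)) cs"

locale rooted_triangulation = triangulation_with_boundary +
  fixes \<rho> :: complex
  assumes root: "\<rho> \<in> pverts G - outer_verts G dr"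

section \<open>Cyclic orders\<close>

text \<open>The directions from \<open>p\<close> to \<open>x\<close>, \<open>y\<close>, \<open>z\<close> are distinct and in counterclockwise order.\<close>

definition ccw :: "complex \<Rightarrow> complex \<Rightarrow> complex \<Rightarrow> complex \<Rightarrow> bool" where
  "ccw p x y z \<longleftrightarrow> p \<notin> {x, y, z} \<and>
     (\<exists>\<alpha> \<beta> \<gamma>. \<alpha> < \<beta> \<and> \<beta> < \<gamma> \<and> \<gamma> < \<alpha> + 2 * pi \<and>
        x - p = rcis (cmod (x - p)) \<alpha> \<and>
        y - p = rcis (cmod (y - p)) \<beta> \<and>
        z - p = rcis (cmod (z - p)) \<gamma>)"

text \<open>
  Edges need not have tangents, so the cyclic order of the edges at a vertex \<open>v\<close> is read off from
  the points in which they first meet a small circle around \<open>v\<close>. For all radii smaller than the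
  distance from \<open>v\<close> to the nearest neighbour, these points come in the same cyclic order.
\<close>

definition first_hit :: "(real \<Rightarrow> complex) \<Rightarrow> real \<Rightarrow> complex" where
  "first_hit g \<epsilon> = g (Inf {t \<in> {0..1}. dist (pathstart g) (g t) = \<epsilon>})"

definition ccw_neighbours :: "drawing \<Rightarrow> complex \<Rightarrow> complex \<Rightarrow> complex \<Rightarrow> complex \<Rightarrow> bool" where
  "ccw_neighbours dr v x y z \<longleftrightarrow>
     (\<forall>\<^sub>F \<epsilon> in at_right 0.
        ccw v (first_hit (dr v x) \<epsilon>) (first_hit (dr v y) \<epsilon>) (first_hit (dr v z) \<epsilon>))"

section \<open>Circle packings\<close>

text \<open>
  The circle \<open>C\<^sub>v\<close> is \<open>sphere (cen v) (rad v)\<close>. Circles with disjoint interiors can only be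
  externally tangent.
\<close>

locale circle_packing = planar_map +
  fixes cen :: "complex \<Rightarrow> complex" and rad :: "complex \<Rightarrow> real"
  assumes rad_pos: "v \<in> pverts G \<Longrightarrow> 0 < rad v"
    and disjoint_interiors: "\<lbrakk>u \<in> pverts G; v \<in> pverts G; u \<noteq> v\<rbrakk>
          \<Longrightarrow> ball (cen u) (rad u) \<inter> ball (cen v) (rad v) = {}"
    and tangent_iff: "\<lbrakk>u \<in> pverts G; v \<in> pverts G; u \<noteq> v\<rbrakk>
          \<Longrightarrow> dist (cen u) (cen v) = rad u + rad v \<longleftrightarrow> (u, v) \<in> parcs G"
    and cyclic_order: "\<lbrakk>(v, x) \<in> parcs G; (v, y) \<in> parcs G; (v, z) \<in> parcs G; distinct [x, y, z]\<rbrakk>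
          \<Longrightarrow> ccw (cen v) (cen x) (cen y) (cen z) \<longleftrightarrow> ccw_neighbours dr v x y z"

text \<open>
  The circle with centre \<open>a\<close> and radius \<open>s < 1\<close> is internally tangent to the unit circle iff the
  distance \<open>cmod a\<close> of the centres is the difference \<open>1 - s\<close> of the radii.
\<close>

locale circle_packing_in_disc = triangulation_with_boundary + circle_packing +
  assumes outer_tangent: "v \<in> outer_verts G dr \<Longrightarrow> rad v < 1 \<and> cmod (cen v) = 1 - rad v"
    and inner_contained: "v \<in> pverts G - outer_verts G dr \<Longrightarrow> sphere (cen v) (rad v) \<subseteq> ball 0 1"

section \<open>Vertex extremal length\<close>

text \<open>Paths are vertex lists; \<open>set p\<close> makes every visited vertex count once.\<close>

definition path_len :: "('a \<Rightarrow> real) \<Rightarrow> 'a list \<Rightarrow> real" where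
  "path_len m p = (\<Sum>v\<in>set p. m v)"

definition len :: "('a \<Rightarrow> real) \<Rightarrow> 'a list set \<Rightarrow> ereal" where
  "len m \<Gamma> = (INF p\<in>\<Gamma>. ereal (path_len m p))"

definition area :: "'a set \<Rightarrow> ('a \<Rightarrow> real) \<Rightarrow> real" where
  "area V m = (\<Sum>v\<in>V. (m v)\<^sup>2)"

definition VEL :: "'a set \<Rightarrow> 'a list set \<Rightarrow> ereal" where
  "VEL V \<Gamma> = (SUP m\<in>{m. (\<forall>v\<in>V. 0 \<le> m v) \<and> (\<exists>v\<in>V. m v \<noteq> 0)}.
                (len m \<Gamma>)\<^sup>2 / ereal (area V m))"

definition winding_paths ::
  "complex pair_pre_digraph \<Rightarrow> drawing \<Rightarrow> complex \<Rightarrow> complex \<Rightarrow> complex list set" where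
  "winding_paths G dr \<rho> v =
     {p. vwalk p (with_proj G) \<and> hd p = v \<and> last p = v \<and>
         \<rho> \<notin> path_image (walk_curve dr p) \<and> winding_number (walk_curve dr p) \<rho> = 1}"

definition boundary_paths ::
  "complex pair_pre_digraph \<Rightarrow> drawing \<Rightarrow> complex \<Rightarrow> complex list set" where
  "boundary_paths G dr v =
     {p. vwalk p (with_proj G) \<and> hd p = v \<and> last p \<in> outer_verts G dr}"

end

theory Submission
  imports Defs
begin

text \<open>
  For a given \<open>m\<close> a short path is found among the circles met by a random curve, by averaging and
  the Cauchy-Schwarz inequality.

  For the paths to the boundary the curve is the ray from the centre of \<open>C\<^sub>v\<close> in a uniform direction.
  It meets the circle of \<open>u\<close> with probability at most \<open>x\<^sub>u / 2\<close>, where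
  \<open>x\<^sub>u = rad u / dist (cen u) (cen v)\<close>, and \<open>\<Sum>x\<^sub>u\<^sup>2 \<le> 2 ln (1 / rad v)\<close>: the logarithmic length of
  the chord cut out of the disc of \<open>u\<close> has integral at least \<open>\<pi> x\<^sub>u\<^sup>2\<close> over the directions, the
  chords on one ray are disjoint, and two opposite rays leave the unit disc at distances with
  product at most \<open>1\<close>. For the paths around \<open>\<rho>\<close> the curve is a circle around \<open>0\<close> whose radius is
  uniform among those meeting \<open>C\<^sub>v\<close>; here the squares of the probabilities are compared with areas
  of disjoint discs in an annulus.

  The circles met by a curve form a connected subgraph: for a union \<open>K\<close> of components of it, the
  number of triangles touching \<open>K\<close> that cover a point is constant along the curve and at least \<open>1\<close>,
  whereas no point is covered by more than one triangle. That the circles met by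
  \<open>sphere 0 t\<close> carry a walk with winding number \<open>1\<close> around \<open>\<rho>\<close> is seen in the drawing, by adding up
  the facial triangles that touch the circles inside \<open>sphere 0 t\<close>.
\<close>

hide_const (open) Digraph_Component.connected

hide_const (open) Digraph_Component.connected

section \<open>Walks and cycles in a drawing\<close>

text \<open>The drawing and the packing are tied together only by adjacency and by the cyclic order
  at each vertex; nothing says that the straight triangles spanned by the centres form a copy of the
  drawing. This is the main obstacle. What survives without a homeomorphism is that no edge leaves a
  corner of a face into that face, and that the segments between tangent circles cross only at
  common ends. Positive orientation of all straight triangles follows from this, and coverings are
  counted by sums of signed angles over edges, in which an edge that occurs in both directions
  cancels. The same cancellation serves twice: with the arcs of the drawing for winding numbers
  around \<open>\<rho>\<close>, and with segments for the packing.

  The constant 4 comes from Cauchy-Schwarz: the radius of the random circle ranges over an interval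
  of length \<open>2 * rad v\<close>, and the squared lengths of its intersections with the radial
  extents of the other circles sum to at most \<open>16 * rad v\<close>. In the other bound the term
  1 is the contribution of \<open>v\<close> itself, which every ray meets.\<close>

lemma arc_interior_empty:
  fixes g :: "real \<Rightarrow> complex"
  assumes "arc g"
  shows "interior (path_image g) = {}"
proof (rule ccontr)
  assume "interior (path_image g) \<noteq> {}"
  then obtain p where "p \<in> interior (path_image g)" by blast
  then obtain e where e: "e > 0" "ball p e \<subseteq> path_image g"
    by (meson mem_interior)
  obtain h where h: "homeomorphism {0..1} (path_image g) g h"
    using homeomorphism_arc[OF assms] by blast
  have conn: "connected (h ` S)" if "connected S" "S \<subseteq> path_image g" for S
    using that h by (meson connected_continuous_image continuous_on_subset homeomorphism_cont2)
  let ?x = "h p" and ?y = "h (p + of_real (e/2))" and ?z = "h (p - of_real (e/2))"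
  have in_ball: "p \<in> ball p e" "p + of_real (e/2) \<in> ball p e" "p - of_real (e/2) \<in> ball p e"
    using e by (auto simp: dist_norm)
  have gh: "g (h x) = x" if "x \<in> ball p e" for x
    using that e h by (meson homeomorphism_apply2 subsetD)
  have inj: "h x = h y \<Longrightarrow> x = y" if "x \<in> ball p e" "y \<in> ball p e" for x y
    using gh that by metis
  \<comment> \<open>A planar disc stays connected when a point is deleted, so its image under
    \<open>h\<close> cannot omit a value between two others; yet one of any three distinct reals
    lies between the other two.\<close>
  have key: False if c: "c \<in> ball p e" "u \<in> ball p e" "w \<in> ball p e" and lt: "h u < h c" "h c < h w" for c u w
  proof -
    have "connected (ball p e - {c})"
      by (rule connected_open_delete) (auto)
    then have "connected (h ` (ball p e - {c}))"
      using e by (intro conn) auto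
    moreover have "h u \<in> h ` (ball p e - {c})" "h w \<in> h ` (ball p e - {c})"
      using c lt by auto
    ultimately have "h c \<in> h ` (ball p e - {c})"
      using lt by (meson connected_contains_Icc atLeastAtMost_iff less_imp_le subsetD)
    then show False using inj c by auto
  qed
  have ne: "?x \<noteq> ?y" "?y \<noteq> ?z" "?x \<noteq> ?z"
    using inj[OF in_ball(1,2)] inj[OF in_ball(2,3)] inj[OF in_ball(1,3)] e by (auto simp: algebra_simps)
  show False
    using ne key[OF in_ball(1,2,3)] key[OF in_ball(1,3,2)] key[OF in_ball(2,1,3)] key[OF in_ball(2,3,1)]
      key[OF in_ball(3,1,2)] key[OF in_ball(3,2,1)] by linarith
qed

lemma finite_Union_arcs_interior_empty:
  fixes \<A> :: "(real \<Rightarrow> complex) set"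
  assumes "finite \<A>" "\<And>g. g \<in> \<A> \<Longrightarrow> arc g"
  shows "interior (\<Union>g\<in>\<A>. path_image g) = {}"
  using assms
proof (induction rule: finite_induct)
  case (insert g \<A>)
  have "closed (path_image g)" using insert by (simp add: closed_arc_image)
  then show ?case
    using insert interior_closed_Un_empty_interior[of "path_image g" "\<Union>g\<in>\<A>. path_image g"]
    by (simp add: arc_interior_empty)
qed auto

text \<open>\<open>walk_curve\<close> ends in a constant piece and is therefore never injective.
  Leaving that piece out makes the curve of a cycle a simple closed path with the same image, to
  which the Jordan curve theorem applies.\<close>

fun edge_curve :: "drawing \<Rightarrow> complex list \<Rightarrow> real \<Rightarrow> complex" where
  "edge_curve dr [] = (\<lambda>_. 0)"
| "edge_curve dr [u] = linepath u u"
| "edge_curve dr [u, v] = dr u v"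
| "edge_curve dr (u # v # w # p) = dr u v +++ edge_curve dr (v # w # p)"

lemma vwalk_arcs_in_set: "(x, y) \<in> set (vwalk_arcs p) \<Longrightarrow> x \<in> set p \<and> y \<in> set p"
  by (induction p rule: vwalk_arcs.induct) auto

context planar_map begin

lemma arcs_sym: "(u, v) \<in> parcs G \<Longrightarrow> (v, u) \<in> parcs G"
  using pair_sym_arcs by (auto simp: symmetric_def sym_def)

lemma arcs_neq: "(u, v) \<in> parcs G \<Longrightarrow> u \<noteq> v"
  using pair_no_loops by force

lemma edge_path [simp]: "(u, v) \<in> parcs G \<Longrightarrow> path (dr u v)"
  using edge_arc arc_imp_path by blast

lemma edge_image_sym: "(u, v) \<in> parcs G \<Longrightarrow> path_image (dr v u) = path_image (dr u v)"
  by (simp add: edge_reverse)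

lemma edge_ends_in: "(u, v) \<in> parcs G \<Longrightarrow> u \<in> path_image (dr u v) \<and> v \<in> path_image (dr u v)"
  by (metis edge_finish edge_start pathfinish_in_path_image pathstart_in_path_image)

lemma edge_in_support: "(u, v) \<in> parcs G \<Longrightarrow> path_image (dr u v) \<subseteq> support G dr"
  by (auto simp: support_def)

lemma compact_support: "compact (support G dr)"
  unfolding support_def
  using pair_finite_verts pair_finite_arcs
  by (intro compact_Un compact_UN) (auto intro: finite_imp_compact compact_path_image)

lemma interior_support: "interior (support G dr) = {}"
proof -
  let ?\<A> = "(\<lambda>(u,v). dr u v) ` parcs G"
  have "interior (\<Union>g\<in>?\<A>. path_image g) = {}"
    using pair_finite_arcs by (intro finite_Union_arcs_interior_empty) (auto simp: edge_arc)
  moreover have "support G dr = pverts G \<union> (\<Union>g\<in>?\<A>. path_image g)"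
    by (auto simp: support_def)
  ultimately show ?thesis
    using interior_closed_Un_empty_interior[of "pverts G" "\<Union>g\<in>?\<A>. path_image g"]
    by (simp add: finite_imp_closed pair_finite_verts empty_interior_finite)
qed

lemma edge_meet:
  assumes "(u, v) \<in> parcs G" "(x, y) \<in> parcs G" "{u, v} \<noteq> {x, y}"
    "p \<in> path_image (dr u v)" "p \<in> path_image (dr x y)"
  shows "p \<in> {u, v}" "p \<in> {x, y}"
  using edge_disjoint[OF assms(1-3)] assms(4,5) by auto

lemma vwalk_Cons2: "vwalk (u # v # p) (with_proj G) \<longleftrightarrow> (u, v) \<in> parcs G \<and> vwalk (v # p) (with_proj G)"
  using in_arcsD1 in_arcsD2 by (auto simp: vwalk_def)

lemma walk_curve_props:
  assumes "vwalk p (with_proj G)"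
  shows "path (walk_curve dr p) \<and> pathstart (walk_curve dr p) = hd p \<and>
    pathfinish (walk_curve dr p) = last p \<and>
    path_image (walk_curve dr p) = set p \<union> (\<Union>(u, v)\<in>set (vwalk_arcs p). path_image (dr u v))"
  using assms
proof (induction p rule: induct_list012)
  case (3 u v p)
  then show ?case
    using edge_ends_in[of u v] by (simp add: vwalk_Cons2 edge_start edge_finish path_image_join) blast
qed (auto simp: vwalk_def)

lemma winding_number_walk_curve:
  assumes "vwalk p (with_proj G)" "q \<notin> path_image (walk_curve dr p)"
  shows "winding_number (walk_curve dr p) q = (\<Sum>(u, v)\<leftarrow>vwalk_arcs p. winding_number (dr u v) q)"
  using assms
proof (induction p rule: induct_list012)
  case (2 u)
  then have "u \<noteq> q" by simp
  then have "winding_number (linepath u u) q = 0" by (rule winding_number_trivial[OF not_sym])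
  then show ?case by (simp add: linepath_refl)
next
  case (3 u v p)
  then show ?case
    using walk_curve_props[of "v # p"]
    by (simp add: vwalk_Cons2 winding_number_join edge_start edge_finish path_image_join)
qed (auto simp: vwalk_def)

lemma edge_curve_props:
  assumes "vwalk p (with_proj G)" "length p \<ge> 2"
  shows "path_image (edge_curve dr p) = path_image (walk_curve dr p) \<and>
    pathstart (edge_curve dr p) = hd p \<and> pathfinish (edge_curve dr p) = last p"
  using assms
proof (induction p rule: induct_list012)
  case (3 u v p)
  show ?case
  proof (cases p)
    case Nil
    have uv: "(u, v) \<in> parcs G" using 3 by (simp add: vwalk_Cons2)
    have "path_image (dr u v +++ linepath v v) = path_image (dr u v)"
      using edge_ends_in[OF uv] edge_finish[OF uv] by (subst path_image_join) auto
    then show ?thesis using edge_start[OF uv] edge_finish[OF uv] Nil by simp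
  next
    case (Cons w p')
    then show ?thesis
      using 3 walk_curve_props[of "v # p"]
      by (simp add: vwalk_Cons2 edge_start edge_finish path_image_join)
  qed
qed auto

lemma edge_curve_arc:
  assumes "vwalk p (with_proj G)" "length p \<ge> 2" "distinct p"
  shows "Path_Connected.arc (edge_curve dr p)"
  using assms
proof (induction p rule: induct_list012)
  case (3 u v p)
  show ?case
  proof (cases p)
    case Nil
    then show ?thesis using 3 by (simp add: vwalk_Cons2 edge_arc)
  next
    case (Cons w p')
    have w: "vwalk (v # p) (with_proj G)" and uv: "(u, v) \<in> parcs G" using 3 by (auto simp: vwalk_Cons2)
    have img: "path_image (edge_curve dr (v # p)) =
        set (v # p) \<union> (\<Union>(x, y)\<in>set (vwalk_arcs (v # p)). path_image (dr x y))"
      using edge_curve_props[OF w] walk_curve_props[OF w] Cons by simp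
    have "path_image (dr u v) \<inter> path_image (edge_curve dr (v # p)) \<subseteq> {v}"
    proof
      fix q assume q: "q \<in> path_image (dr u v) \<inter> path_image (edge_curve dr (v # p))"
      have uq: "u \<notin> set (v # p)" using 3 by auto
      consider "q \<in> set (v # p)" | x y where "(x, y) \<in> set (vwalk_arcs (v # p))" "q \<in> path_image (dr x y)"
        using q img by auto
      then show "q \<in> {v}"
      proof cases
        case 1
        then have "q \<in> {u, v}" using q edge_verts[OF uv] w by (auto simp: vwalk_def)
        then show ?thesis using 1 uq by auto
      next
        case 2
        have xy: "(x, y) \<in> parcs G" using 2 w by (auto simp: vwalk_def)
        have xys: "x \<in> set (v # p)" "y \<in> set (v # p)" 
          using 2(1) by (auto dest: vwalk_arcs_in_set)
        then have "{u, v} \<noteq> {x, y}" using uq by auto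
        then have "q \<in> {u, v}" "q \<in> {x, y}" using edge_meet[OF uv xy] q 2 by auto
        then show ?thesis using xys uq by auto
      qed
    qed
    moreover have "Path_Connected.arc (edge_curve dr (v # p))" using 3 Cons w by simp
    ultimately have "Path_Connected.arc (dr u v +++ edge_curve dr (v # p))"
      using edge_curve_props[OF w] Cons uv
      by (intro arc_join) (simp_all add: edge_arc edge_finish)
    then show ?thesis using Cons by simp
  qed
qed auto

lemma cycle_curve:
  assumes "distinct cs" "3 \<le> length cs" "vwalk (cs @ [hd cs]) (with_proj G)"
  shows "simple_path (edge_curve dr (cs @ [hd cs]))"
    "pathfinish (edge_curve dr (cs @ [hd cs])) = pathstart (edge_curve dr (cs @ [hd cs]))"
    "path_image (edge_curve dr (cs @ [hd cs])) = path_image (walk_curve dr (cs @ [hd cs]))"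
proof -
  obtain u v w p where cs: "cs = u # v # w # p"
    using assms(2) by (auto simp: numeral_3_eq_3 Suc_le_length_iff)
  let ?r = "v # w # p @ [u]"
  have w: "vwalk ?r (with_proj G)" and uv: "(u, v) \<in> parcs G" using assms cs by (auto simp: vwalk_Cons2)
  have a: "Path_Connected.arc (edge_curve dr ?r)"
    using assms cs w by (intro edge_curve_arc) auto
  have img: "path_image (edge_curve dr ?r) =
        set ?r \<union> (\<Union>(x, y)\<in>set (vwalk_arcs ?r). path_image (dr x y))"
    using edge_curve_props[OF w] walk_curve_props[OF w] by simp
  show "path_image (edge_curve dr (cs @ [hd cs])) = path_image (walk_curve dr (cs @ [hd cs]))"
    and cl: "pathfinish (edge_curve dr (cs @ [hd cs])) = pathstart (edge_curve dr (cs @ [hd cs]))"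
    using edge_curve_props[OF assms(3)] unfolding cs by simp_all
  \<comment> \<open>A cycle of at least three distinct vertices does not run back along its first
    edge, so that edge meets the rest of the cycle in its two ends only.\<close>
  have arcs_ne: "{x, y} \<noteq> {u, v}" if "(x, y) \<in> set (vwalk_arcs ?r)" for x y
  proof -
    have "(x, y) = (v, w) \<or> (x, y) \<in> set (vwalk_arcs (w # p @ [u]))" using that by simp
    moreover have "v \<notin> set (w # p @ [u])" "u \<noteq> w" "u \<noteq> v" using assms(1) cs by auto
    ultimately show ?thesis
      using vwalk_arcs_in_set[of x y "w # p @ [u]"] unfolding doubleton_eq_iff by blast
  qed
  have "path_image (dr u v) \<inter> path_image (edge_curve dr ?r) \<subseteq> {u, v}"
  proof
    fix q assume q: "q \<in> path_image (dr u v) \<inter> path_image (edge_curve dr ?r)"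
    consider "q \<in> set ?r" | x y where "(x, y) \<in> set (vwalk_arcs ?r)" "q \<in> path_image (dr x y)"
      using q img by auto
    then show "q \<in> {u, v}"
    proof cases
      case 1
      then show ?thesis using q edge_verts[OF uv] w by (auto simp: vwalk_def)
    next
      case 2
      have xy: "(x, y) \<in> parcs G" using 2 w by (auto simp: vwalk_def)
      then show ?thesis using edge_meet(1)[OF uv xy] arcs_ne[OF 2(1)] q 2 by auto
    qed
  qed
  then have "simple_path (dr u v +++ edge_curve dr ?r)"
    using a uv edge_curve_props[OF w]
    by (intro simple_path_join_loop) (simp_all add: edge_arc edge_start edge_finish)
  then show "simple_path (edge_curve dr (cs @ [hd cs]))" using cs by simp
qed

end

section \<open>Facial triangles\<close>

lemma connected_subset_if_disjoint_frontier:
  fixes F U :: "'a::topological_space set"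
  assumes "connected U" "F \<inter> U \<noteq> {}" "U \<inter> frontier F = {}"
  shows "U \<subseteq> F"
  using connected_Int_frontier[OF assms(1), of F] assms by blast

text \<open>Of a face, \<open>bounded_by_cycle\<close> prescribes only the frontier. Two overlapping
  connected sets, each of which avoids the frontier of the other, coincide; this identifies the face
  with one of the two sides of the Jordan curve.\<close>

lemma region_of_Jordan_frontier:
  fixes g :: "real \<Rightarrow> complex"
  assumes g: "simple_path g" "pathfinish g = pathstart g"
    and F: "connected F" "F \<noteq> {}" "open F" "frontier F = path_image g"
  shows "F = inside (path_image g) \<or> F = outside (path_image g)"
proof -
  let ?I = "inside (path_image g)" and ?O = "outside (path_image g)"
  have J: "connected ?I" "connected ?O" "frontier ?I = path_image g" "frontier ?O = path_image g"
    using Jordan_inside_outside[OF g] by blast+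
  have disj: "F \<inter> path_image g = {}" using F frontier_disjoint_eq[of F] by (simp add: Int_commute)
  have I: "?I \<inter> path_image g = {}" and O: "?O \<inter> path_image g = {}"
    by (simp_all add: inside_no_overlap outside_no_overlap)
  have eq: "F = U" if U: "connected U" "frontier U = path_image g" "U \<inter> path_image g = {}" "F \<inter> U \<noteq> {}" for U
  proof
    show "U \<subseteq> F" using connected_subset_if_disjoint_frontier[of U F] U F by simp
    show "F \<subseteq> U" using connected_subset_if_disjoint_frontier[of F U] U F disj by (simp add: Int_commute)
  qed
  have "F \<subseteq> ?I \<union> ?O" using disj inside_Un_outside[of "path_image g"] by blast
  then have "F \<inter> ?I \<noteq> {} \<or> F \<inter> ?O \<noteq> {}" using F(2) by blast
  then show ?thesis using eq[of ?I] eq[of ?O] J I O by blast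
qed

lemma ex_nat_split: "(\<exists>i. P i) \<longleftrightarrow> P 0 \<or> (\<exists>i. P (Suc i))"
  by (metis not0_implies_Suc)

lemma in_set_vwalk_arcs_iff:
  "(x, y) \<in> set (vwalk_arcs p) \<longleftrightarrow> (\<exists>i. Suc i < length p \<and> p ! i = x \<and> p ! Suc i = y)"
proof (induction p rule: vwalk_arcs.induct)
  case (3 a b p)
  have "(\<exists>i. Suc i < length (a # b # p) \<and> (a # b # p) ! i = x \<and> (a # b # p) ! Suc i = y) \<longleftrightarrow>
     (a = x \<and> b = y) \<or> (\<exists>i. Suc i < length (b # p) \<and> (b # p) ! i = x \<and> (b # p) ! Suc i = y)"
    by (subst ex_nat_split) simp
  then show ?case using 3 by auto
qed auto

lemma cycle_arc_rotate:
  assumes "(a, b) \<in> set (vwalk_arcs (cs @ [hd cs]))" "cs \<noteq> []"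
  obtains k where "rotate k cs ! 0 = a" "rotate k cs ! (1 mod length cs) = b"
proof -
  obtain i where i: "Suc i < length (cs @ [hd cs])" "(cs @ [hd cs]) ! i = a" "(cs @ [hd cs]) ! Suc i = b"
    using assms(1) unfolding in_set_vwalk_arcs_iff by blast
  have "rotate i cs ! 0 = a" using i assms(2) by (simp add: nth_rotate nth_append)
  moreover have "rotate i cs ! (1 mod length cs) = b"
    using i assms(2) by (cases "Suc i = length cs")
     (auto simp: nth_rotate nth_append hd_conv_nth mod_simps)
  ultimately show ?thesis by (rule that)
qed

lemma vwalk_cycle_rotate:
  assumes "vwalk (cs @ [hd cs]) H" "cs \<noteq> []"
  shows "vwalk (rotate k cs @ [hd (rotate k cs)]) H"
proof (induction k)
  case (Suc k)
  show ?case
  proof (cases "rotate k cs")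
    case (Cons x xs)
    show ?thesis
    proof (cases xs)
      case Nil
      then show ?thesis using Suc Cons by simp
    next
      case (Cons y ys)
      then have rc: "rotate k cs = x # y # ys" using \<open>rotate k cs = x # xs\<close> by simp
      have w: "vwalk (x # y # ys @ [x]) H" using Suc rc by simp
      have "set (vwalk_arcs (x # y # ys @ [x])) = insert (x, y) (set (vwalk_arcs (y # ys @ [x])))" by simp
      moreover have "vwalk_arcs (y # ys @ [x, y]) = vwalk_arcs (y # ys @ [x]) @ [(x, y)]"
        using vwalk_arcs_append[of "y # ys @ [x]" "[y]"] by simp
      ultimately show ?thesis using w rc by (auto simp: vwalk_def)
    qed
  qed (use assms in auto)
qed (use assms in auto)

context planar_map begin

definition tri :: "complex \<Rightarrow> complex \<Rightarrow> complex \<Rightarrow> real \<Rightarrow> complex" where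
  "tri x y z = edge_curve dr [x, y, z, x]"

text \<open>Facial triangles with their vertices in counterclockwise order.\<close>

definition faces :: "(complex \<times> complex \<times> complex) set" where
  "faces = {(x, y, z). (x, y) \<in> parcs G \<and> (y, z) \<in> parcs G \<and> (z, x) \<in> parcs G \<and>
     inside (path_image (tri x y z)) \<inter> support G dr = {} \<and>
     (\<forall>q\<in>inside (path_image (tri x y z)). winding_number (tri x y z) q = 1)}"

lemma facesD:
  assumes "(x, y, z) \<in> faces"
  shows "(x, y) \<in> parcs G" "(y, z) \<in> parcs G" "(z, x) \<in> parcs G" "x \<noteq> y" "y \<noteq> z" "z \<noteq> x"
    "inside (path_image (tri x y z)) \<inter> support G dr = {}"
    "q \<in> inside (path_image (tri x y z)) \<Longrightarrow> winding_number (tri x y z) q = 1"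
  using assms arcs_neq unfolding faces_def by auto

lemma finite_faces: "finite faces"
proof (rule finite_subset)
  show "faces \<subseteq> pverts G \<times> pverts G \<times> pverts G"
    using in_arcsD1 in_arcsD2 by (auto simp: faces_def)
qed (simp add: pair_finite_verts)

lemma tri_props:
  assumes "(x, y) \<in> parcs G" "(y, z) \<in> parcs G" "(z, x) \<in> parcs G"
  shows "simple_path (tri x y z)" "pathfinish (tri x y z) = pathstart (tri x y z)" "path (tri x y z)"
    "path_image (tri x y z) = path_image (dr x y) \<union> path_image (dr y z) \<union> path_image (dr z x)"
    "path_image (tri x y z) \<subseteq> support G dr"
    "q \<notin> path_image (tri x y z) \<Longrightarrow> winding_number (tri x y z) q =
       winding_number (dr x y) q + winding_number (dr y z) q + winding_number (dr z x) q"
proof -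
  have "vwalk ([x, y, z] @ [hd [x, y, z]]) (with_proj G)"
    using assms in_arcsD1 by (auto simp: vwalk_def)
  moreover have "distinct [x, y, z]" using assms arcs_neq by auto
  ultimately show s: "simple_path (tri x y z)" and "pathfinish (tri x y z) = pathstart (tri x y z)"
    using cycle_curve[of "[x, y, z]"] by (simp_all add: tri_def)
  then show "path (tri x y z)" by (simp add: simple_path_imp_path)
  show i: "path_image (tri x y z) = path_image (dr x y) \<union> path_image (dr y z) \<union> path_image (dr z x)"
    using assms by (simp add: tri_def path_image_join edge_start edge_finish Un_assoc)
  show "path_image (tri x y z) \<subseteq> support G dr"
    unfolding i using assms edge_in_support by blast
  show "winding_number (tri x y z) q =
       winding_number (dr x y) q + winding_number (dr y z) q + winding_number (dr z x) q"
    if "q \<notin> path_image (tri x y z)"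
    using that assms unfolding i
    by (simp add: tri_def winding_number_join path_image_join edge_start edge_finish)
qed

lemma winding_edge_reverse:
  assumes "(x, y) \<in> parcs G" "q \<notin> path_image (dr x y)"
  shows "winding_number (dr y x) q = - winding_number (dr x y) q"
  using assms by (simp add: edge_reverse winding_number_reversepath)

lemma tri_rotate:
  assumes "(x, y) \<in> parcs G" "(y, z) \<in> parcs G" "(z, x) \<in> parcs G"
  shows "path_image (tri y z x) = path_image (tri x y z)"
    "q \<notin> path_image (tri x y z) \<Longrightarrow> winding_number (tri y z x) q = winding_number (tri x y z) q"
  using tri_props[OF assms] tri_props[OF assms(2,3,1)] by auto

lemma tri_flip:
  assumes "(x, y) \<in> parcs G" "(y, z) \<in> parcs G" "(z, x) \<in> parcs G"
  shows "path_image (tri x z y) = path_image (tri x y z)"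
    "q \<notin> path_image (tri x y z) \<Longrightarrow> winding_number (tri x z y) q = - winding_number (tri x y z) q"
proof -
  note a = arcs_sym[OF assms(3)] arcs_sym[OF assms(2)] arcs_sym[OF assms(1)]
  show "path_image (tri x z y) = path_image (tri x y z)"
    using tri_props(4)[OF assms] tri_props(4)[OF a] edge_image_sym[OF assms(1)] edge_image_sym[OF assms(2)]
      edge_image_sym[OF assms(3)] by blast
  then show "q \<notin> path_image (tri x y z) \<Longrightarrow> winding_number (tri x z y) q = - winding_number (tri x y z) q"
    using tri_props(4)[OF assms] tri_props(6)[OF assms, of q] tri_props(6)[OF a, of q]
      winding_edge_reverse[OF assms(1), of q] winding_edge_reverse[OF assms(2), of q] winding_edge_reverse[OF assms(3), of q]
    by simp
qed

lemma inside_tri_disjoint: "q \<in> inside (path_image (tri x y z)) \<Longrightarrow> q \<notin> path_image (tri x y z)"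
  by (meson disjoint_iff inside_no_overlap)

lemma faces_rotate:
  assumes "(x, y, z) \<in> faces"
  shows "(y, z, x) \<in> faces"
  using facesD[OF assms] tri_rotate[of x y z] inside_tri_disjoint[of _ x y z]
  unfolding faces_def by auto

lemma winding_tri_outside:
  assumes "(x, y, z) \<in> faces" "q \<notin> support G dr" "q \<notin> inside (path_image (tri x y z))"
  shows "winding_number (tri x y z) q = 0"
proof -
  note t = tri_props[OF facesD(1-3)[OF assms(1)]]
  have "q \<in> outside (path_image (tri x y z))"
    using assms t(5) inside_Un_outside[of "path_image (tri x y z)"] by blast
  then show ?thesis using t winding_number_zero_in_outside by blast
qed

lemma winding_edge_isCont:
  assumes "(x, y) \<in> parcs G" "p \<notin> path_image (dr x y)"
  shows "isCont (winding_number (dr x y)) p"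
  using continuous_at_winding_number[of "dr x y" p] assms by simp

text \<open>A face listed as \<open>(a, b, c)\<close> lies to the left of the edge from
  \<open>a\<close> to \<open>b\<close>. Two such faces with different third vertices would be
  disjoint and both accumulate at an inner point \<open>p\<close> of the edge. In the difference of
  their winding numbers the common edge cancels, so the difference is continuous at
  \<open>p\<close>, yet it equals 1 in one face and -1 in the other.\<close>

lemma faces_third_unique:
  assumes c: "(a, b, c) \<in> faces" and d: "(a, b, d) \<in> faces"
  shows "c = d"
proof (rule ccontr)
  assume "c \<noteq> d"
  have ab: "(a, b) \<in> parcs G" using facesD(1)[OF c] .
  note tc = tri_props[OF facesD(1-3)[OF c]] and td = tri_props[OF facesD(1-3)[OF d]]
  let ?I = "inside (path_image (tri a b c))" and ?I' = "inside (path_image (tri a b d))"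
  have Jc: "connected ?I" "?I \<noteq> {}" "frontier ?I = path_image (tri a b c)"
    using Jordan_inside_outside[OF tc(1,2)] by blast+
  have Jd: "connected ?I'" "?I' \<noteq> {}" "frontier ?I' = path_image (tri a b d)"
    using Jordan_inside_outside[OF td(1,2)] by blast+
  define p where "p = dr a b (1/2)"
  have p: "p \<in> path_image (dr a b)" by (auto simp: p_def path_image_def)
  have inj: "inj_on (dr a b) {0..1}" using edge_arc[OF ab] by (simp add: Path_Connected.arc_def)
  have pab: "p \<noteq> a" "p \<noteq> b"
    using inj_onD[OF inj, of "1/2" 0] inj_onD[OF inj, of "1/2" 1] edge_start[OF ab] edge_finish[OF ab]
    by (auto simp: p_def pathstart_def pathfinish_def)
  have off: "p \<notin> path_image (dr x y)" if "(x, y) \<in> parcs G" "{x, y} \<noteq> {a, b}" for x y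
    using edge_meet(1)[OF ab that(1)] that p pab by auto
  have nin: "{b, c} \<noteq> {a, b}" "{c, a} \<noteq> {a, b}" "{b, d} \<noteq> {a, b}" "{d, a} \<noteq> {a, b}"
    using facesD(4-6)[OF c] facesD(4-6)[OF d] by (auto simp: doubleton_eq_iff)
  let ?h = "\<lambda>q. winding_number (dr b c) q + winding_number (dr c a) q
     - winding_number (dr b d) q - winding_number (dr d a) q"
  have cont: "isCont ?h p"
    using facesD(2,3)[OF c] facesD(2,3)[OF d] nin by (intro continuous_intros winding_edge_isCont off)
  have noteq: "?I \<noteq> ?I'"
  proof
    assume "?I = ?I'"
    then have "path_image (tri a b c) = path_image (tri a b d)"
      using arg_cong[of ?I ?I' frontier] unfolding Jc(3) Jd(3) by blast
    then have "c \<in> path_image (tri a b d)"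
      using tc(4) edge_ends_in[OF facesD(2)[OF c]] by blast
    then have "c \<in> path_image (dr a b) \<inter> pverts G \<or> c \<in> path_image (dr b d) \<inter> pverts G \<or> c \<in> path_image (dr d a) \<inter> pverts G"
      using td(4) in_arcsD1[OF facesD(3)[OF c]] by auto
    then have "c \<in> {a, b} \<or> c \<in> {b, d} \<or> c \<in> {d, a}"
      unfolding edge_verts[OF facesD(1)[OF d]] edge_verts[OF facesD(2)[OF d]] edge_verts[OF facesD(3)[OF d]] .
    then show False using facesD(4-6)[OF c] \<open>c \<noteq> d\<close> by auto
  qed
  have comp: "?I \<inter> ?I' = {}"
  proof (rule ccontr)
    assume ne: "?I \<inter> ?I' \<noteq> {}"
    have d: "?I \<inter> frontier ?I' = {}" "?I' \<inter> frontier ?I = {}"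
      using facesD(7)[OF c] facesD(7)[OF d] tc(5) td(5) Jc(3) Jd(3) by blast+
    have "?I \<subseteq> ?I'"
      using connected_subset_if_disjoint_frontier[OF Jc(1) _ d(1)] ne by (simp add: Int_commute)
    moreover have "?I' \<subseteq> ?I"
      using connected_subset_if_disjoint_frontier[OF Jd(1) _ d(2)] ne by (simp add: Int_commute)
    ultimately show False using noteq by blast
  qed
  have "\<forall>\<^sub>F q in at p. dist (?h q) (?h p) < 1/2"
    by (rule tendstoD[OF cont[unfolded isCont_def]]) simp
  then have "\<forall>\<^sub>F q in nhds p. dist (?h q) (?h p) < 1/2"
    unfolding eventually_nhds_conv_at by simp
  then obtain N where N: "open N" "p \<in> N" "\<And>q. q \<in> N \<Longrightarrow> dist (?h q) (?h p) < 1/2"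
    unfolding eventually_nhds by auto
  have val: "?h q = winding_number (tri a b c) q - winding_number (tri a b d) q"
    if q: "q \<notin> support G dr" for q
  proof -
    have "q \<notin> path_image (tri a b c)" "q \<notin> path_image (tri a b d)" using q tc(5) td(5) by blast+
    then show ?thesis using tc(6)[of q] td(6)[of q] by simp
  qed
  have "p \<in> closure ?I" "p \<in> closure ?I'"
    using Jc(3) Jd(3) p tc(4) td(4) unfolding frontier_def by blast+
  then have "?I \<inter> N \<noteq> {}" "?I' \<inter> N \<noteq> {}"
    using N open_Int_closure_eq_empty[of N ?I] open_Int_closure_eq_empty[of N ?I'] by blast+
  then obtain q q' where q: "q \<in> N" "q \<in> ?I" "q' \<in> N" "q' \<in> ?I'" by blast
  have qs: "q \<notin> support G dr" "q' \<notin> support G dr" using q facesD(7)[OF c] facesD(7)[OF d] by blast+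
  have "?h q = 1" using val[OF qs(1)] facesD(8)[OF c q(2)] winding_tri_outside[OF d qs(1)] q(2) comp by (simp add: disjoint_iff)
  moreover have "?h q' = -1" using val[OF qs(2)] facesD(8)[OF d q(4)] winding_tri_outside[OF c qs(2)] q(4) comp by (auto simp: disjoint_iff)
  ultimately have "dist (1::complex) (-1) < 1"
    using dist_triangle_half_l[of "?h q" "?h p" 1 "?h q'"] N(3)[OF q(1)] N(3)[OF q(3)] by simp
  then show False by (simp add: dist_norm)
qed

section \<open>Faces on the two sides of an edge\<close>

definition between :: "complex \<Rightarrow> complex \<Rightarrow> complex set" where
  "between a b = path_image (dr a b) - {a, b}"

lemma between_nonempty:
  assumes ab: "(a, b) \<in> parcs G"
  obtains p where "p \<in> between a b"
proof -
  have "p \<in> path_image (dr a b)" if "p = dr a b (1/2)" for p using that by (auto simp: path_image_def)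
  moreover have inj: "inj_on (dr a b) {0..1}" using edge_arc[OF ab] by (simp add: Path_Connected.arc_def)
  have "dr a b (1/2) \<noteq> a" "dr a b (1/2) \<noteq> b"
    using inj_onD[OF inj, of "1/2" 0] inj_onD[OF inj, of "1/2" 1] edge_start[OF ab] edge_finish[OF ab]
    by (auto simp: pathstart_def pathfinish_def)
  ultimately show ?thesis by (intro that[of "dr a b (1/2)"]) (simp add: between_def)
qed

lemma between_edge:
  assumes "(a, b) \<in> parcs G" "p \<in> between a b" "(x, y) \<in> parcs G" "p \<in> path_image (dr x y)"
  shows "{x, y} = {a, b}"
  using edge_meet(1)[OF assms(1,3)] assms by (auto simp: between_def)

text \<open>Only finitely many closed sets have to be avoided: the vertices, the other edges, and
  the closures of the faces that do not have \<open>p\<close> on their boundary.\<close>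

lemma between_nbhd:
  assumes ab: "(a, b) \<in> parcs G" and p: "p \<in> between a b"
  obtains N where "open N" "p \<in> N" "N \<inter> support G dr \<subseteq> path_image (dr a b)"
    "\<And>x y z. (x, y, z) \<in> faces \<Longrightarrow> N \<inter> inside (path_image (tri x y z)) \<noteq> {} \<Longrightarrow>
        p \<in> path_image (tri x y z)"
proof -
  let ?E = "{e \<in> parcs G. {fst e, snd e} \<noteq> {a, b}}"
  let ?F = "{(x, y, z) \<in> faces. p \<notin> path_image (tri x y z)}"
  define C where "C = (pverts G \<union> (\<Union>e\<in>?E. path_image (dr (fst e) (snd e)))) \<union>
     (\<Union>(x, y, z)\<in>?F. closure (inside (path_image (tri x y z))))"
  have fin: "finite ?E" "finite ?F"
    using pair_finite_arcs finite_faces by (auto intro: finite_subset)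
  have cl: "closed (path_image (dr (fst e) (snd e)))" if "e \<in> ?E" for e
    using that by (intro closed_path_image) (simp add: edge_path)
  have "closed C" unfolding C_def
    using fin cl pair_finite_verts by (intro closed_Un closed_UN) (auto simp: finite_imp_closed)
  moreover have "p \<notin> C"
  proof -
    have "p \<in> support G dr" using p edge_in_support[OF ab] by (auto simp: between_def)
    have "p \<notin> pverts G" using p edge_verts[OF ab] by (auto simp: between_def)
    moreover have "p \<notin> path_image (dr (fst e) (snd e))" if "e \<in> ?E" for e
      using between_edge[OF ab p, of "fst e" "snd e"] that by auto
    moreover have "p \<notin> closure (inside (path_image (tri x y z)))"
      if f: "(x, y, z) \<in> faces" "p \<notin> path_image (tri x y z)" for x y z
    proof -
      note t = tri_props[OF facesD(1-3)[OF f(1)]]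
      have "frontier (inside (path_image (tri x y z))) = path_image (tri x y z)"
        using Jordan_inside_outside[OF t(1,2)] by blast
      then have "closure (inside (path_image (tri x y z))) = inside (path_image (tri x y z)) \<union> path_image (tri x y z)"
        by (simp only: closure_Un_frontier)
      then show ?thesis using f facesD(7)[OF f(1)] \<open>p \<in> support G dr\<close> by blast
    qed
    ultimately show ?thesis unfolding C_def by blast
  qed
  moreover have "- C \<inter> support G dr \<subseteq> path_image (dr a b)"
  proof
    fix q assume q: "q \<in> - C \<inter> support G dr"
    then obtain x y where xy: "(x, y) \<in> parcs G" "q \<in> path_image (dr x y)"
      unfolding C_def support_def by blast
    have "{x, y} = {a, b}" 
    proof (rule ccontr)
      assume "{x, y} \<noteq> {a, b}"
      then have "(x, y) \<in> ?E" using xy by simp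
      then show False using q xy unfolding C_def by force
    qed
    then show "q \<in> path_image (dr a b)"
      using xy edge_image_sym[OF ab] unfolding doubleton_eq_iff by blast
  qed
  moreover have "p \<in> path_image (tri x y z)"
    if "(x, y, z) \<in> faces" "- C \<inter> inside (path_image (tri x y z)) \<noteq> {}" for x y z
  proof (rule ccontr)
    assume "p \<notin> path_image (tri x y z)"
    then have "(x, y, z) \<in> ?F" using that by simp
    then have "closure (inside (path_image (tri x y z))) \<subseteq> C" unfolding C_def by force
    then show False using that(2) closure_subset[of "inside (path_image (tri x y z))"] by blast
  qed
  ultimately show ?thesis by (intro that[of "- C"]) auto
qed

lemma face_at_edge:
  assumes ab: "(a, b) \<in> parcs G" and p: "p \<in> between a b"
    and f: "(x, y, z) \<in> faces" "p \<in> path_image (tri x y z)"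
  obtains c where "(a, b, c) \<in> faces" "path_image (tri a b c) = path_image (tri x y z)"
  | c where "(b, a, c) \<in> faces" "path_image (tri b a c) = path_image (tri x y z)"
proof -
  note d = facesD(1-3)[OF f(1)]
  have r1: "(y, z, x) \<in> faces" "path_image (tri y z x) = path_image (tri x y z)"
    using faces_rotate[OF f(1)] tri_rotate(1)[OF d] by auto
  have r2: "(z, x, y) \<in> faces" "path_image (tri z x y) = path_image (tri x y z)"
    using faces_rotate[OF r1(1)] tri_rotate(1)[OF d(2,3,1)] r1 by auto
  have "{x, y} = {a, b} \<or> {y, z} = {a, b} \<or> {z, x} = {a, b}"
    using between_edge[OF ab p d(1)] between_edge[OF ab p d(2)] between_edge[OF ab p d(3)] f(2)
    unfolding tri_props(4)[OF d] by blast
  then show ?thesis using that f(1) r1 r2 unfolding doubleton_eq_iff by blast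
qed

end

section \<open>Inner faces and the outer cycle of a triangulation\<close>

context triangulation_with_boundary begin

text \<open>The cycle supplied by \<open>inner_faces\<close> may run clockwise. Its winding number
  on the face is then -1, and exchanging two vertices gives the triple in
  \<open>faces\<close>.\<close>

lemma bounded_face:
  assumes F: "F \<in> components (- support G dr)" "bounded F"
  obtains x y z where "(x, y, z) \<in> faces" "F = inside (path_image (tri x y z))"
proof -
  obtain cs where cs: "length cs = 3" "bounded_by_cycle G dr F cs" using inner_faces[OF F] by blast
  then obtain x y z where xyz: "cs = [x, y, z]" by (auto simp: numeral_3_eq_3 length_Suc_conv)
  have e: "(x, y) \<in> parcs G" "(y, z) \<in> parcs G" "(z, x) \<in> parcs G"
    using cs xyz by (auto simp: bounded_by_cycle_def vwalk_def)
  note t = tri_props[OF e]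
  have fr: "frontier F = path_image (tri x y z)"
    using cs xyz cycle_curve(3)[of cs] by (simp add: bounded_by_cycle_def tri_def)
  have oF: "open F" using F(1) compact_support by (meson compact_imp_closed open_Compl open_components)
  have "F = inside (path_image (tri x y z)) \<or> F = outside (path_image (tri x y z))"
    using in_components_connected[OF F(1)] in_components_nonempty[OF F(1)] oF fr t(1,2)
    by (intro region_of_Jordan_frontier) auto
  moreover have "\<not> bounded (outside (path_image (tri x y z)))" using Jordan_inside_outside[OF t(1,2)] by blast
  ultimately have Fi: "F = inside (path_image (tri x y z))" using F(2) by blast
  have disj: "F \<inter> support G dr = {}" using in_components_subset[OF F(1)] by blast
  have conn: "connected F" using in_components_connected[OF F(1)] .
  have "F \<noteq> {}" using in_components_nonempty[OF F(1)] .
  then obtain q0 where q0: "q0 \<in> F" by blast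
  have q0J: "q0 \<notin> path_image (tri x y z)" using q0 inside_tri_disjoint Fi by blast
  have const: "winding_number (tri x y z) q = winding_number (tri x y z) q0" if "q \<in> F" for q
    using winding_number_eq[OF t(3,2) that q0 conn] disj t(5) by blast
  have "\<bar>Re (winding_number (tri x y z) q0)\<bar> = 1"
    using simple_closed_path_abs_winding_number_inside[OF t(1)] q0 Fi by blast
  moreover have "winding_number (tri x y z) q0 \<in> {-1, 0, 1}"
    by (rule simple_closed_path_winding_number_cases[OF t(1,2) q0J])
  ultimately consider "winding_number (tri x y z) q0 = 1" | "winding_number (tri x y z) q0 = -1" by auto
  then show ?thesis
  proof cases
    case 1
    then have "(x, y, z) \<in> faces" unfolding faces_def using e disj Fi const by auto
    then show ?thesis using that Fi by blast
  next
    case 2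
    note fl = tri_flip[OF e]
    have "winding_number (tri x z y) q = 1" if "q \<in> F" for q
      using const[OF that] 2 fl(2)[of q] that Fi inside_tri_disjoint[of q x y z] by simp
    then have "(x, z, y) \<in> faces" 
      using disj Fi arcs_sym[OF e(1)] arcs_sym[OF e(2)] arcs_sym[OF e(3)] by (auto simp: faces_def fl(1))
    then show ?thesis using that[of x z y] Fi by (simp add: fl(1))
  qed
qed

lemma face_or_outside:
  assumes "q \<notin> support G dr" "q \<notin> outside (support G dr)"
  obtains x y z where "(x, y, z) \<in> faces" "q \<in> inside (path_image (tri x y z))"
proof -
  let ?F = "connected_component_set (- support G dr) q"
  have "?F \<in> components (- support G dr)" "bounded ?F" "q \<in> ?F"
    using assms by (auto simp: componentsI outside_def connected_component_refl_eq)
  then show ?thesis using bounded_face[of ?F] that by metis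
qed

lemma outer_cycle:
  obtains cs where "3 \<le> length cs" "distinct cs" "vwalk (cs @ [hd cs]) (with_proj G)"
    "outside (support G dr) = outside (path_image (walk_curve dr (cs @ [hd cs])))"
    "frontier (outside (support G dr)) = path_image (walk_curve dr (cs @ [hd cs]))"
    "simple_path (edge_curve dr (cs @ [hd cs]))"
    "pathfinish (edge_curve dr (cs @ [hd cs])) = pathstart (edge_curve dr (cs @ [hd cs]))"
    "path_image (edge_curve dr (cs @ [hd cs])) = path_image (walk_curve dr (cs @ [hd cs]))"
proof -
  obtain cs where cs: "3 \<le> length cs" "distinct cs" "vwalk (cs @ [hd cs]) (with_proj G)"
    "frontier (outside (support G dr)) = path_image (walk_curve dr (cs @ [hd cs]))"
    using outer_face unfolding bounded_by_cycle_def by blast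
  note c = cycle_curve[OF cs(2,1,3)]
  let ?U = "outside (support G dr)"
  have bs: "bounded (support G dr)" using compact_support compact_imp_bounded by blast
  have "connected ?U" using connected_outside[OF bs] by simp
  moreover have "open ?U" using compact_support by (simp add: open_outside compact_imp_closed)
  moreover have ub: "\<not> bounded ?U" using unbounded_outside[OF bs] by simp
  moreover from ub have "?U \<noteq> {}" by auto
  ultimately have "?U = inside (path_image (edge_curve dr (cs @ [hd cs]))) \<or>
      ?U = outside (path_image (edge_curve dr (cs @ [hd cs])))"
    using c cs(4) by (intro region_of_Jordan_frontier) auto
  moreover have "bounded (inside (path_image (edge_curve dr (cs @ [hd cs]))))"
    using Jordan_inside_outside[OF c(1,2)] by blast
  ultimately have "?U = outside (path_image (walk_curve dr (cs @ [hd cs])))"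
    using ub c(3) by auto
  then show ?thesis using that[of cs] cs c by blast
qed

lemma outer_cycle_edge:
  assumes cs: "vwalk (cs @ [hd cs]) (with_proj G)"
    and ab: "(a, b) \<in> parcs G" and p: "p \<in> between a b" "p \<in> path_image (walk_curve dr (cs @ [hd cs]))"
  shows "(a, b) \<in> set (vwalk_arcs (cs @ [hd cs])) \<or> (b, a) \<in> set (vwalk_arcs (cs @ [hd cs]))"
proof -
  have "p \<notin> pverts G" using p edge_verts[OF ab] by (auto simp: between_def)
  then have "p \<notin> set (cs @ [hd cs])" using cs unfolding vwalk_def by auto
  then obtain x y where xy: "(x, y) \<in> set (vwalk_arcs (cs @ [hd cs]))" "p \<in> path_image (dr x y)"
    using p(2) walk_curve_props[OF cs] by blast
  have "(x, y) \<in> parcs G" using xy(1) cs by (auto simp: vwalk_def)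
  then have "{x, y} = {a, b}" using between_edge[OF ab p(1)] xy(2) by blast
  then show ?thesis using xy(1) unfolding doubleton_eq_iff by blast
qed

lemma outer_verts_cycle:
  assumes cs: "vwalk (cs @ [hd cs]) (with_proj G)" "cs \<noteq> []"
    "frontier (outside (support G dr)) = path_image (walk_curve dr (cs @ [hd cs]))"
  shows "outer_verts G dr = set cs"
proof -
  have "v \<in> set cs" if v: "v \<in> pverts G" "v \<in> path_image (walk_curve dr (cs @ [hd cs]))" for v
  proof -
    have "v \<in> set (cs @ [hd cs]) \<or> (\<exists>x y. (x, y) \<in> set (vwalk_arcs (cs @ [hd cs])) \<and> v \<in> path_image (dr x y))"
      using v walk_curve_props[OF cs(1)] by blast
    then show ?thesis
    proof
      assume "\<exists>x y. (x, y) \<in> set (vwalk_arcs (cs @ [hd cs])) \<and> v \<in> path_image (dr x y)"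
      then obtain x y where xy: "(x, y) \<in> set (vwalk_arcs (cs @ [hd cs]))" "v \<in> path_image (dr x y)" by blast
      have "(x, y) \<in> parcs G" using xy(1) cs by (auto simp: vwalk_def)
      then have "v \<in> {x, y}" using edge_verts v(1) xy(2) by blast
      then show ?thesis using vwalk_arcs_in_set[OF xy(1)] cs(2) by auto
    qed (use cs(2) in auto)
  qed
  moreover have "set cs \<subseteq> pverts G" using cs(1) by (auto simp: vwalk_def)
  moreover have "set cs \<subseteq> path_image (walk_curve dr (cs @ [hd cs]))"
    using walk_curve_props[OF cs(1)] by auto
  ultimately show ?thesis unfolding outer_verts_def cs(3) by blast
qed

text \<open>The drawing has empty interior, so an open set off the outer face cannot consist of
  drawing alone and reaches some inner face.\<close>

lemma face_near:
  assumes "open N" "N \<noteq> {}" "N \<inter> outside (support G dr) = {}"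
  obtains x y z where "(x, y, z) \<in> faces" "N \<inter> inside (path_image (tri x y z)) \<noteq> {}"
proof -
  have "\<not> N \<subseteq> support G dr"
    using assms(1,2) interior_support by (metis interior_maximal subset_empty)
  then obtain q where "q \<in> N" "q \<notin> support G dr" by blast
  then have "q \<notin> outside (support G dr)" using assms(3) by blast
  then obtain x y z where "(x, y, z) \<in> faces" "q \<in> inside (path_image (tri x y z))"
    using face_or_outside[OF \<open>q \<notin> support G dr\<close>] by blast
  then show ?thesis using that[of x y z] \<open>q \<in> N\<close> by blast
qed

text \<open>Each face at the edge produces one on the other side: \<open>p\<close> is also a limit
  of points outside its triangle, so a different face comes near \<open>p\<close>, and by
  \<open>faces_third_unique\<close> that face contains the edge in the opposite direction. Some face
  comes near \<open>p\<close> in the first place because the outer face does not.\<close>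

lemma two_faces_at_inner_edge:
  assumes ab: "(a, b) \<in> parcs G" and p: "p \<in> between a b" "p \<notin> frontier (outside (support G dr))"
  shows "\<exists>c. (a, b, c) \<in> faces" "\<exists>c. (b, a, c) \<in> faces"
proof -
  obtain N0 where N0: "open N0" "p \<in> N0" "N0 \<inter> support G dr \<subseteq> path_image (dr a b)"
    "\<And>x y z. (x, y, z) \<in> faces \<Longrightarrow> N0 \<inter> inside (path_image (tri x y z)) \<noteq> {} \<Longrightarrow>
        p \<in> path_image (tri x y z)"
    using between_nbhd[OF ab p(1)] by metis
  have ps: "p \<in> support G dr" using p edge_in_support[OF ab] by (auto simp: between_def)
  then have "p \<notin> outside (support G dr)" using outside_no_overlap by blast
  then have pc: "p \<notin> closure (outside (support G dr))" using p(2) by (simp add: closure_Un_frontier)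
  define N where "N = N0 - closure (outside (support G dr))"
  have N: "open N" "p \<in> N" "N \<inter> outside (support G dr) = {}" "N \<subseteq> N0"
    using N0 pc closure_subset[of "outside (support G dr)"] by (auto simp: N_def)
  have key: "\<exists>d. (v, u, d) \<in> faces" if c: "(u, v, c) \<in> faces" and uv: "{u, v} = {a, b}" for u v c
  proof -
    note t = tri_props[OF facesD(1-3)[OF c]]
    let ?O = "outside (path_image (tri u v c))"
    have "p \<in> path_image (dr u v)"
      using p uv edge_image_sym[OF ab] unfolding between_def doubleton_eq_iff by blast
    then have "p \<in> path_image (tri u v c)" using t(4) by simp
    then have "p \<in> closure ?O"
      using Jordan_inside_outside[OF t(1,2)] unfolding frontier_def by blast
    moreover have oO: "open ?O" using Jordan_inside_outside[OF t(1,2)] by blast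
    ultimately have "N \<inter> ?O \<noteq> {}" using N open_Int_closure_eq_empty[of N ?O] by blast
    then obtain x y z where f: "(x, y, z) \<in> faces" "N \<inter> ?O \<inter> inside (path_image (tri x y z)) \<noteq> {}"
      using face_near[of "N \<inter> ?O"] N oO by (metis Int_assoc Int_empty_right Int_left_commute open_Int)
    have px: "p \<in> path_image (tri x y z)" using N0(4)[OF f(1)] f(2) N(4) by blast
    have ne: "path_image (tri x y z) \<noteq> path_image (tri u v c)"
      using f(2) inside_Int_outside[of "path_image (tri u v c)"] by (metis Int_assoc Int_commute Int_empty_right)
    have uvp: "(u, v) \<in> parcs G" "p \<in> between u v"
      using facesD(1)[OF c] p(1) uv edge_image_sym[OF ab] unfolding between_def doubleton_eq_iff by blast+
    from uvp f(1) px show ?thesis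
    proof (cases rule: face_at_edge)
      case (1 d)
      then show ?thesis using faces_third_unique[OF c, of d] ne by simp
    qed blast
  qed
  obtain x y z where f: "(x, y, z) \<in> faces" "N \<inter> inside (path_image (tri x y z)) \<noteq> {}"
    using face_near[OF N(1) _ N(3)] N(2) by blast
  have "p \<in> path_image (tri x y z)" using N0(4)[OF f(1)] f(2) N(4) by blast
  with ab p(1) f(1) have "(\<exists>c. (a, b, c) \<in> faces) \<or> (\<exists>c. (b, a, c) \<in> faces)"
    by (cases rule: face_at_edge) blast+
  then show "\<exists>c. (a, b, c) \<in> faces" "\<exists>c. (b, a, c) \<in> faces"
    using key by (metis insert_commute)+
qed

lemma face_at_each_edge:
  assumes ab: "(a, b) \<in> parcs G"
  shows "(\<exists>c. (a, b, c) \<in> faces) \<or> (\<exists>c. (b, a, c) \<in> faces)"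
proof -
  obtain p where p: "p \<in> between a b" using between_nonempty[OF ab] by blast
  show ?thesis
  proof (cases "p \<in> frontier (outside (support G dr))")
    case True
    obtain N where N: "open N" "p \<in> N" "N \<inter> support G dr \<subseteq> path_image (dr a b)"
      "\<And>x y z. (x, y, z) \<in> faces \<Longrightarrow> N \<inter> inside (path_image (tri x y z)) \<noteq> {} \<Longrightarrow>
          p \<in> path_image (tri x y z)"
      using between_nbhd[OF ab p] by metis
    obtain cs where cs: "outside (support G dr) = outside (path_image (walk_curve dr (cs @ [hd cs])))"
      "frontier (outside (support G dr)) = path_image (walk_curve dr (cs @ [hd cs]))"
      "simple_path (edge_curve dr (cs @ [hd cs]))"
      "pathfinish (edge_curve dr (cs @ [hd cs])) = pathstart (edge_curve dr (cs @ [hd cs]))"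
      "path_image (edge_curve dr (cs @ [hd cs])) = path_image (walk_curve dr (cs @ [hd cs]))"
      using outer_cycle by metis
    let ?I = "inside (path_image (walk_curve dr (cs @ [hd cs])))"
    have J: "open ?I" "frontier ?I = path_image (walk_curve dr (cs @ [hd cs]))"
      using Jordan_inside_outside[OF cs(3,4)] unfolding cs(5) by blast+
    \<comment> \<open>An edge on the outer cycle is still approached from the inside of that cycle,
      which is disjoint from the outer face.\<close>
    have "p \<in> closure ?I" using J(2) True cs(2) by (auto simp: frontier_def)
    then have "N \<inter> ?I \<noteq> {}" using N(1,2) open_Int_closure_eq_empty[of N ?I] by blast
    moreover have "N \<inter> ?I \<inter> outside (support G dr) = {}"
      unfolding cs(1) using inside_Int_outside by blast
    ultimately obtain x y z where f: "(x, y, z) \<in> faces" "N \<inter> ?I \<inter> inside (path_image (tri x y z)) \<noteq> {}"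
      using face_near[of "N \<inter> ?I"] N(1) J(1) by blast
    have "p \<in> path_image (tri x y z)" using N(4)[OF f(1)] f(2) by blast
    with ab p f(1) show ?thesis by (cases rule: face_at_edge) blast+
  qed (use two_faces_at_inner_edge[OF ab p] in blast)
qed

lemma face_of_inner_edge:
  assumes ab: "(a, b) \<in> parcs G" and "a \<notin> outer_verts G dr \<or> b \<notin> outer_verts G dr"
  shows "\<exists>c. (a, b, c) \<in> faces"
proof -
  obtain p where p: "p \<in> between a b" using between_nonempty[OF ab] by blast
  obtain cs where cs: "3 \<le> length cs" "vwalk (cs @ [hd cs]) (with_proj G)"
    "frontier (outside (support G dr)) = path_image (walk_curve dr (cs @ [hd cs]))"
    using outer_cycle by metis
  have ne: "cs \<noteq> []" using cs(1) by auto
  have "p \<notin> frontier (outside (support G dr))"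
  proof
    assume "p \<in> frontier (outside (support G dr))"
    then have "(a, b) \<in> set (vwalk_arcs (cs @ [hd cs])) \<or> (b, a) \<in> set (vwalk_arcs (cs @ [hd cs]))"
      using outer_cycle_edge[OF cs(2) ab p] cs(3) by simp
    then have "a \<in> set cs" "b \<in> set cs"
      using vwalk_arcs_in_set[of a b "cs @ [hd cs]"] vwalk_arcs_in_set[of b a "cs @ [hd cs]"] ne by auto
    then show False using outer_verts_cycle[OF cs(2) ne cs(3)] assms(2) by simp
  qed
  then show ?thesis using two_faces_at_inner_edge[OF ab p] by blast
qed

text \<open>An edge without a face on one side lies on the outer cycle. Without the two ends of that
  edge the cycle is still a path, along which membership in \<open>X\<close> propagates.\<close>

lemma outer_verts_connected_off_boundary_edge:
  assumes ab: "(a, b) \<in> parcs G" and nf: "\<And>c. (b, a, c) \<notin> faces"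
    and X: "\<And>u w. u \<in> X \<Longrightarrow> (u, w) \<in> parcs G \<Longrightarrow> w \<in> X \<union> {a, b}"
    and o: "t \<in> X" "t \<in> outer_verts G dr" "t \<notin> {a, b}"
  shows "outer_verts G dr \<subseteq> X \<union> {a, b}"
proof -
  obtain p where p: "p \<in> between a b" using between_nonempty[OF ab] by blast
  obtain cs where cs: "3 \<le> length cs" "vwalk (cs @ [hd cs]) (with_proj G)"
    "frontier (outside (support G dr)) = path_image (walk_curve dr (cs @ [hd cs]))"
    "distinct cs"
    using outer_cycle by metis
  have ne: "cs \<noteq> []" using cs(1) by auto
  have ov: "outer_verts G dr = set cs" using outer_verts_cycle[OF cs(2) ne cs(3)] .
  have "p \<in> frontier (outside (support G dr))"
    using two_faces_at_inner_edge(2)[OF ab p] nf by blast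
  then have "(a, b) \<in> set (vwalk_arcs (cs @ [hd cs])) \<or> (b, a) \<in> set (vwalk_arcs (cs @ [hd cs]))"
    using outer_cycle_edge[OF cs(2) ab p] cs(3) by simp
  then obtain u v where uv: "(u, v) \<in> set (vwalk_arcs (cs @ [hd cs]))" "{u, v} = {a, b}" by blast
  obtain k where k: "rotate k cs ! 0 = u" "rotate k cs ! (1 mod length cs) = v"
    using cycle_arc_rotate[OF uv(1) ne] by blast
  have "length (rotate k cs) = length cs" by simp
  then obtain r where r: "rotate k cs = u # v # r"
    using k cs(1) by (cases "rotate k cs"; cases "tl (rotate k cs)") auto
  have "vwalk ((u # v # r) @ [u]) (with_proj G)"
    using vwalk_cycle_rotate[OF cs(2) ne, of k] r by simp
  then have wr: "r = [] \<or> vwalk r (with_proj G)"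
    using vwalk_Cons2[of u v "r @ [u]"] vwalk_consE[of v "r @ [u]"] set_vwalk_arcs_append1[of r "[u]"]
    unfolding vwalk_def by (simp only: append_Cons set_append) blast
  have "set cs = set (rotate k cs)" by simp
  then have sr: "set cs = {u, v} \<union> set r" using r by auto
  have dr': "distinct (u # v # r)" using cs(4) r by (metis distinct_rotate)
  have X': "u' \<in> X \<longleftrightarrow> w' \<in> X" if "(u', w') \<in> parcs G" "u' \<notin> {a, b}" "w' \<notin> {a, b}" for u' w'
    using X[of u' w'] X[of w' u'] that arcs_sym by blast
  have all: "set q \<subseteq> X \<or> set q \<inter> X = {}" if "vwalk q (with_proj G)" "set q \<inter> {a, b} = {}" for q
    using that
  proof (induction q rule: induct_list012)
    case (3 x y zs)
    then show ?case using X'[of x y] by (auto simp: vwalk_Cons2)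
  qed (auto simp: vwalk_def)
  have "t \<in> set r" using o ov sr uv(2) by auto
  moreover have "set r \<inter> {a, b} = {}" using dr' uv(2) by auto
  ultimately have "set r \<subseteq> X" using all[of r] wr o(1) by (metis disjoint_iff empty_iff list.set(1))
  then show ?thesis using ov sr uv(2) by blast
qed

end

context rooted_triangulation begin

text \<open>Otherwise the outer cycle would be the boundary of this face. The outer face and this
  one would then fill the complement of the triangle, and the root, a vertex different from the
  three corners, would have no place left.\<close>

lemma outer_vert_off_face:
  assumes f: "(x, y, z) \<in> faces"
  obtains t where "t \<in> outer_verts G dr" "t \<notin> {x, y, z}"
proof -
  obtain cs where cs: "3 \<le> length cs" "vwalk (cs @ [hd cs]) (with_proj G)"
    "frontier (outside (support G dr)) = path_image (walk_curve dr (cs @ [hd cs]))"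
    "distinct cs" "outside (support G dr) = outside (path_image (walk_curve dr (cs @ [hd cs])))"
    using outer_cycle by metis
  have ne: "cs \<noteq> []" using cs(1) by auto
  have ov: "outer_verts G dr = set cs" using outer_verts_cycle[OF cs(2) ne cs(3)] .
  have "\<not> set cs \<subseteq> {x, y, z}"
  proof
    assume sub: "set cs \<subseteq> {x, y, z}"
    note d = facesD[OF f] and t = tri_props[OF facesD(1-3)[OF f]]
    have c3: "card {x, y, z} = 3" using d by auto
    have "card (set cs) = length cs" using cs(4) distinct_card by blast
    then have l3: "length cs = 3" and "set cs = {x, y, z}"
      using sub cs(1) c3 card_mono[OF _ sub] card_subset_eq[OF _ sub] by auto
    obtain u v w where cse: "cs = [u, v, w]" using l3 by (auto simp: numeral_3_eq_3 length_Suc_conv)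
    have e: "(u, v) \<in> parcs G" "(v, w) \<in> parcs G" "(w, u) \<in> parcs G"
      using cs(2) cse by (auto simp: vwalk_def)
    have uvw: "{u, v, w} = {x, y, z}" using cse \<open>set cs = {x, y, z}\<close> by simp
    have J: "path_image (walk_curve dr (cs @ [hd cs])) = path_image (tri u v w)"
      using cycle_curve(3)[OF cs(4,1,2)] cse by (simp add: tri_def)
    have "path_image (tri u v w) = path_image (tri x y z)"
    proof -
      have r: "path_image (tri y z x) = path_image (tri x y z)" "path_image (tri z x y) = path_image (tri x y z)"
        using tri_rotate(1)[OF d(1,2,3)] tri_rotate(1)[OF d(2,3,1)] by auto
      have s: "path_image (tri x z y) = path_image (tri x y z)" "path_image (tri y x z) = path_image (tri x y z)"
          "path_image (tri z y x) = path_image (tri x y z)"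
        using tri_flip(1)[OF d(1,2,3)] tri_flip(1)[OF d(2,3,1)] tri_flip(1)[OF d(3,1,2)] r by auto
      have "u \<noteq> v" "v \<noteq> w" "u \<noteq> w" using cs(4) cse by auto
      then have "(u = x \<and> v = y \<and> w = z) \<or> (u = y \<and> v = z \<and> w = x) \<or> (u = z \<and> v = x \<and> w = y) \<or>
         (u = x \<and> v = z \<and> w = y) \<or> (u = y \<and> v = x \<and> w = z) \<or> (u = z \<and> v = y \<and> w = x)"
        using uvw by (metis insert_iff empty_iff)
      then show ?thesis using r s by auto
    qed
    then have out: "outside (support G dr) = outside (path_image (tri x y z))" using cs(5) J by simp
    have rv: "\<rho> \<in> support G dr" "\<rho> \<notin> {x, y, z}" "\<rho> \<in> pverts G"
      using root ov \<open>set cs = {x, y, z}\<close> by (auto simp: support_def)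
    have "\<rho> \<notin> path_image (tri x y z)"
      using rv edge_verts[OF d(1)] edge_verts[OF d(2)] edge_verts[OF d(3)] unfolding t(4) by blast
    moreover have "\<rho> \<notin> inside (path_image (tri x y z))" using rv d(7) by blast
    ultimately have "\<rho> \<in> outside (path_image (tri x y z))"
      using inside_Un_outside[of "path_image (tri x y z)"] by blast
    then show False using out rv(1) outside_no_overlap[of "support G dr"] by blast
  qed
  then show ?thesis using that ov by blast
qed

end

section \<open>Cyclic order at a vertex of a face\<close>

lemma winding_number_part_circlepath_centre:
  assumes "0 < r" "a < b"
  shows "winding_number (part_circlepath z r a b) z = of_real ((b - a) / (2 * pi))"
proof -
  have z: "z \<notin> path_image (part_circlepath z r a b)"
    using in_path_image_part_circlepath[of z z r a b] assms by auto
  have "contour_integral (part_circlepath z r a b) (\<lambda>w. 1 / (w - z)) =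
      integral {a..b} (\<lambda>t. 1 / (z + r * cis t - z) * r * \<i> * cis t)"
    by (rule contour_integral_part_circlepath_eq[OF assms(2)])
  also have "\<dots> = integral {a..b} (\<lambda>t. \<i>)"
    using assms(1) by (intro integral_cong) (simp add: field_simps)
  also have "\<dots> = of_real (b - a) * \<i>"
    using assms by (simp add: scaleR_conv_of_real)
  finally have "contour_integral (part_circlepath z r a b) (\<lambda>w. 1 / (w - z)) = of_real (b - a) * \<i>" .
  then show ?thesis
    using winding_number_valid_path[OF valid_path_part_circlepath z] by simp
qed

lemma first_hit_props:
  assumes g: "path g" "0 < \<epsilon>" "\<epsilon> < dist (pathstart g) (pathfinish g)"
  obtains \<tau> where "0 < \<tau>" "\<tau> < 1" "g \<tau> = first_hit g \<epsilon>" "dist (pathstart g) (g \<tau>) = \<epsilon>"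
    "\<And>t. 0 \<le> t \<Longrightarrow> t < \<tau> \<Longrightarrow> dist (pathstart g) (g t) < \<epsilon>"
proof -
  let ?d = "\<lambda>t. dist (pathstart g) (g t)"
  let ?S = "{t \<in> {0..1}. ?d t = \<epsilon>}"
  have cont: "continuous_on {0..1} ?d" using g(1) by (intro continuous_intros) (simp add: path_def)
  have d0: "?d 0 = 0" by (simp add: pathstart_def)
  have ivt: "\<exists>s. 0 \<le> s \<and> s \<le> t \<and> ?d s = \<epsilon>" if "0 \<le> t" "t \<le> 1" "\<epsilon> \<le> ?d t" for t
    using IVT'[of ?d 0 \<epsilon> t] that g(2) d0 continuous_on_subset[OF cont, of "{0..t}"] by auto
  have ne: "?S \<noteq> {}" using ivt[of 1] g(3) by (auto simp: pathfinish_def)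
  have "closed ?S"
    using continuous_closed_preimage[OF cont closed_atLeastAtMost, of "{\<epsilon>}"] by (simp add: vimage_def Int_def conj_commute)
  moreover have bdd: "bdd_below ?S" by (rule bdd_belowI[of _ 0]) auto
  ultimately have inS: "Inf ?S \<in> ?S" using closed_contains_Inf[OF ne] by blast
  have lt: "?d t < \<epsilon>" if t: "0 \<le> t" "t < Inf ?S" for t
  proof (rule ccontr)
    assume "\<not> ?d t < \<epsilon>"
    moreover have "t \<le> 1" using t(2) inS by (metis (no_types, lifting) atLeastAtMost_iff less_le_trans less_imp_le mem_Collect_eq)
    ultimately obtain s where "0 \<le> s" "s \<le> t" "?d s = \<epsilon>" using ivt[of t] t(1) by auto
    then have "s \<in> ?S" using \<open>t \<le> 1\<close> by auto
    then show False using cInf_lower[OF _ bdd] \<open>s \<le> t\<close> t(2) by fastforce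
  qed
  show ?thesis
  proof (rule that[of "Inf ?S"])
    show "0 < Inf ?S" using inS d0 g(2) by (metis (mono_tags, lifting) atLeastAtMost_iff less_eq_real_def less_irrefl mem_Collect_eq)
    show "Inf ?S < 1" using inS g(3) by (cases "Inf ?S = 1") (auto simp: pathfinish_def)
  qed (use inS lt in \<open>auto simp: first_hit_def\<close>)
qed

lemma connected_unbounded_subset_outside:
  assumes "connected C" "C \<inter> S = {}" "\<not> bounded C"
  shows "C \<subseteq> outside S"
proof
  fix q assume "q \<in> C"
  then have "C \<subseteq> connected_component_set (- S) q"
    using assms by (intro connected_component_maximal) auto
  then have "\<not> bounded (connected_component_set (- S) q)" using assms(3) bounded_subset by blast
  then show "q \<in> outside S" using \<open>q \<in> C\<close> assms(2) by (auto simp: outside_def)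
qed

lemma cis_eq_imp_eq:
  assumes "cis a = cis b" "\<bar>a - b\<bar> < 2 * pi"
  shows "a = b"
proof -
  obtain n :: int where n: "a = b + 2 * pi * n"
    using assms(1) sin_cos_eq_iff[of a b] by (auto simp: complex_eq_iff)
  then have "a - b = of_int n * (2 * pi)" by simp
  then have "\<bar>of_int n\<bar> * (2 * pi) < 1 * (2 * pi)" using assms(2) by (simp add: abs_mult)
  then have "\<bar>of_int n :: real\<bar> < 1" by (subst (asm) mult_less_cancel_right) auto
  then have "n = 0" by linarith
  then show ?thesis using n by simp
qed

text \<open>
  If the arc \<open>\<omega>\<close> started inside the counterclockwise sector from \<open>\<eta>\<close> to \<open>\<zeta>\<close>, then rerouting the
  closed curve through \<open>\<eta>\<close>, \<open>\<beta>\<close> and the reverse of \<open>\<zeta>\<close> along the two arcs of a small circle around \<open>x\<close>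
  would produce a simple closed curve with winding number 2.
\<close>

lemma not_ccw_first_hits:
  fixes \<eta> \<omega> \<zeta> \<beta> :: "real \<Rightarrow> complex"
  assumes arcs: "arc \<eta>" "arc \<omega>" "arc \<zeta>"
    and starts: "pathstart \<eta> = x" "pathstart \<omega> = x" "pathstart \<zeta> = x"
    and \<beta>: "path \<beta>" "pathstart \<beta> = pathfinish \<eta>" "pathfinish \<beta> = pathfinish \<zeta>" "x \<notin> path_image \<beta>"
    and disj: "path_image \<eta> \<inter> path_image \<zeta> \<subseteq> {x}" "path_image \<omega> \<inter> path_image \<eta> \<subseteq> {x}"
      "path_image \<omega> \<inter> path_image \<zeta> \<subseteq> {x}"
    and W0: "\<And>q. q \<in> path_image \<omega> \<Longrightarrow> q \<noteq> x \<Longrightarrow> q \<notin> path_image \<beta> \<and>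
       winding_number \<eta> q + winding_number \<beta> q - winding_number \<zeta> q = 0"
    and F: "x \<in> closure F" "\<And>q. q \<in> F \<Longrightarrow> q \<notin> path_image \<eta> \<union> path_image \<beta> \<union> path_image \<zeta> \<and>
       winding_number \<eta> q + winding_number \<beta> q - winding_number \<zeta> q = 1"
    and \<epsilon>: "0 < \<epsilon>" "\<epsilon> < dist x (pathfinish \<eta>)" "\<epsilon> < dist x (pathfinish \<omega>)" "\<epsilon> < dist x (pathfinish \<zeta>)"
  shows "\<not> ccw x (first_hit \<zeta> \<epsilon>) (first_hit \<eta> \<epsilon>) (first_hit \<omega> \<epsilon>)"
proof
  note paths = arcs[THEN arc_imp_path]
  obtain t\<eta> where t\<eta>: "0 < t\<eta>" "t\<eta> < 1" "\<eta> t\<eta> = first_hit \<eta> \<epsilon>" "dist x (\<eta> t\<eta>) = \<epsilon>"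
    "\<And>t. 0 \<le> t \<Longrightarrow> t < t\<eta> \<Longrightarrow> dist x (\<eta> t) < \<epsilon>"
    using first_hit_props[OF paths(1) \<epsilon>(1)] \<epsilon>(2) unfolding starts by metis
  obtain t\<omega> where t\<omega>: "0 < t\<omega>" "t\<omega> < 1" "\<omega> t\<omega> = first_hit \<omega> \<epsilon>" "dist x (\<omega> t\<omega>) = \<epsilon>"
    "\<And>t. 0 \<le> t \<Longrightarrow> t < t\<omega> \<Longrightarrow> dist x (\<omega> t) < \<epsilon>"
    using first_hit_props[OF paths(2) \<epsilon>(1)] \<epsilon>(3) unfolding starts by metis
  obtain t\<zeta> where t\<zeta>: "0 < t\<zeta>" "t\<zeta> < 1" "\<zeta> t\<zeta> = first_hit \<zeta> \<epsilon>" "dist x (\<zeta> t\<zeta>) = \<epsilon>"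
    "\<And>t. 0 \<le> t \<Longrightarrow> t < t\<zeta> \<Longrightarrow> dist x (\<zeta> t) < \<epsilon>"
    using first_hit_props[OF paths(3) \<epsilon>(1)] \<epsilon>(4) unfolding starts by metis
  define Y W Z where "Y = \<eta> t\<eta>" and "W = \<omega> t\<omega>" and "Z = \<zeta> t\<zeta>"
  assume "ccw x (first_hit \<zeta> \<epsilon>) (first_hit \<eta> \<epsilon>) (first_hit \<omega> \<epsilon>)"
  then have "ccw x Z Y W" using t\<eta>(3) t\<omega>(3) t\<zeta>(3) by (simp add: Y_def W_def Z_def)
  moreover have "cmod (Z - x) = \<epsilon>" "cmod (Y - x) = \<epsilon>" "cmod (W - x) = \<epsilon>"
    using t\<eta>(4) t\<omega>(4) t\<zeta>(4) by (simp_all add: Y_def W_def Z_def dist_norm norm_minus_commute)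
  ultimately obtain a b c where abc: "a < b" "b < c" "c < a + 2 * pi"
    "Z - x = rcis \<epsilon> a" "Y - x = rcis \<epsilon> b" "W - x = rcis \<epsilon> c"
    unfolding ccw_def by metis
  have Z: "Z = x + \<epsilon> * cis a" and Y: "Y = x + \<epsilon> * cis b" and W: "W = x + \<epsilon> * cis c"
    using abc(4-6) by (simp_all add: rcis_def algebra_simps)
  define \<eta>1 \<eta>2 \<zeta>1 \<zeta>2 C D where "\<eta>1 = subpath 0 t\<eta> \<eta>" and "\<eta>2 = subpath t\<eta> 1 \<eta>"
    and "\<zeta>1 = subpath 0 t\<zeta> \<zeta>" and "\<zeta>2 = subpath t\<zeta> 1 \<zeta>"
    and "C = part_circlepath x \<epsilon> a b" and "D = part_circlepath x \<epsilon> b (a + 2 * pi)"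
  have arcs1: "arc \<eta>1" "arc \<eta>2" "arc \<zeta>1" "arc \<zeta>2"
    using arcs t\<eta>(1,2) t\<zeta>(1,2) by (auto simp: \<eta>1_def \<eta>2_def \<zeta>1_def \<zeta>2_def intro!: arc_subpath_arc)
  have arcD: "arc D" unfolding D_def using abc \<epsilon>(1) by (intro arc_part_circlepath) auto
  have pathC: "path C" by (simp add: C_def)
  have ends: "pathstart \<eta>1 = x" "pathfinish \<eta>1 = Y" "pathstart \<eta>2 = Y" "pathfinish \<eta>2 = pathfinish \<eta>"
     "pathstart \<zeta>1 = x" "pathfinish \<zeta>1 = Z" "pathstart \<zeta>2 = Z" "pathfinish \<zeta>2 = pathfinish \<zeta>"
     "pathstart C = Z" "pathfinish C = Y" "pathstart D = Y" "pathfinish D = Z"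
    using starts unfolding \<eta>1_def \<eta>2_def \<zeta>1_def \<zeta>2_def C_def D_def
    by (simp_all add: pathstart_def pathfinish_def subpath_def Y_def[symmetric] Z_def[symmetric] part_circlepath_def
        linepath_def Z Y cis_conv_exp exp_add algebra_simps flip: cis_conv_exp)
  have im: "path_image \<eta>1 = \<eta> ` {0..t\<eta>}" "path_image \<eta>2 = \<eta> ` {t\<eta>..1}"
     "path_image \<zeta>1 = \<zeta> ` {0..t\<zeta>}" "path_image \<zeta>2 = \<zeta> ` {t\<zeta>..1}"
    using t\<eta>(1,2) t\<zeta>(1,2) by (simp_all add: \<eta>1_def \<eta>2_def \<zeta>1_def \<zeta>2_def path_image_subpath)
  have sub: "path_image \<eta>1 \<subseteq> path_image \<eta>" "path_image \<eta>2 \<subseteq> path_image \<eta>"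
     "path_image \<zeta>1 \<subseteq> path_image \<zeta>" "path_image \<zeta>2 \<subseteq> path_image \<zeta>"
    unfolding im using t\<eta>(1,2) t\<zeta>(1,2) by (auto simp: path_image_def)
  have at0: "\<eta> 0 = x" "\<omega> 0 = x" "\<zeta> 0 = x" using starts by (simp_all add: pathstart_def)
  have inj: "inj_on \<eta> {0..1}" "inj_on \<omega> {0..1}" "inj_on \<zeta> {0..1}"
    using arcs by (simp_all add: Path_Connected.arc_def)
  have x2: "x \<notin> path_image \<eta>2" "x \<notin> path_image \<zeta>2"
    using inj_onD[OF inj(1), of 0] inj_onD[OF inj(3), of 0] at0 t\<eta>(1,2) t\<zeta>(1,2) unfolding im by fastforce+
  have cb: "path_image \<eta>1 \<subseteq> cball x \<epsilon>" "path_image \<zeta>1 \<subseteq> cball x \<epsilon>"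
    unfolding im using t\<eta>(4,5) t\<zeta>(4,5) by (force simp: less_le)+
  have bd: "path_image \<eta>1 - {Y} \<subseteq> ball x \<epsilon>" "path_image \<zeta>1 - {Z} \<subseteq> ball x \<epsilon>"
    unfolding im using t\<eta>(4,5) t\<zeta>(4,5) by (force simp: Y_def Z_def less_le)+
  have sC: "path_image C \<subseteq> sphere x \<epsilon>" and sD: "path_image D \<subseteq> sphere x \<epsilon>"
    using \<epsilon>(1) by (auto simp: C_def D_def intro!: path_image_part_circlepath_subset')
  have WC: "W \<notin> path_image C"
  proof
    assume "W \<in> path_image C"
    then obtain s where s: "s \<in> closed_segment a b" "W = x + \<epsilon> * cis s"
      unfolding C_def path_image_part_circlepath' by blast
    then have "cis s = cis c" using W \<epsilon>(1) by simp
    moreover have "a \<le> s" "s \<le> b" using s(1) abc by (auto simp: closed_segment_eq_real_ivl)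
    ultimately show False using cis_eq_imp_eq[of s c] abc by auto
  qed
  define \<Omega> where "\<Omega> = \<omega> ` {0<..t\<omega>}"
  have \<Omega>sub: "\<Omega> \<subseteq> path_image \<omega>" "x \<notin> \<Omega>"
    using t\<omega>(1,2) inj_onD[OF inj(2), of 0] at0 by (fastforce simp: \<Omega>_def path_image_def)+
  have W\<Omega>: "W \<in> \<Omega>" using t\<omega>(1) by (simp add: \<Omega>_def W_def)
  have \<Omega>ball: "\<Omega> - {W} \<subseteq> ball x \<epsilon>" using t\<omega>(5) by (force simp: \<Omega>_def W_def less_le)
  have \<Omega>C: "\<Omega> \<inter> path_image C = {}" using \<Omega>ball WC sC by force
  have \<Omega>\<eta>\<zeta>: "\<Omega> \<inter> path_image \<eta> = {}" "\<Omega> \<inter> path_image \<zeta> = {}" using \<Omega>sub disj by blast+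
  let ?A = "reversepath \<zeta>1 +++ \<eta>1 +++ reversepath C"
  have pA: "path ?A" "pathfinish ?A = pathstart ?A"
    using arcs1 pathC ends by (auto simp: arc_imp_path)
  have imA: "path_image ?A = path_image \<zeta>1 \<union> path_image \<eta>1 \<union> path_image C"
    using ends by (simp add: path_image_join Un_assoc)
  have wA: "winding_number ?A q = winding_number \<eta>1 q - winding_number \<zeta>1 q - winding_number C q"
    if "q \<notin> path_image ?A" for q
    using that arcs1 pathC ends unfolding imA
    by (simp add: winding_number_join path_image_join winding_number_reversepath arc_imp_path)
  \<comment> \<open>The piece \<open>\<Omega>\<close> of \<open>\<omega>\<close> reaches the small
    circle at \<open>W\<close>, which is not on \<open>C\<close>. Continued by a straight ray from
    \<open>W\<close>, it joins its points to infinity without meeting the loop through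
    \<open>\<zeta>1\<close>, \<open>\<eta>1\<close> and \<open>C\<close>.\<close>
  have A0: "winding_number ?A q = 0" if "q \<in> \<Omega>" for q
  proof -
    let ?R = "(\<lambda>s. x + of_real s * (W - x)) ` {1..}"
    have nW: "cmod (W - x) = \<epsilon>" using W \<epsilon>(1) by (simp add: norm_mult)
    have "connected ?R" by (intro connected_continuous_image continuous_intros) auto
    moreover have "connected \<Omega>" unfolding \<Omega>_def
      using paths(2) t\<omega>(1,2) by (intro connected_continuous_image) (auto simp: path_def intro: continuous_on_subset)
    moreover have "W \<in> ?R" by (rule image_eqI[of _ _ 1]) auto
    ultimately have conn: "connected (\<Omega> \<union> ?R)" using W\<Omega> by (intro connected_Un) auto
    have "?R \<inter> path_image ?A = {}"
    proof -
      have "p \<notin> path_image ?A" if p: "p = x + of_real s * (W - x)" "1 \<le> s" for p s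
      proof (cases "s = 1")
        case True
        then have "p = W" using p by simp
        then show ?thesis using \<Omega>\<eta>\<zeta> \<Omega>C W\<Omega> sub unfolding imA by blast
      next
        case False
        have "dist x p = s * \<epsilon>" using p nW by (simp add: dist_norm norm_mult)
        then have "p \<notin> cball x \<epsilon>" using False p(2) \<epsilon>(1) by (simp add: not_le)
        then show ?thesis using cb sC sphere_cball[of x \<epsilon>] unfolding imA by blast
      qed
      then show ?thesis by blast
    qed
    moreover have "\<Omega> \<inter> path_image ?A = {}" using \<Omega>\<eta>\<zeta> \<Omega>C sub unfolding imA by blast
    ultimately have dis: "(\<Omega> \<union> ?R) \<inter> path_image ?A = {}" by blast
    have "\<not> bounded ?R"
    proof
      assume "bounded ?R"
      then obtain B where B: "\<And>p. p \<in> ?R \<Longrightarrow> dist x p \<le> B" unfolding bounded_any_center[of _ x] by blast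
      define s where "s = max 1 (B / \<epsilon> + 1)"
      have "dist x (x + of_real s * (W - x)) = s * \<epsilon>" using nW by (simp add: dist_norm norm_mult s_def)
      moreover have "s * \<epsilon> > B"
      proof -
      have "s * \<epsilon> \<ge> (B / \<epsilon> + 1) * \<epsilon>" using \<epsilon>(1) by (intro mult_right_mono) (auto simp: s_def)
      moreover have "(B / \<epsilon> + 1) * \<epsilon> = B + \<epsilon>" using \<epsilon>(1) by (simp add: field_simps)
      ultimately show ?thesis using \<epsilon>(1) by linarith
      qed
      moreover have "x + of_real s * (W - x) \<in> ?R" by (auto simp: s_def)
      ultimately show False using B by fastforce
    qed
    then have "\<not> bounded (\<Omega> \<union> ?R)" by simp
    then have "q \<in> outside (path_image ?A)"
      using connected_unbounded_subset_outside[OF conn dis] that by blast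
    then show ?thesis using winding_number_zero_in_outside[OF pA] by blast
  qed
  let ?J = "\<lambda>q. winding_number \<eta> q + winding_number \<beta> q - winding_number \<zeta> q"
  let ?B = "\<eta>2 +++ \<beta> +++ reversepath \<zeta>2 +++ C"
  have pB: "path ?B" "pathfinish ?B = pathstart ?B"
    using arcs1 pathC ends \<beta> by (auto simp: arc_imp_path)
  have imB: "path_image ?B = path_image \<eta>2 \<union> path_image \<beta> \<union> path_image \<zeta>2 \<union> path_image C"
    using ends \<beta> by (simp add: path_image_join Un_assoc)
  have wB: "winding_number ?B q = winding_number \<eta>2 q + winding_number \<beta> q - winding_number \<zeta>2 q + winding_number C q"
    if "q \<notin> path_image ?B" for q
    using that arcs1 pathC ends \<beta> unfolding imB
    by (simp add: winding_number_join path_image_join winding_number_reversepath arc_imp_path)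
  have split: "winding_number \<eta> q = winding_number \<eta>1 q + winding_number \<eta>2 q" if "q \<notin> path_image \<eta>" for q
    using winding_number_subpath_combine[OF paths(1) that, of 0 t\<eta> 1] t\<eta>(1,2) by (simp add: \<eta>1_def \<eta>2_def)
  have split': "winding_number \<zeta> q = winding_number \<zeta>1 q + winding_number \<zeta>2 q" if "q \<notin> path_image \<zeta>" for q
    using winding_number_subpath_combine[OF paths(3) that, of 0 t\<zeta> 1] t\<zeta>(1,2) by (simp add: \<zeta>1_def \<zeta>2_def)
  have JAB: "?J q = winding_number ?A q + winding_number ?B q"
    if "q \<notin> path_image \<eta>" "q \<notin> path_image \<zeta>" "q \<notin> path_image \<beta>" "q \<notin> path_image C" for q
  proof -
    have "q \<notin> path_image ?A" "q \<notin> path_image ?B" using that sub unfolding imA imB by blast+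
    then show ?thesis using wA[of q] wB[of q] split[OF that(1)] split'[OF that(2)] by simp
  qed
  have B0: "winding_number ?B q = 0" if "q \<in> \<Omega>" for q
  proof -
    have "q \<in> path_image \<omega>" "q \<noteq> x" using that \<Omega>sub by auto
    from W0[OF this] have "?J q = 0" "q \<notin> path_image \<beta>" by auto
    moreover have "q \<notin> path_image \<eta>" "q \<notin> path_image \<zeta>" "q \<notin> path_image C" using that \<Omega>\<eta>\<zeta> \<Omega>C by auto
    ultimately show ?thesis using JAB[of q] A0[OF that] by simp
  qed
  have "x \<notin> path_image ?B" using x2 \<beta>(4) sC \<epsilon>(1) unfolding imB by auto
  moreover have "closed (path_image ?B)" using pB(1) by (rule closed_path_image)
  ultimately obtain \<delta> where \<delta>: "\<delta> > 0" "ball x \<delta> \<subseteq> - path_image ?B"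
    using open_contains_ball[of "- path_image ?B"] by (auto simp: open_Compl)
  have constB: "winding_number ?B q = winding_number ?B q'" if "q \<in> ball x \<delta>" "q' \<in> ball x \<delta>" for q q'
    using winding_number_eq[OF pB that connected_ball] \<delta>(2) by blast
  have "continuous (at 0 within {0..1}) \<omega>"
    using paths(2) by (simp add: path_def continuous_on_eq_continuous_within)
  then obtain d where d: "d > 0" "\<And>t. t \<in> {0..1} \<Longrightarrow> dist t 0 < d \<Longrightarrow> dist (\<omega> t) (\<omega> 0) < \<delta>"
    using \<delta>(1) unfolding continuous_within_eps_delta by blast
  define t where "t = min (d/2) t\<omega>"
  have t: "0 < t" "t \<le> t\<omega>" "t < d" using d(1) t\<omega>(1) by (auto simp: t_def)
  have "\<omega> t \<in> \<Omega>" "\<omega> t \<in> ball x \<delta>"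
    using t t\<omega>(2) d(2)[of t] at0(2) by (auto simp: \<Omega>_def dist_commute)
  \<comment> \<open>The second loop stays away from \<open>x\<close>, so its winding number is
    constant near \<open>x\<close>, and the value 0 on \<open>\<Omega>\<close> extends to all points
    near \<open>x\<close>. The value 1 required on \<open>F\<close> must therefore come from the
    first loop.\<close>
  then have Bx: "winding_number ?B q = 0" if "q \<in> ball x \<delta>" for q
    using constB[OF that] B0 by metis
  let ?N = "ball x \<delta> \<inter> ball x \<epsilon>"
  have "?N \<inter> F \<noteq> {}"
    using F(1) open_Int_closure_eq_empty[of ?N F] \<delta>(1) \<epsilon>(1) by (metis IntI centre_in_ball empty_iff open_Int open_ball)
  then obtain q where q: "q \<in> ball x \<delta>" "q \<in> ball x \<epsilon>" "q \<in> F" by blast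
  have qn: "q \<notin> path_image \<eta>" "q \<notin> path_image \<zeta>" "q \<notin> path_image \<beta>" and Jq: "?J q = 1"
    using F(2)[OF q(3)] by auto
  have qC: "q \<notin> path_image C" "q \<notin> path_image D" using q(2) sC sD by auto
  have Aq: "winding_number ?A q = 1" using JAB[OF qn(1,2,3) qC(1)] Bx[OF q(1)] Jq by simp
  have "winding_number (C +++ D) q = winding_number (C +++ D) x"
  proof (rule winding_number_eq)
    show "ball x \<epsilon> \<inter> path_image (C +++ D) = {}" using sC sD ends by (auto simp: path_image_join)
  qed (use q(2) \<epsilon>(1) pathC arcD ends in \<open>auto simp: arc_imp_path\<close>)
  moreover have "x \<notin> path_image C" "x \<notin> path_image D" using sC sD \<epsilon>(1) by auto
  ultimately have "winding_number C q + winding_number D q = winding_number C x + winding_number D x"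
    using qC ends pathC arcD by (simp add: winding_number_join arc_imp_path)
  also have "\<dots> = of_real ((b - a) / (2 * pi)) + of_real ((a + 2 * pi - b) / (2 * pi))"
    using winding_number_part_circlepath_centre[OF \<epsilon>(1), of a b x]
      winding_number_part_circlepath_centre[OF \<epsilon>(1), of b "a + 2 * pi" x] abc by (simp add: C_def D_def)
  also have "\<dots> = of_real ((b - a) / (2 * pi) + (a + 2 * pi - b) / (2 * pi))" by (rule of_real_add[symmetric])
  also have "(b - a) / (2 * pi) + (a + 2 * pi - b) / (2 * pi) = 1" by (simp add: field_simps)
  finally have CD: "winding_number C q + winding_number D q = 1" by simp
  \<comment> \<open>Replacing the reverse of \<open>C\<close> by the complementary arc
    \<open>D\<close> adds one full turn of the circle to the winding number 1 of the first loop, and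
    the result is still simple.\<close>
  let ?E = "(reversepath \<zeta>1 +++ \<eta>1) +++ D"
  have "path_image (reversepath \<zeta>1) \<inter> path_image \<eta>1 \<subseteq> {pathstart \<eta>1}"
    using disj(1) sub ends by auto
  then have arc1: "arc (reversepath \<zeta>1 +++ \<eta>1)"
    using arcs1 ends by (intro arc_join) (auto simp: arc_reversepath)
  have "path_image (reversepath \<zeta>1 +++ \<eta>1) \<inter> path_image D \<subseteq> {Y, Z}"
  proof -
    have "path_image D \<inter> ball x \<epsilon> = {}" using sD by auto
    moreover have "path_image (reversepath \<zeta>1 +++ \<eta>1) = path_image \<zeta>1 \<union> path_image \<eta>1"
      using ends by (simp add: path_image_join)
    ultimately show ?thesis using bd by blast
  qed
  then have E: "simple_path ?E" "pathfinish ?E = pathstart ?E"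
    using arc1 arcD ends by (auto intro!: simple_path_join_loop)
  have qE: "q \<notin> path_image ?E" using qn qC sub ends by (auto simp: path_image_join)
  have "winding_number ?E q = winding_number \<eta>1 q - winding_number \<zeta>1 q + winding_number D q"
  proof -
    have "q \<notin> path_image \<eta>1" "q \<notin> path_image \<zeta>1" using qn sub by blast+
    then show ?thesis using arcs1 arcD ends qC
      by (simp add: winding_number_join path_image_join winding_number_reversepath arc_imp_path)
  qed
  also have "\<dots> = 2"
  proof -
    have "q \<notin> path_image ?A" using qn qC sub unfolding imA by blast
    then have "winding_number \<eta>1 q - winding_number \<zeta>1 q = 1 + winding_number C q"
      using wA[of q] Aq by (simp add: algebra_simps)
    then have "winding_number \<eta>1 q - winding_number \<zeta>1 q + winding_number D q =
        1 + (winding_number C q + winding_number D q)" by simp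
    then show ?thesis using CD by simp
  qed
  finally show False
    using simple_closed_path_winding_number_cases[OF E qE] by auto
qed

context planar_map begin

text \<open>Seen from \<open>x\<close>, no edge leaves into the face between its two sides. An edge
  to another vertex \<open>w\<close> meets the triangle at \<open>x\<close> only and otherwise runs
  where the winding number of the triangle is 0, whereas it is 1 on the face, which accumulates at
  \<open>x\<close>.\<close>

lemma face_rotation:
  assumes f: "(x, y, z) \<in> faces" and xw: "(x, w) \<in> parcs G" and w: "w \<notin> {y, z}"
  shows "\<not> ccw_neighbours dr x z y w"
proof
  note d = facesD[OF f] and t = tri_props[OF facesD(1-3)[OF f]]
  have xz: "(x, z) \<in> parcs G" using arcs_sym[OF d(3)] .
  let ?F = "inside (path_image (tri x y z))"
  let ?w = "\<lambda>q. winding_number (dr x y) q + winding_number (dr y z) q - winding_number (dr x z) q"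
  have im: "path_image (tri x y z) = path_image (dr x y) \<union> path_image (dr y z) \<union> path_image (dr x z)"
    using t(4) edge_image_sym[OF xz] by simp
  have tw: "winding_number (tri x y z) q = ?w q" if "q \<notin> path_image (tri x y z)" for q
    using t(6)[OF that] that winding_edge_reverse[OF xz, of q] unfolding im by simp
  have xyz: "x \<in> pverts G" "y \<in> pverts G" using d(1) in_arcsD1 in_arcsD2 by blast+
  have xw_ne: "x \<noteq> w" using arcs_neq[OF xw] .
  have x_yz: "x \<notin> path_image (dr y z)" using edge_verts[OF d(2)] xyz(1) d(4,6) by blast
  have disj: "path_image (dr x y) \<inter> path_image (dr x z) \<subseteq> {x}"
    "path_image (dr x w) \<inter> path_image (dr x y) \<subseteq> {x}"
    "path_image (dr x w) \<inter> path_image (dr x z) \<subseteq> {x}"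
    using edge_disjoint[OF d(1) xz] edge_disjoint[OF xw d(1)] edge_disjoint[OF xw xz] d(4-6) w xw_ne
    by (auto simp: doubleton_eq_iff)
  have w_yz: "path_image (dr x w) \<inter> path_image (dr y z) = {}"
    using edge_disjoint[OF xw d(2)] d(4-6) w xw_ne by (auto simp: doubleton_eq_iff)
  have W0: "q \<notin> path_image (dr y z) \<and> ?w q = 0" if q: "q \<in> path_image (dr x w)" "q \<noteq> x" for q
  proof -
    have "q \<notin> path_image (tri x y z)" using q disj w_yz unfolding im by blast
    moreover have "q \<notin> ?F" using d(7) q edge_in_support[OF xw] by blast
    ultimately have "q \<in> outside (path_image (tri x y z))"
      using inside_Un_outside[of "path_image (tri x y z)"] by blast
    then have "winding_number (tri x y z) q = 0" using winding_number_zero_in_outside[OF t(3,2)] by blast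
    then show ?thesis using tw \<open>q \<notin> path_image (tri x y z)\<close> q w_yz by auto
  qed
  have F: "q \<notin> path_image (dr x y) \<union> path_image (dr y z) \<union> path_image (dr x z) \<and> ?w q = 1" if "q \<in> ?F" for q
  proof -
    have "q \<notin> path_image (tri x y z)" using inside_tri_disjoint[OF that] .
    then show ?thesis using tw d(8)[OF that] unfolding im by auto
  qed
  have "frontier ?F = path_image (tri x y z)" using Jordan_inside_outside[OF t(1,2)] by blast
  then have "x \<in> closure ?F" using edge_ends_in[OF d(1)] unfolding im frontier_def by blast
  then have key: "\<not> ccw x (first_hit (dr x z) \<epsilon>) (first_hit (dr x y) \<epsilon>) (first_hit (dr x w) \<epsilon>)"
    if "0 < \<epsilon>" "\<epsilon> < dist x y" "\<epsilon> < dist x w" "\<epsilon> < dist x z" for \<epsilon>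
    using that not_ccw_first_hits[of "dr x y" "dr x w" "dr x z" x "dr y z" ?F \<epsilon>]
      edge_arc[OF d(1)] edge_arc[OF xw] edge_arc[OF xz] d(1,2) xw xz x_yz disj W0 F
    by (simp add: edge_start edge_finish)
  assume "ccw_neighbours dr x z y w"
  then have "\<forall>\<^sub>F \<epsilon> in at_right 0. ccw x (first_hit (dr x z) \<epsilon>) (first_hit (dr x y) \<epsilon>) (first_hit (dr x w) \<epsilon>)"
    by (simp add: ccw_neighbours_def)
  then obtain b where b: "b > 0" "\<And>\<epsilon>. 0 < \<epsilon> \<Longrightarrow> \<epsilon> < b \<Longrightarrow>
      ccw x (first_hit (dr x z) \<epsilon>) (first_hit (dr x y) \<epsilon>) (first_hit (dr x w) \<epsilon>)"
    unfolding eventually_at_right_field by auto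
  have "0 < min b (min (dist x y) (min (dist x w) (dist x z)))"
    using b(1) d(4,6) xw_ne by auto
  then obtain \<epsilon> where "0 < \<epsilon>" "\<epsilon> < min b (min (dist x y) (min (dist x w) (dist x z)))"
    using dense by blast
  then have "0 < \<epsilon>" "\<epsilon> < b" "\<epsilon> < dist x y" "\<epsilon> < dist x w" "\<epsilon> < dist x z" by auto
  then show False using key b(2) by blast
qed

end

section \<open>Sums over oriented triangles\<close>

text \<open>
  In sums over triangles the summand \<open>f a b\<close> for the
  triple \<open>(a, b, c)\<close> stands for the first edge of the triple, so each edge of each triangle
  contributes once.
\<close>

locale oriented_triples =
  fixes T :: "('a \<times> 'a \<times> 'a) set"
  assumes finite_T: "finite T"
    and rot: "(a, b, c) \<in> T \<Longrightarrow> (b, c, a) \<in> T"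
    and third_unique: "(a, b, c) \<in> T \<Longrightarrow> (a, b, d) \<in> T \<Longrightarrow> c = d"
begin

definition touching :: "'a set \<Rightarrow> ('a \<times> 'a \<times> 'a) set" where
  "touching X = {(a, b, c) \<in> T. a \<in> X \<or> b \<in> X \<or> c \<in> X}"

text \<open>A triangle with exactly one corner in \<open>X\<close> enters with the rotation that
  puts the edge opposite that corner first.\<close>

definition link :: "'a set \<Rightarrow> ('a \<times> 'a \<times> 'a) set" where
  "link X = {(a, b, c) \<in> T. a \<notin> X \<and> b \<notin> X \<and> c \<in> X}"

definition bdry :: "('a \<times> 'a) set" where
  "bdry = {(a, b). (\<exists>c. (a, b, c) \<in> T) \<and> (\<forall>d. (b, a, d) \<notin> T)}"

definition edges :: "('a \<times> 'a) set" where
  "edges = {(a, b). \<exists>c. (a, b, c) \<in> T}"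

lemma finite_sub [simp]: "finite (touching X)" "finite (link X)" "finite bdry" "finite edges"
proof -
  show "finite (touching X)" "finite (link X)"
    using finite_T by (auto simp: touching_def link_def intro: finite_subset)
  have e: "edges \<subseteq> (\<lambda>(a, b, c). (a, b)) ` T" by (force simp: edges_def)
  show "finite edges" by (rule finite_subset[OF e]) (simp add: finite_T)
  moreover have "bdry \<subseteq> edges" by (auto simp: bdry_def edges_def)
  ultimately show "finite bdry" by (rule rev_finite_subset)
qed

lemma touching_rot: "(a, b, c) \<in> touching X \<Longrightarrow> (b, c, a) \<in> touching X"
  using rot by (auto simp: touching_def)

lemma sum_rot:
  assumes S: "S \<subseteq> T" "\<And>a b c. (a, b, c) \<in> S \<Longrightarrow> (b, c, a) \<in> S"
  shows "(\<Sum>(a, b, c)\<in>S. g a b c) = (\<Sum>(a, b, c)\<in>S. g b c a)"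
  by (rule sum.reindex_bij_witness[where i = "\<lambda>(a, b, c). (b, c, a)" and j = "\<lambda>(a, b, c). (c, a, b)"])
    (use S(2) in auto)

lemma sum_edges_thrice:
  fixes f :: "'a \<Rightarrow> 'a \<Rightarrow> 'b::field_char_0"
  assumes S: "S \<subseteq> T" "\<And>a b c. (a, b, c) \<in> S \<Longrightarrow> (b, c, a) \<in> S"
  shows "(\<Sum>(a, b, c)\<in>S. f a b + f b c + f c a) = 3 * (\<Sum>(a, b, c)\<in>S. f a b)"
proof -
  have "(\<Sum>(a, b, c)\<in>S. f a b) = (\<Sum>(a, b, c)\<in>S. f b c)" "(\<Sum>(a, b, c)\<in>S. f b c) = (\<Sum>(a, b, c)\<in>S. f c a)"
    using sum_rot[OF S, of "\<lambda>a b c. f a b"] sum_rot[OF S, of "\<lambda>a b c. f b c"] by simp_all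
  then show ?thesis by (simp add: sum.distrib case_prod_unfold)
qed

lemma touching_sum_thrice:
  fixes f :: "'a \<Rightarrow> 'a \<Rightarrow> 'b::field_char_0"
  shows "3 * (\<Sum>(a, b, c)\<in>touching X. f a b) = (\<Sum>(a, b, c)\<in>touching X. f a b + f b c + f c a)"
proof (rule sum_edges_thrice[symmetric])
  show "touching X \<subseteq> T" by (auto simp: touching_def)
qed (rule touching_rot)

text \<open>An edge that occurs in both directions contributes two opposite values, which leaves the
  boundary.\<close>

lemma sum_edges_antisym:
  fixes f :: "'a \<Rightarrow> 'a \<Rightarrow> 'b::field_char_0"
  assumes f: "\<And>a b. (a, b) \<in> edges \<Longrightarrow> P a b \<Longrightarrow> f b a = - f a b" and P: "\<And>a b. P a b \<longleftrightarrow> P b a"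
  shows "(\<Sum>(a, b)\<in>{(a, b) \<in> edges. P a b}. f a b) = (\<Sum>(a, b)\<in>{(a, b) \<in> bdry. P a b}. f a b)"
proof -
  let ?E = "{(a, b) \<in> edges. P a b}" and ?D = "{(a, b) \<in> bdry. P a b}"
  let ?B = "{(a, b) \<in> edges. (b, a) \<in> edges \<and> P a b}"
  have "(\<Sum>(a, b)\<in>?B. f a b) = (\<Sum>(a, b)\<in>?B. f b a)"
    by (rule sum.reindex_bij_witness[where i = prod.swap and j = prod.swap]) (use P in auto)
  also have "\<dots> = (\<Sum>(a, b)\<in>?B. - f a b)"
    by (rule sum.cong) (use f in auto)
  also have "\<dots> = - (\<Sum>(a, b)\<in>?B. f a b)" by (simp add: sum_negf case_prod_unfold)
  finally have B: "(\<Sum>(a, b)\<in>?B. f a b) = 0" by simp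
  have "?E = ?B \<union> ?D" "?B \<inter> ?D = {}" by (auto simp: edges_def bdry_def)
  moreover have "finite ?B" "finite ?D"
    by (auto intro: finite_subset[OF _ finite_sub(4)] finite_subset[OF _ finite_sub(3)])
  ultimately show ?thesis using B by (simp add: sum.union_disjoint)
qed

lemma sum_edges_triples:
  "(\<Sum>(a, b)\<in>{(a, b) \<in> edges. P a b}. f a b) = (\<Sum>(a, b, c)\<in>{(a, b, c) \<in> T. P a b}. f a b)"
  by (rule sum.reindex_bij_witness[where i = "\<lambda>(a, b, c). (a, b)" and j = "\<lambda>(a, b). (a, b, THE c. (a, b, c) \<in> T)"])
    (use third_unique in \<open>auto simp: edges_def intro: theI the_equality\<close>)

text \<open>Edges with an endpoint in \<open>X\<close> cancel, unless they lie on the boundary.\<close>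

lemma sum_touching:
  fixes f :: "'a \<Rightarrow> 'a \<Rightarrow> 'b::field_char_0"
  assumes f: "\<And>a b. (a, b) \<in> edges \<Longrightarrow> a \<in> X \<or> b \<in> X \<Longrightarrow> f b a = - f a b"
  shows "(\<Sum>(a, b, c)\<in>touching X. f a b) =
    (\<Sum>(a, b, c)\<in>link X. f a b) + (\<Sum>(a, b)\<in>{(a, b) \<in> bdry. a \<in> X \<or> b \<in> X}. f a b)"
proof -
  let ?T = "{(a, b, c) \<in> T. a \<in> X \<or> b \<in> X}"
  have "touching X = link X \<union> ?T" "link X \<inter> ?T = {}" by (auto simp: touching_def link_def)
  moreover have "finite ?T" using finite_T by (auto intro: finite_subset)
  ultimately have "(\<Sum>(a, b, c)\<in>touching X. f a b) = (\<Sum>(a, b, c)\<in>link X. f a b) + (\<Sum>(a, b, c)\<in>?T. f a b)"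
    by (simp add: sum.union_disjoint)
  also have "(\<Sum>(a, b, c)\<in>?T. f a b) = (\<Sum>(a, b)\<in>{(a, b) \<in> bdry. a \<in> X \<or> b \<in> X}. f a b)"
    using sum_edges_antisym[of "\<lambda>a b. a \<in> X \<or> b \<in> X" f] f
    unfolding sum_edges_triples[where P = "\<lambda>a b. a \<in> X \<or> b \<in> X" and f = f] by blast
  finally show ?thesis .
qed

text \<open>The boundary is a cycle in the homological sense: the sum telescopes around each
  triangle, and the interior edges cancel.\<close>

lemma sum_bdry_coboundary:
  fixes g :: "'a \<Rightarrow> 'b::field_char_0"
  shows "(\<Sum>(a, b)\<in>bdry. g b - g a) = 0"
proof -
  have "(\<Sum>(a, b, c)\<in>T. g b - g a) = 0"
    using sum_edges_thrice[of T "\<lambda>a b. g b - g a"] rot by simp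
  then have "(\<Sum>(a, b)\<in>{(a, b) \<in> edges. True}. g b - g a) = 0"
    using sum_edges_triples[where P = "\<lambda>a b. True" and f = "\<lambda>a b. g b - g a"] by simp
  then show ?thesis
    using sum_edges_antisym[of "\<lambda>a b. True" "\<lambda>a b. g b - g a"] by simp
qed

end

section \<open>Winding numbers of unions of facial triangles\<close>

sublocale planar_map \<subseteq> cx: oriented_triples faces
  using finite_faces faces_rotate faces_third_unique by unfold_locales blast+

context planar_map begin

lemma tri_verts:
  assumes "(x, y, z) \<in> faces"
  shows "path_image (tri x y z) \<inter> pverts G = {x, y, z}"
  using edge_verts[OF facesD(1)[OF assms]] edge_verts[OF facesD(2)[OF assms]] edge_verts[OF facesD(3)[OF assms]]
  unfolding tri_props(4)[OF facesD(1-3)[OF assms]] by blast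

text \<open>Overlapping faces have the same inside, hence the same curve and the same corners. The
  winding number 1 rules out the three odd permutations of the corners.\<close>

lemma face_of_point:
  assumes f: "(a, b, c) \<in> faces" "(x, y, z) \<in> faces"
    and q: "q \<in> inside (path_image (tri a b c))" "q \<in> inside (path_image (tri x y z))"
  shows "(a, b, c) \<in> {(x, y, z), (y, z, x), (z, x, y)}"
proof -
  let ?I = "inside (path_image (tri a b c))" and ?I' = "inside (path_image (tri x y z))"
  note t = tri_props[OF facesD(1-3)[OF f(1)]] and t' = tri_props[OF facesD(1-3)[OF f(2)]]
  note d = facesD[OF f(1)] and d' = facesD[OF f(2)]
  have J: "connected ?I" "frontier ?I = path_image (tri a b c)" using Jordan_inside_outside[OF t(1,2)] by blast+
  have J': "connected ?I'" "frontier ?I' = path_image (tri x y z)" using Jordan_inside_outside[OF t'(1,2)] by blast+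
  have e: "?I \<inter> frontier ?I' = {}" "?I' \<inter> frontier ?I = {}" using d(7) d'(7) t(5) t'(5) J(2) J'(2) by blast+
  have "?I = ?I'"
    using connected_subset_if_disjoint_frontier[OF J(1) _ e(1)] connected_subset_if_disjoint_frontier[OF J'(1) _ e(2)] q
    by blast
  then have im: "path_image (tri a b c) = path_image (tri x y z)"
    using arg_cong[of ?I ?I' frontier] unfolding J(2) J'(2) by blast
  then have "{a, b, c} = {x, y, z}" using tri_verts[OF f(1)] tri_verts[OF f(2)] by simp
  then have "a = x \<or> a = y \<or> a = z" "b = x \<or> b = y \<or> b = z" "c = x \<or> c = y \<or> c = z" by blast+
  then consider "(a, b, c) \<in> {(x, y, z), (y, z, x), (z, x, y)}" | "(a, b, c) \<in> {(x, z, y), (z, y, x), (y, x, z)}"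
    using d(4-6) d'(4-6) by (elim disjE) simp_all
  then show ?thesis
  proof cases
    case 2
    note fl = tri_flip[OF d'(1-3)]
    have qn: "q \<notin> path_image (tri x y z)" "q \<notin> path_image (tri a b c)" using inside_tri_disjoint q by blast+
    have w: "winding_number (tri x z y) q = -1" using fl(2)[OF qn(1)] d'(8)[OF q(2)] by simp
    note a = arcs_sym[OF d'(3)] arcs_sym[OF d'(2)] arcs_sym[OF d'(1)]
    have qn': "q \<notin> path_image (tri x z y)" using fl(1) qn(1) by simp
    have "winding_number (tri z y x) q = -1" "winding_number (tri y x z) q = -1"
      using tri_rotate(2)[OF a, of q] tri_rotate(2)[OF a(2,3,1), of q] tri_rotate(1)[OF a] w qn' by simp_all
    then have "winding_number (tri a b c) q = -1" using 2 w by (elim insertE emptyE) simp_all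
    then show ?thesis using d(8)[OF q(1)] by simp
  qed blast
qed

text \<open>Three times the sum adds up whole triangles instead of single edges. Only the three
  rotations of the one face around \<open>q\<close> have a nonzero winding number there, and each of
  them has 1.\<close>

lemma sum_touching_winding:
  assumes q: "q \<notin> support G dr" and f: "(x, y, z) \<in> faces" "q \<in> inside (path_image (tri x y z))"
    and X: "{x, y, z} \<inter> X \<noteq> {}"
  shows "(\<Sum>(a, b, c)\<in>cx.touching X. winding_number (dr a b) q) = 1"
proof -
  note d = facesD[OF f(1)]
  let ?R = "{(x, y, z), (y, z, x), (z, x, y)}"
  have rots: "(y, z, x) \<in> faces" "(z, x, y) \<in> faces" using f(1) faces_rotate by blast+
  have "3 * (\<Sum>(a, b, c)\<in>cx.touching X. winding_number (dr a b) q) =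
      (\<Sum>(a, b, c)\<in>cx.touching X. winding_number (dr a b) q + winding_number (dr b c) q + winding_number (dr c a) q)"
    by (rule cx.touching_sum_thrice)
  also have "\<dots> = (\<Sum>(a, b, c)\<in>cx.touching X. if (a, b, c) \<in> ?R then 1 else 0)"
  proof (rule sum.cong[OF refl], clarify)
    fix a b c assume "(a, b, c) \<in> cx.touching X"
    then have abc: "(a, b, c) \<in> faces" by (simp add: cx.touching_def)
    note t = tri_props[OF facesD(1-3)[OF abc]]
    have qn: "q \<notin> path_image (tri a b c)" using q t(5) by blast
    have "winding_number (tri a b c) q = (if (a, b, c) \<in> ?R then 1 else 0)"
    proof (cases "(a, b, c) \<in> ?R")
      case True
      have "q \<in> inside (path_image (tri a b c))"
        using True f(2) tri_rotate(1)[OF d(1,2,3)] tri_rotate(1)[OF d(2,3,1)] by auto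
      then show ?thesis using True facesD(8)[OF abc] by simp
    next
      case False
      then have "q \<notin> inside (path_image (tri a b c))" using face_of_point[OF abc f(1) _ f(2)] by blast
      then show ?thesis using False winding_tri_outside[OF abc q] by simp
    qed
    then show "winding_number (dr a b) q + winding_number (dr b c) q + winding_number (dr c a) q =
        (if (a, b, c) \<in> ?R then 1 else 0)" using t(6)[OF qn] by simp
  qed
  also have "\<dots> = (\<Sum>t\<in>cx.touching X. if t \<in> ?R then 1 else 0)"
    by (intro sum.cong refl) (simp only: split_paired_all prod.case)
  also have "\<dots> = of_nat (card (cx.touching X \<inter> ?R))"
    by (simp add: sum.If_cases Int_def)
  also have "cx.touching X \<inter> ?R = ?R" using rots f(1) X by (auto simp: cx.touching_def)
  also have "card ?R = 3" using d(4-6) by simp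
  finally show ?thesis by simp
qed

end

context triangulation_with_boundary begin

lemma face_near_inner_vertex:
  assumes v: "v \<in> pverts G" "v \<notin> outer_verts G dr" and r: "r > 0"
  obtains x y z q where "(x, y, z) \<in> faces" "v \<in> {x, y, z}" "q \<in> inside (path_image (tri x y z))" "dist v q < r"
proof -
  let ?F = "{(x, y, z) \<in> faces. v \<notin> path_image (tri x y z)}"
  let ?C = "closure (outside (support G dr)) \<union> (\<Union>(x, y, z)\<in>?F. closure (inside (path_image (tri x y z))))"
  have vs: "v \<in> support G dr" using v(1) by (simp add: support_def)
  then have "v \<notin> outside (support G dr)" using outside_no_overlap by blast
  then have "v \<notin> closure (outside (support G dr))"
    using v by (simp add: closure_Un_frontier outer_verts_def)
  moreover have "v \<notin> closure (inside (path_image (tri x y z)))"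
    if f: "(x, y, z) \<in> faces" "v \<notin> path_image (tri x y z)" for x y z
  proof -
    note t = tri_props[OF facesD(1-3)[OF f(1)]]
    have "frontier (inside (path_image (tri x y z))) = path_image (tri x y z)"
      using Jordan_inside_outside[OF t(1,2)] by blast
    then show ?thesis using f facesD(7)[OF f(1)] vs by (auto simp: closure_Un_frontier)
  qed
  ultimately have "v \<notin> ?C" by auto
  moreover have "finite ?F" by (rule finite_subset[OF _ finite_faces]) auto
  then have "closed ?C" by (intro closed_Un closed_UN) auto
  ultimately have N: "open (ball v r - ?C)" "v \<in> ball v r - ?C" using r by auto
  have no: "(ball v r - ?C) \<inter> outside (support G dr) = {}"
    using closure_subset[of "outside (support G dr)"] by blast
  have ne: "ball v r - ?C \<noteq> {}" using N(2) by (rule ex_in_conv[THEN iffD1, OF exI])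
  obtain x y z where f: "(x, y, z) \<in> faces" "(ball v r - ?C) \<inter> inside (path_image (tri x y z)) \<noteq> {}"
    by (rule face_near[OF N(1) ne no])
  then obtain q where q: "q \<in> ball v r" "q \<notin> ?C" "q \<in> inside (path_image (tri x y z))" by blast
  have "v \<in> path_image (tri x y z)"
  proof (rule ccontr)
    assume "v \<notin> path_image (tri x y z)"
    then have "(x, y, z) \<in> ?F" using f(1) by simp
    then have "closure (inside (path_image (tri x y z))) \<subseteq> ?C" by force
    then show False using q closure_subset by blast
  qed
  then have "v \<in> {x, y, z}" using tri_verts[OF f(1)] v(1) by blast
  then show ?thesis using that[OF f(1) _ q(3)] q(1) by simp
qed

text \<open>
  The walks in question have winding numbers forming a subgroup of the integers. It contains
  \<open>1\<close> because the triangles touching \<open>X\<close> have total winding number \<open>1\<close> around a point near \<open>\<rho>\<close>,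
  and their sum is a combination of edges inside \<open>S\<close>, each of which can be closed up within \<open>S\<close>.
\<close>

lemma closed_walk_around:
  assumes \<rho>: "\<rho> \<in> X" and X: "X \<subseteq> pverts G" "X \<inter> outer_verts G dr = {}"
    and S: "S \<subseteq> pverts G" "S \<inter> X = {}" "\<And>a b. (a, b) \<in> parcs G \<Longrightarrow> a \<in> X \<Longrightarrow> b \<in> X \<union> S"
    and conn: "\<And>u w. u \<in> S \<Longrightarrow> w \<in> S \<Longrightarrow>
        \<exists>p. vwalk p (with_proj G) \<and> set p \<subseteq> S \<and> hd p = u \<and> last p = w"
    and v: "v \<in> S"
  shows "\<exists>p\<in>winding_paths G dr \<rho> v. set p \<subseteq> S"
proof -
  have \<rho>V: "\<rho> \<in> pverts G" "\<rho> \<notin> outer_verts G dr" "\<rho> \<notin> S" using \<rho> X S by blast+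
  \<comment> \<open>\<open>\<rho>\<close> lies on the drawing, so the triangles are summed at a
    nearby point \<open>q\<close> of a face instead. A walk in \<open>S\<close> uses no edge at
    \<open>\<rho>\<close>; in a ball around \<open>\<rho>\<close> that misses all other edges, its
    winding number is the same at \<open>\<rho>\<close> and at \<open>q\<close>.\<close>
  define C where "C = (\<Union>(a, b)\<in>{(a, b) \<in> parcs G. \<rho> \<notin> {a, b}}. path_image (dr a b)) \<union> S"
  have "finite {(a, b) \<in> parcs G. \<rho> \<notin> {a, b}}" by (rule finite_subset[OF _ pair_finite_arcs]) auto
  moreover have finS: "finite S" using S(1) pair_finite_verts finite_subset by blast
  ultimately have clC: "closed C"
    unfolding C_def by (intro closed_Un closed_UN finite_imp_closed) (auto intro!: closed_path_image)
  have "\<rho> \<notin> path_image (dr a b)" if "(a, b) \<in> parcs G" "\<rho> \<notin> {a, b}" for a b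
    using edge_verts[OF that(1)] that(2) \<rho>V(1) by blast
  then have "\<rho> \<in> - C" using \<rho>V(3) by (auto simp: C_def)
  then obtain r where r: "r > 0" "ball \<rho> r \<subseteq> - C"
    using clC open_contains_ball[of "- C"] by (auto simp: open_Compl)
  obtain x y z q where f: "(x, y, z) \<in> faces" "\<rho> \<in> {x, y, z}" "q \<in> inside (path_image (tri x y z))" "dist \<rho> q < r"
    using face_near_inner_vertex[OF \<rho>V(1,2) r(1)] .
  have qs: "q \<notin> support G dr" using facesD(7)[OF f(1)] f(3) by blast
  define \<theta> where "\<theta> a b = winding_number (dr a b) q" for a b
  define \<Theta> where "\<Theta> p = (\<Sum>(a, b)\<leftarrow>vwalk_arcs p. \<theta> a b)" for p
  have \<theta>_anti: "\<theta> b a = - \<theta> a b" if "(a, b) \<in> parcs G" for a b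
    using winding_edge_reverse[OF that, of q] qs edge_in_support[OF that] by (auto simp: \<theta>_def)
  have walk_off: "ball \<rho> r \<inter> path_image (walk_curve dr p) = {}" if p: "vwalk p (with_proj G)" "set p \<subseteq> S" for p
  proof -
    have "path_image (dr a b) \<subseteq> C" if "(a, b) \<in> set (vwalk_arcs p)" for a b
    proof -
      have "a \<in> S" "b \<in> S" "(a, b) \<in> parcs G"
        using vwalk_arcs_in_set[OF that] p that by (auto simp: vwalk_def)
      then have "(a, b) \<in> {(a, b) \<in> parcs G. \<rho> \<notin> {a, b}}" using \<rho>V(3) by auto
      then show ?thesis unfolding C_def by blast
    qed
    then have "path_image (walk_curve dr p) \<subseteq> C" using walk_curve_props[OF p(1)] p(2) by (auto simp: C_def)
    then show ?thesis using r(2) by blast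
  qed
  define closed_at where "closed_at p \<longleftrightarrow> vwalk p (with_proj G) \<and> set p \<subseteq> S \<and> hd p = v \<and> last p = v" for p
  define H where "H = \<Theta> ` {p. closed_at p}"
  have \<Theta>_app: "\<Theta> (p @ w # p') = \<Theta> (p @ [w]) + \<Theta> (w # p')" for p w p'
    by (cases "p = []") (simp_all add: \<Theta>_def vwalk_arcs_append)
  have join: "vwalk (p @ tl p') (with_proj G) \<and> \<Theta> (p @ tl p') = \<Theta> p + \<Theta> p' \<and>
      hd (p @ tl p') = hd p \<and> last (p @ tl p') = last p' \<and> set (p @ tl p') \<subseteq> set p \<union> set p'"
    if p: "vwalk p (with_proj G)" "vwalk p' (with_proj G)" "last p = hd p'" for p p'
  proof -
    obtain p0 w where p0: "p = p0 @ [w]" using p(1) by (metis append_butlast_last_id vwalk_def)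
    obtain p1 where p1: "p' = w # p1" using p p0 by (cases p') (auto simp: vwalk_def)
    have "vwalk (p0 @ w # p1) (with_proj G)"
      using vwalk_arcs_append[of p0 "w # p1"] vwalk_arcs_append[of p0 "[w]"] p(1,2) unfolding p0 p1
      by (cases "p0 = []") (auto simp: vwalk_def)
    then show ?thesis unfolding p0 p1 using \<Theta>_app[of p0 w p1] by (auto simp: hd_append)
  qed
  have rev_walk: "vwalk (rev p) (with_proj G) \<and> \<Theta> (rev p) = - \<Theta> p" if "vwalk p (with_proj G)" for p
    using that
  proof (induction p rule: induct_list012)
    case (3 a b p)
    have ab: "(a, b) \<in> parcs G" "vwalk (b # p) (with_proj G)" using 3 by (auto simp: vwalk_Cons2)
    have IH: "vwalk (rev p @ [b]) (with_proj G)" "\<Theta> (rev p @ [b]) = - \<Theta> (b # p)" using 3(2) ab(2) by auto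
    have "vwalk [b, a] (with_proj G)" using arcs_sym[OF ab(1)] in_arcsD1 in_arcsD2 ab(1) by (auto simp: vwalk_def)
    then have "vwalk (rev p @ [b, a]) (with_proj G)" "\<Theta> (rev p @ [b, a]) = \<Theta> (rev p @ [b]) + \<Theta> [b, a]"
      using join[OF IH(1), of "[b, a]"] by auto
    then show ?case using IH(2) \<theta>_anti[OF ab(1)] by (simp add: \<Theta>_def)
  qed (auto simp: vwalk_def \<Theta>_def)
  have H0: "0 \<in> H"
  proof -
    have "closed_at [v]" using v S(1) by (auto simp: closed_at_def vwalk_def)
    then show ?thesis by (force simp: H_def \<Theta>_def)
  qed
  have Hadd: "s + t \<in> H" if st: "s \<in> H" "t \<in> H" for s t
  proof -
    obtain p p' where "closed_at p" "closed_at p'" "s = \<Theta> p" "t = \<Theta> p'" using st by (auto simp: H_def)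
    then have "closed_at (p @ tl p')" "\<Theta> (p @ tl p') = s + t"
      using join[of p p'] unfolding closed_at_def by auto
    then show ?thesis by (metis H_def image_eqI mem_Collect_eq)
  qed
  \<comment> \<open>One fixed walk from \<open>v\<close> to each vertex of \<open>S\<close>;
    \<open>h\<close> is the potential that these walks define.\<close>
  define P where "P w = (SOME p. vwalk p (with_proj G) \<and> set p \<subseteq> S \<and> hd p = v \<and> last p = w)" for w
  have P: "vwalk (P w) (with_proj G) \<and> set (P w) \<subseteq> S \<and> hd (P w) = v \<and> last (P w) = w" if "w \<in> S" for w
    unfolding P_def by (rule someI_ex) (rule conn[OF v that])
  define h where "h w = (if w \<in> S then \<Theta> (P w) else 0)" for w
  \<comment> \<open>Going out along \<open>P a\<close>, across the edge and back along
    \<open>P b\<close> is a closed walk at \<open>v\<close>. Its value is that of the edge corrected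
    by the potential.\<close>
  have edge_H: "\<theta> a b - (h b - h a) \<in> H" if ab: "(a, b) \<in> parcs G" "a \<in> S" "b \<in> S" for a b
  proof -
    note Pa = P[OF ab(2)] and Pb = P[OF ab(3)]
    have ne: "P a \<noteq> []" "P b \<noteq> []" using Pa Pb by (auto simp: vwalk_def)
    have wab: "vwalk [a, b] (with_proj G)" using ab S(1) by (auto simp: vwalk_def)
    let ?p = "P a @ tl [a, b]"
    have 1: "vwalk ?p (with_proj G)" "\<Theta> ?p = \<Theta> (P a) + \<theta> a b" "hd ?p = v" "last ?p = b" "set ?p \<subseteq> S"
      using join[of "P a" "[a, b]"] wab Pa ab by (auto simp: \<Theta>_def)
    have 2: "vwalk (rev (P b)) (with_proj G)" "\<Theta> (rev (P b)) = - \<Theta> (P b)" using rev_walk Pb by auto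
    have hl: "hd (rev (P b)) = b" "last (rev (P b)) = v" using Pb ne by (auto simp: hd_rev last_rev)
    have "closed_at (?p @ tl (rev (P b)))" "\<Theta> (?p @ tl (rev (P b))) = \<Theta> (P a) + \<theta> a b - \<Theta> (P b)"
      using join[OF 1(1) 2(1)] 1 2 hl Pb unfolding closed_at_def by auto
    moreover have "\<theta> a b - (h b - h a) = \<Theta> (P a) + \<theta> a b - \<Theta> (P b)" using ab by (simp add: h_def)
    ultimately show ?thesis by (metis H_def image_eqI mem_Collect_eq)
  qed
  let ?f = "\<lambda>a b. \<theta> a b - (h b - h a)"
  have Hsum: "(\<Sum>t\<in>A. g t) \<in> H" if "\<And>t. t \<in> A \<Longrightarrow> g t \<in> H" for A :: "(complex \<times> complex \<times> complex) set" and g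
    using that by (induction A rule: infinite_finite_induct) (auto intro: H0 Hadd)
  \<comment> \<open>An edge with an end off the outer face has a face on both sides.\<close>
  have bal: "{(a, b) \<in> cx.bdry. a \<in> X \<or> b \<in> X} = {}"
  proof -
    have "\<exists>d. (b, a, d) \<in> faces" if "(a, b, c) \<in> faces" "a \<in> X \<or> b \<in> X" for a b c
      using face_of_inner_edge[OF arcs_sym[OF facesD(1)[OF that(1)]]] that(2) X(2) by blast
    then show ?thesis unfolding cx.bdry_def by blast
  qed
  have "(\<Sum>(a, b, c)\<in>cx.touching X. ?f a b) = (\<Sum>(a, b, c)\<in>cx.link X. ?f a b)"
  proof -
    have "?f b a = - ?f a b" if "(a, b) \<in> cx.edges" for a b
      using \<theta>_anti[of a b] facesD(1) that by (auto simp: cx.edges_def)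
    then show ?thesis by (subst cx.sum_touching) (simp_all add: bal)
  qed
  also have "\<dots> \<in> H"
  proof (rule Hsum, clarify)
    fix a b c assume "(a, b, c) \<in> cx.link X"
    then have l: "(a, b, c) \<in> faces" "a \<notin> X" "b \<notin> X" "c \<in> X" by (auto simp: cx.link_def)
    note d = facesD[OF l(1)]
    have "b \<in> S" "a \<in> S" using S(3)[OF d(3) l(4)] S(3)[OF arcs_sym[OF d(2)] l(4)] l by blast+
    then show "?f a b \<in> H" using edge_H[OF d(1)] by blast
  qed
  finally have inH: "(\<Sum>(a, b, c)\<in>cx.touching X. ?f a b) \<in> H" .
  \<comment> \<open>The correction by the potential telescopes around each triangle, so it does not
    change the total.\<close>
  have cob: "(\<Sum>(a, b, c)\<in>cx.touching X. h b - h a) = 0"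
  proof -
    have "3 * (\<Sum>(a, b, c)\<in>cx.touching X. h b - h a) =
      (\<Sum>(a, b, c)\<in>cx.touching X. (h b - h a) + (h c - h b) + (h a - h c))"
      by (rule cx.touching_sum_thrice)
    also have "\<dots> = 0" by (simp add: case_prod_unfold)
    finally show ?thesis by simp
  qed
  have "(\<Sum>(a, b, c)\<in>cx.touching X. \<theta> a b) = 1"
    unfolding \<theta>_def by (rule sum_touching_winding[OF qs f(1,3)]) (use f(2) \<rho> in blast)
  then have "(\<Sum>(a, b, c)\<in>cx.touching X. ?f a b) = 1"
    using cob by (simp add: sum_subtractf case_prod_unfold)
  then have "1 \<in> H" using inH by simp
  then obtain p where p: "closed_at p" "\<Theta> p = 1" by (auto simp: H_def)
  then have w: "vwalk p (with_proj G)" "set p \<subseteq> S" "hd p = v" "last p = v" by (auto simp: closed_at_def)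
  note off = walk_off[OF w(1,2)]
  have qb: "q \<in> ball \<rho> r" "\<rho> \<in> ball \<rho> r" using f(4) r(1) by auto
  then have qn: "q \<notin> path_image (walk_curve dr p)" "\<rho> \<notin> path_image (walk_curve dr p)" using off by blast+
  have "winding_number (walk_curve dr p) \<rho> = winding_number (walk_curve dr p) q"
    using walk_curve_props[OF w(1)] w off qb by (intro winding_number_eq[OF _ _ qb(2,1)]) auto
  also have "\<dots> = 1"
    using winding_number_walk_curve[OF w(1) qn(1)] p(2) by (simp add: \<Theta>_def \<theta>_def)
  finally have "p \<in> winding_paths G dr \<rho> v"
    using w qn by (auto simp: winding_paths_def)
  then show ?thesis using w(2) by blast
qed

end

section \<open>Triangles spanned by a packing\<close>

definition cross :: "complex \<Rightarrow> complex \<Rightarrow> real" where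
  "cross z w = Re z * Im w - Im z * Re w"

lemma cross_simps [simp]: "cross z z = 0" "cross 0 z = 0" "cross z 0 = 0"
  by (simp_all add: cross_def)

lemma cross_linear: "cross (z + z') w = cross z w + cross z' w" "cross z (w + w') = cross z w + cross z w'"
  "cross (z - z') w = cross z w - cross z' w" "cross z (w - w') = cross z w - cross z w'"
  "cross (of_real k * z) w = k * cross z w" "cross z (of_real k * w) = k * cross z w"
  "cross (k *\<^sub>R z) w = k * cross z w" "cross z (k *\<^sub>R w) = k * cross z w"
  by (simp_all add: cross_def algebra_simps)

lemma cross_commute: "cross z w = - cross w z"
  by (simp add: cross_def)

lemma cross_decompose:
  assumes "cross a b \<noteq> 0"
  shows "z = of_real (cross z b / cross a b) * a + of_real (cross a z / cross a b) * b"
proof -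
  have "of_real (cross a b) * z = of_real (cross z b) * a + of_real (cross a z) * b"
    by (simp add: complex_eq_iff cross_def algebra_simps)
  then show ?thesis using assms by (simp add: field_simps)
qed

lemma cross_zero_parallel:
  assumes "cross a b = 0" "a \<noteq> 0"
  obtains k where "b = of_real k * a"
proof -
  have "b = of_real (Re (b / a)) * a"
  proof -
    have "Im (b / a) = 0" using assms by (simp add: Im_divide cross_def algebra_simps)
    then have "b / a = of_real (Re (b / a))" by (simp add: complex_eq_iff)
    then show ?thesis using assms(2) by (metis nonzero_eq_divide_eq)
  qed
  then show ?thesis using that by blast
qed

lemma disjoint_balls_imp_dist:
  fixes a b :: "'a::real_normed_vector"
  assumes "0 < r" "0 < s" "ball a r \<inter> ball b s = {}"
  shows "r + s \<le> dist a b"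
proof (rule ccontr)
  assume less: "\<not> r + s \<le> dist a b"
  \<comment> \<open>Dividing the segment between the centres in the ratio of the radii gives a point
    that would lie in both balls.\<close>
  define t where "t = r / (r + s)"
  define p where "p = a + t *\<^sub>R (b - a)"
  have t: "0 < t" "t < 1" "t * (r + s) = r" using assms by (auto simp: t_def)
  have "dist a p = t * dist a b" using t by (simp add: p_def dist_norm norm_minus_commute)
  moreover have "t * dist a b < t * (r + s)" using less t by (intro mult_strict_left_mono) auto
  ultimately have 1: "p \<in> ball a r" using t by simp
  have "b - p = (1 - t) *\<^sub>R (b - a)" by (simp add: p_def algebra_simps)
  then have "dist b p = (1 - t) * dist a b" using t by (simp add: dist_norm norm_minus_commute)
  moreover have "(1 - t) * dist a b < (1 - t) * (r + s)" using less t by (intro mult_strict_left_mono) auto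
  moreover have "(1 - t) * (r + s) = s" using t(3) by (simp add: algebra_simps)
  ultimately have "p \<in> ball b s" by simp
  then show False using 1 assms(3) by blast
qed

text \<open>The interface between drawing and packing: the geometric argument sees only finitely
  many tangent discs and a set of triples. \<open>rotation\<close> carries the cyclic order; it says
  that no other neighbour of the corner \<open>x\<close> comes counterclockwise after
  \<open>y\<close> and before \<open>z\<close>. \<open>outer_off_face\<close> and
  \<open>outer_conn\<close> express the shape of the outer cycle.\<close>

locale disc_packing = oriented_triples T for T :: "('v \<times> 'v \<times> 'v) set" +
  fixes V B :: "'v set" and E :: "('v \<times> 'v) set" and cen :: "'v \<Rightarrow> complex" and rad :: "'v \<Rightarrow> real" and \<rho> :: 'v
  assumes finite_V: "finite V" and B_sub: "B \<subseteq> V" and E_sub: "E \<subseteq> V \<times> V" and E_sym: "(a, b) \<in> E \<Longrightarrow> (b, a) \<in> E"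
    and E_irrefl: "(a, b) \<in> E \<Longrightarrow> a \<noteq> b"
    and E_conn: "\<And>X. X \<subseteq> V \<Longrightarrow> X \<noteq> {} \<Longrightarrow> (\<And>a b. a \<in> X \<Longrightarrow> (a, b) \<in> E \<Longrightarrow> b \<in> X) \<Longrightarrow> X = V"
    and rad_pos: "v \<in> V \<Longrightarrow> 0 < rad v"
    and disjoint_balls: "u \<in> V \<Longrightarrow> v \<in> V \<Longrightarrow> u \<noteq> v \<Longrightarrow> ball (cen u) (rad u) \<inter> ball (cen v) (rad v) = {}"
    and tangent: "(u, v) \<in> E \<longleftrightarrow> u \<in> V \<and> v \<in> V \<and> u \<noteq> v \<and> dist (cen u) (cen v) = rad u + rad v"
    and outer_tangent: "v \<in> B \<Longrightarrow> rad v < 1 \<and> cmod (cen v) = 1 - rad v"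
    and inner_contained: "v \<in> V - B \<Longrightarrow> cmod (cen v) + rad v < 1"
    and T_edges: "(a, b, c) \<in> T \<Longrightarrow> (a, b) \<in> E"
    and inner_edge_face: "(a, b) \<in> E \<Longrightarrow> a \<notin> B \<or> b \<notin> B \<Longrightarrow> \<exists>c. (a, b, c) \<in> T"
    and edge_face: "(a, b) \<in> E \<Longrightarrow> (\<exists>c. (a, b, c) \<in> T) \<or> (\<exists>c. (b, a, c) \<in> T)"
    and rotation: "(x, y, z) \<in> T \<Longrightarrow> (x, w) \<in> E \<Longrightarrow> w \<notin> {y, z} \<Longrightarrow> \<not> ccw (cen x) (cen z) (cen y) (cen w)"
    and outer_off_face: "(x, y, z) \<in> T \<Longrightarrow> \<exists>t\<in>B. t \<notin> {x, y, z}"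
    and outer_conn: "(a, b) \<in> bdry \<Longrightarrow> (\<And>u w. u \<in> X \<Longrightarrow> (u, w) \<in> E \<Longrightarrow> w \<in> X \<union> {a, b}) \<Longrightarrow>
        t \<in> X \<Longrightarrow> t \<in> B \<Longrightarrow> t \<notin> {a, b} \<Longrightarrow> B \<subseteq> X \<union> {a, b}"
    and B_nonempty: "B \<noteq> {}"
    and root: "\<rho> \<in> V - B" and root_centre: "cen \<rho> = 0"
begin

lemma in_V: "(a, b) \<in> E \<Longrightarrow> a \<in> V" "(a, b) \<in> E \<Longrightarrow> b \<in> V"
  using E_sub by auto

lemma facesE:
  assumes "(a, b, c) \<in> T"
  shows "(a, b) \<in> E" "(b, c) \<in> E" "(c, a) \<in> E" "a \<noteq> b" "b \<noteq> c" "c \<noteq> a" "a \<in> V" "b \<in> V" "c \<in> V"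
  using T_edges[OF assms] T_edges[OF rot[OF assms]] T_edges[OF rot[OF rot[OF assms]]] E_irrefl in_V by blast+

lemma sep: "u \<in> V \<Longrightarrow> v \<in> V \<Longrightarrow> u \<noteq> v \<Longrightarrow> rad u + rad v \<le> dist (cen u) (cen v)"
  using disjoint_balls_imp_dist[OF rad_pos rad_pos disjoint_balls] by blast

lemma cen_inj: "u \<in> V \<Longrightarrow> v \<in> V \<Longrightarrow> cen u = cen v \<Longrightarrow> u = v"
  using sep[of u v] rad_pos[of u] rad_pos[of v] by fastforce

lemma in_disc: "v \<in> V \<Longrightarrow> cmod (cen v) + rad v \<le> 1"
  using outer_tangent inner_contained by fastforce

lemma cen_less_1: "v \<in> V \<Longrightarrow> cmod (cen v) < 1"
  using in_disc[of v] rad_pos[of v] by linarith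

lemma ball_cball_disjoint:
  assumes "u \<in> V" "v \<in> V" "u \<noteq> v" "dist (cen u) p < rad u" "dist (cen v) p \<le> rad v"
  shows False
  using sep[OF assms(1-3)] assms(4,5) dist_triangle2[of "cen u" "cen v" p] by simp

lemma common_point:
  assumes "u \<in> V" "v \<in> V" "u \<noteq> v" "dist (cen u) p \<le> rad u" "dist (cen v) p \<le> rad v"
  shows "(u, v) \<in> E" "dist (cen u) p = rad u" "dist (cen v) p = rad v"
    "of_real (rad v) * (p - cen u) = - of_real (rad u) * (p - cen v)"
proof -
  note s = sep[OF assms(1-3)] and t = dist_triangle2[of "cen u" "cen v" p]
  show 1: "dist (cen u) p = rad u" and 2: "dist (cen v) p = rad v" using s t assms(4,5) by linarith+
  have 3: "dist (cen u) (cen v) = rad u + rad v" using s t assms(4,5) by linarith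
  then show "(u, v) \<in> E" using assms tangent by simp
  have "dist (cen u) (cen v) = dist (cen u) p + dist p (cen v)" using 1 2 3 by (simp add: dist_commute)
  then have "norm (cen u - p) *\<^sub>R (p - cen v) = norm (p - cen v) *\<^sub>R (cen u - p)"
    by (simp only: dist_triangle_eq)
  moreover have "norm (cen u - p) = rad u" "norm (p - cen v) = rad v"
    using 1 2 by (simp_all add: dist_norm norm_minus_commute)
  ultimately show "of_real (rad v) * (p - cen u) = - of_real (rad u) * (p - cen v)"
    by (simp add: scaleR_conv_of_real algebra_simps)
qed

text \<open>The unit vectors from two tangent centres to their common point are opposite, and three
  unit vectors cannot be pairwise opposite.\<close>

lemma no_triple_point:
  assumes "u \<in> V" "v \<in> V" "w \<in> V" "distinct [u, v, w]"
    and p: "dist (cen u) p \<le> rad u" "dist (cen v) p \<le> rad v" "dist (cen w) p \<le> rad w"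
  shows False
proof -
  define n where "n x = (p - cen x) / of_real (rad x)" for x
  have n: "n x = - n y" if "x \<in> V" "y \<in> V" "x \<noteq> y" "dist (cen x) p \<le> rad x" "dist (cen y) p \<le> rad y" for x y
    using common_point(4)[OF that] rad_pos[OF that(1)] rad_pos[OF that(2)] by (simp add: n_def field_simps)
  have ne: "u \<noteq> v" "v \<noteq> w" "u \<noteq> w" using assms(4) by auto
  have "n u = - n v" "n v = - n w" "n u = - n w"
    using n[OF assms(1,2) ne(1) p(1,2)] n[OF assms(2,3) ne(2) p(2,3)] n[OF assms(1,3) ne(3) p(1,3)] .
  then have "n u = - n u" by (metis minus_minus)
  then have "n u = 0" by simp
  then have "p = cen u" using rad_pos[OF assms(1)] by (simp add: n_def)
  then show False using common_point(2)[of u v p] assms rad_pos[OF assms(1)] by simp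
qed

lemma segment_point:
  assumes "(a, b) \<in> E" "p \<in> closed_segment (cen a) (cen b)"
  shows "dist (cen a) p + dist (cen b) p = rad a + rad b"
    "dist (cen a) p \<le> rad a \<or> dist (cen b) p \<le> rad b"
proof -
  have "dist (cen a) (cen b) = dist (cen a) p + dist p (cen b)"
    using assms(2) by (simp add: between_mem_segment[symmetric] between)
  then show "dist (cen a) p + dist (cen b) p = rad a + rad b"
    using tangent assms(1) by (simp add: dist_commute)
  then show "dist (cen a) p \<le> rad a \<or> dist (cen b) p \<le> rad b" by linarith
qed

text \<open>Both neighbours would touch the disc of \<open>a\<close> in the same point, the one at
  distance \<open>rad a\<close> in the common direction.\<close>

lemma neighbours_directions:
  assumes "(a, b) \<in> E" "(a, y) \<in> E" "b \<noteq> y" "0 < k" "cen y - cen a = of_real k * (cen b - cen a)"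
  shows False
proof -
  define D where "D = dist (cen a) (cen b)"
  have D: "D = rad a + rad b" and V: "a \<in> V" "b \<in> V" "y \<in> V" using assms tangent by (auto simp: D_def)
  have pos: "rad a > 0" "rad b > 0" "rad y > 0" using V rad_pos by auto
  have N: "cmod (cen b - cen a) = D" by (simp add: D_def dist_norm norm_minus_commute)
  have nD: "cmod (of_real t * (cen b - cen a)) = \<bar>t\<bar> * D" for t by (simp add: norm_mult N)
  have "dist (cen a) (cen y) = k * D"
    using nD[of k] assms(4) unfolding dist_norm norm_minus_commute[of "cen a"] assms(5) by simp
  then have kD: "k * D = rad a + rad y" using assms(2) tangent by simp
  define p where "p = cen a + of_real (rad a / D) * (cen b - cen a)"
  have D0: "D > 0" using D pos by simp
  have "dist (cen a) p = \<bar>rad a / D\<bar> * D"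
    using nD[of "rad a / D"] unfolding p_def dist_norm by (simp add: norm_minus_commute del: of_real_divide)
  then have 1: "dist (cen a) p \<le> rad a" using D0 pos by simp
  have "cen b - p = of_real (1 - rad a / D) * (cen b - cen a)" by (simp add: p_def algebra_simps)
  then have "dist (cen b) p = \<bar>1 - rad a / D\<bar> * D" unfolding dist_norm by (simp only: nD)
  also have "1 - rad a / D = rad b / D" using D D0 by (simp add: field_simps)
  finally have 2: "dist (cen b) p \<le> rad b" using D0 pos by simp
  have "cen y - p = (cen y - cen a) - of_real (rad a / D) * (cen b - cen a)" by (simp add: p_def)
  also have "\<dots> = of_real (k - rad a / D) * (cen b - cen a)" unfolding assms(5) by (simp add: algebra_simps)
  finally have "dist (cen y) p = \<bar>k - rad a / D\<bar> * D" unfolding dist_norm by (simp only: nD)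
  also have "k - rad a / D = rad y / D" using kD D0 by (simp add: field_simps)
  finally have 3: "dist (cen y) p \<le> rad y" using D0 pos by simp
  show False using no_triple_point[OF V _ 1 2 3] assms E_irrefl by auto
qed

text \<open>If the near ends \<open>a\<close> and \<open>x\<close> differ, their discs touch at
  \<open>p\<close>. As \<open>p\<close> is on both segments, it then also lies in the discs of
  \<open>b\<close> and \<open>y\<close>, so three discs share a point because the edges differ. If
  \<open>a = x\<close>, the two edges leave in different directions.\<close>

lemma segments_meet_aux:
  assumes ab: "(a, b) \<in> E" and xy: "(x, y) \<in> E" and ne: "{a, b} \<noteq> {x, y}"
    and p: "p \<in> closed_segment (cen a) (cen b)" "p \<in> closed_segment (cen x) (cen y)"
    and near: "dist (cen a) p \<le> rad a" "dist (cen x) p \<le> rad x"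
  shows "a = x \<and> p = cen a"
proof (cases "a = x")
  case False
  have V: "a \<in> V" "b \<in> V" "x \<in> V" "y \<in> V" using ab xy in_V by auto
  note c = common_point[OF V(1,3) False near]
  have "dist (cen b) p \<le> rad b" "dist (cen y) p \<le> rad y"
    using segment_point(1)[OF ab p(1)] segment_point(1)[OF xy p(2)] c by auto
  moreover have "a \<noteq> b" "x \<noteq> y" using ab xy E_irrefl by blast+
  ultimately show ?thesis
    using no_triple_point[OF V(1,2,3)] no_triple_point[OF V(1,2,4)] near ne False by (cases "b = x") auto
next
  case True
  then have by': "b \<noteq> y" using ne by auto
  obtain s where s: "0 \<le> s" "s \<le> 1" "p - cen a = of_real s * (cen b - cen a)"
    using p(1) by (auto simp: in_segment scaleR_conv_of_real algebra_simps)
  obtain t where t: "0 \<le> t" "t \<le> 1" "p - cen a = of_real t * (cen y - cen a)"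
    using p(2) True by (auto simp: in_segment scaleR_conv_of_real algebra_simps)
  have "p = cen a"
  proof (rule ccontr)
    assume "p \<noteq> cen a"
    then have st: "0 < s" "0 < t" using s t by (auto simp: less_le)
    have "of_real t * (cen y - cen a) = of_real s * (cen b - cen a)" using s t by simp
    then have "cen y - cen a = of_real (s / t) * (cen b - cen a)" using st by (simp add: field_simps)
    then show False using neighbours_directions[OF ab _ by'] xy True st by (meson divide_pos_pos)
  qed
  then show ?thesis using True by simp
qed

lemma segments_meet:
  assumes ab: "(a, b) \<in> E" and xy: "(x, y) \<in> E" and ne: "{a, b} \<noteq> {x, y}"
    and p: "p \<in> closed_segment (cen a) (cen b)" "p \<in> closed_segment (cen x) (cen y)"
  obtains u where "u \<in> {a, b}" "u \<in> {x, y}" "p = cen u"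
proof -
  note s = closed_segment_commute[of "cen a"] closed_segment_commute[of "cen x"]
  have p': "p \<in> closed_segment (cen b) (cen a)" "p \<in> closed_segment (cen y) (cen x)"
    using p closed_segment_commute by blast+
  have ne': "{b, a} \<noteq> {x, y}" "{a, b} \<noteq> {y, x}" "{b, a} \<noteq> {y, x}" using ne by (auto simp: insert_commute)
  show ?thesis
    using segment_point(2)[OF ab p(1)] segment_point(2)[OF xy p(2)]
      segments_meet_aux[OF ab xy ne p] segments_meet_aux[OF E_sym[OF ab] xy ne'(1) p'(1) p(2)]
      segments_meet_aux[OF ab E_sym[OF xy] ne'(2) p(1) p'(2)]
      segments_meet_aux[OF E_sym[OF ab] E_sym[OF xy] ne'(3) p'] that by blast
qed

end

section \<open>Cones and the orientation of the triangles\<close>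

lemma cross_rcis: "cross (rcis r a) (rcis s b) = r * s * sin (b - a)"
  by (simp add: cross_def sin_diff algebra_simps)

text \<open>Angles are measured from the direction of \<open>z\<close>; that of \<open>y\<close> is
  some \<delta> below \<open>pi\<close>. If \<open>w\<close> came after \<open>y\<close>, the three
  would be in counterclockwise order. So \<open>w\<close> comes before \<open>y\<close> and is a
  positive combination of the two directions.\<close>

lemma cone_of_not_ccw:
  assumes pos: "0 < cross (z - p) (y - p)"
    and w: "w \<noteq> p" "\<And>k. 0 < k \<Longrightarrow> w - p \<noteq> of_real k * (z - p)" "\<And>k. 0 < k \<Longrightarrow> w - p \<noteq> of_real k * (y - p)"
    and n: "\<not> ccw p z y w"
  obtains \<alpha> \<beta> where "0 < \<alpha>" "0 < \<beta>" "w - p = of_real \<alpha> * (z - p) + of_real \<beta> * (y - p)"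
proof -
  let ?A = "z - p" and ?B = "y - p" and ?W = "w - p"
  have ne: "?A \<noteq> 0" "?B \<noteq> 0" using pos by auto
  have nn: "0 < cmod ?A" "0 < cmod ?B" "0 < cmod ?W" using ne w(1) by auto
  define a \<delta> \<gamma> where "a = Arg2pi ?A" and "\<delta> = Arg2pi (?B / ?A)" and "\<gamma> = Arg2pi (?W / ?A)"
  have rA: "?A = rcis (cmod ?A) a" unfolding a_def by (metis Arg2pi_eq rcis_def cis_conv_exp)
  have mult: "X = rcis (cmod X) (a + Arg2pi (X / ?A))" for X
  proof -
    have "X = (X / ?A) * ?A" using ne by simp
    also have "\<dots> = rcis (cmod (X / ?A)) (Arg2pi (X / ?A)) * rcis (cmod ?A) a"
      using rA by (metis Arg2pi_eq rcis_def cis_conv_exp)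
    also have "\<dots> = rcis (cmod X) (a + Arg2pi (X / ?A))"
      using ne by (simp add: rcis_mult norm_divide add.commute)
    finally show ?thesis .
  qed
  have rB: "?B = rcis (cmod ?B) (a + \<delta>)" and rW: "?W = rcis (cmod ?W) (a + \<gamma>)"
    using mult unfolding \<delta>_def \<gamma>_def by blast+
  have rng: "0 \<le> \<delta>" "\<delta> < 2 * pi" "0 \<le> \<gamma>" "\<gamma> < 2 * pi"
    using Arg2pi unfolding \<delta>_def \<gamma>_def by blast+
  have cAB: "cross ?A ?B = cmod ?A * cmod ?B * sin \<delta>"
    using cross_rcis[of "cmod ?A" a "cmod ?B" "a + \<delta>"] rA rB by simp
  moreover have "0 < cmod ?A * cmod ?B" using nn by simp
  ultimately have sin0: "0 < sin \<delta>" using pos zero_less_mult_pos by metis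
  then have "\<delta> \<noteq> 0" by auto
  then have \<delta>: "0 < \<delta>" "\<delta> < pi"
    using rng(1,2) sin_le_zero[of \<delta>] sin0 by linarith+
  have "\<not> \<delta> < \<gamma>"
  proof
    assume "\<delta> < \<gamma>"
    then have "ccw p z y w"
      unfolding ccw_def using \<delta>(1) rng(4) ne w(1) rA rB rW
      by (intro conjI exI[of _ a] exI[of _ "a + \<delta>"] exI[of _ "a + \<gamma>"]) auto
    then show False using n by blast
  qed
  moreover have "\<gamma> \<noteq> \<delta>"
  proof
    assume "\<gamma> = \<delta>"
    then have "?W = rcis (cmod ?W) (a + \<delta>)" using rW by simp
    also have "\<dots> = of_real (cmod ?W / cmod ?B) * rcis (cmod ?B) (a + \<delta>)" using nn by (simp add: rcis_def)
    also have "\<dots> = of_real (cmod ?W / cmod ?B) * ?B" using rB by simp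
    finally show False using w(3)[of "cmod ?W / cmod ?B"] nn by simp
  qed
  moreover have "\<gamma> \<noteq> 0"
  proof
    assume "\<gamma> = 0"
    then have "?W = rcis (cmod ?W) a" using rW by simp
    also have "\<dots> = of_real (cmod ?W / cmod ?A) * rcis (cmod ?A) a" using nn by (simp add: rcis_def)
    also have "\<dots> = of_real (cmod ?W / cmod ?A) * ?A" using rA by simp
    finally show False using w(2)[of "cmod ?W / cmod ?A"] nn by simp
  qed
  ultimately have \<gamma>: "0 < \<gamma>" "\<gamma> < \<delta>" using rng by auto
  have "cross ?A ?W = cmod ?A * cmod ?W * sin \<gamma>"
    using cross_rcis[of "cmod ?A" a "cmod ?W" "a + \<gamma>"] rA rW by simp
  then have 1: "0 < cross ?A ?W" using \<gamma> \<delta> nn by (simp add: sin_gt_zero)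
  have "cross ?W ?B = cmod ?W * cmod ?B * sin (\<delta> - \<gamma>)"
    using cross_rcis[of "cmod ?W" "a + \<gamma>" "cmod ?B" "a + \<delta>"] rB rW by simp
  then have 2: "0 < cross ?W ?B" using \<gamma> \<delta> nn by (simp add: sin_gt_zero)
  show ?thesis
    using that[OF _ _ cross_decompose[of ?A ?B ?W]] 1 2 pos by simp
qed

lemma interior_triangle_iff:
  fixes a b c :: complex
  assumes "cross (b - a) (c - a) \<noteq> 0"
  shows "p \<in> interior (convex hull {a, b, c}) \<longleftrightarrow>
    (\<exists>\<beta> \<gamma>. 0 < \<beta> \<and> 0 < \<gamma> \<and> \<beta> + \<gamma> < 1 \<and> p - a = of_real \<beta> * (b - a) + of_real \<gamma> * (c - a))"
proof -
  have nc: "\<not> collinear {a, b, c}"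
  proof
    assume "collinear {a, b, c}"
    then have "collinear {b, a, c}" by (simp add: insert_commute)
    then obtain u where u: "\<And>x y. x \<in> {b, a, c} \<Longrightarrow> y \<in> {b, a, c} \<Longrightarrow> \<exists>k. x - y = k *\<^sub>R u"
      unfolding collinear_def by blast
    obtain k l where "b - a = k *\<^sub>R u" "c - a = l *\<^sub>R u" using u by (meson insertCI)
    then show False using assms by (simp add: cross_linear)
  qed
  have "interior (convex hull {a, b, c}) = {v. \<exists>x y z. 0 < x \<and> 0 < y \<and> 0 < z \<and> x + y + z = 1 \<and> x *\<^sub>R a + y *\<^sub>R b + z *\<^sub>R c = v}"
    by (rule interior_convex_hull_3_minimal[OF nc]) simp
  also have "p \<in> \<dots> \<longleftrightarrow> (\<exists>\<beta> \<gamma>. 0 < \<beta> \<and> 0 < \<gamma> \<and> \<beta> + \<gamma> < 1 \<and> p - a = of_real \<beta> * (b - a) + of_real \<gamma> * (c - a))"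
  proof
    assume "p \<in> {v. \<exists>x y z. 0 < x \<and> 0 < y \<and> 0 < z \<and> x + y + z = 1 \<and> x *\<^sub>R a + y *\<^sub>R b + z *\<^sub>R c = v}"
    then obtain x y z where xyz: "0 < x" "0 < y" "0 < z" "x + y + z = 1" "x *\<^sub>R a + y *\<^sub>R b + z *\<^sub>R c = p" by blast
    have "x = 1 - y - z" using xyz(4) by simp
    then have "p - a = of_real y * (b - a) + of_real z * (c - a)"
      unfolding xyz(5)[symmetric] \<open>x = 1 - y - z\<close> by (simp add: scaleR_conv_of_real algebra_simps)
    then show "\<exists>\<beta> \<gamma>. 0 < \<beta> \<and> 0 < \<gamma> \<and> \<beta> + \<gamma> < 1 \<and> p - a = of_real \<beta> * (b - a) + of_real \<gamma> * (c - a)"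
      using xyz by (intro exI[of _ y] exI[of _ z]) auto
  next
    assume "\<exists>\<beta> \<gamma>. 0 < \<beta> \<and> 0 < \<gamma> \<and> \<beta> + \<gamma> < 1 \<and> p - a = of_real \<beta> * (b - a) + of_real \<gamma> * (c - a)"
    then obtain y z where yz: "0 < y" "0 < z" "y + z < 1" "p - a = of_real y * (b - a) + of_real z * (c - a)" by blast
    have "p = a + (p - a)" by simp
    also have "\<dots> = (1 - y - z) *\<^sub>R a + y *\<^sub>R b + z *\<^sub>R c"
      unfolding yz(4) by (simp add: scaleR_conv_of_real algebra_simps)
    finally show "p \<in> {v. \<exists>x y z. 0 < x \<and> 0 < y \<and> 0 < z \<and> x + y + z = 1 \<and> x *\<^sub>R a + y *\<^sub>R b + z *\<^sub>R c = v}"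
      using yz by (intro CollectI exI[of _ "1 - y - z"] exI[of _ y] exI[of _ z]) auto
  qed
  finally show ?thesis .
qed

lemma on_segment_of_cone:
  fixes p w y z :: complex
  assumes "0 < \<alpha>" "0 < \<beta>" "1 \<le> \<alpha> + \<beta>" "w - p = of_real \<alpha> * (z - p) + of_real \<beta> * (y - p)"
  obtains s where "s \<in> closed_segment p w" "s \<in> closed_segment z y"
proof -
  define t where "t = 1 / (\<alpha> + \<beta>)"
  define s where "s = p + of_real t * (w - p)"
  have "\<alpha> + \<beta> > 0" using assms by simp
  then have t: "0 < t" "t \<le> 1" "t * (\<alpha> + \<beta>) = 1" using assms(3) by (auto simp: t_def)
  then have t3: "t * \<alpha> + t * \<beta> = 1" by (simp add: distrib_left)
  have 1: "s \<in> closed_segment p w"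
    unfolding in_segment s_def using t by (intro exI[of _ t]) (simp add: scaleR_conv_of_real algebra_simps)
  have s: "s = z + of_real (t * \<beta>) * (y - z)"
  proof -
    have "s = p + of_real (t * \<alpha>) * (z - p) + of_real (t * \<beta>) * (y - p)"
      unfolding s_def assms(4) by (simp add: algebra_simps)
    moreover have "t * \<alpha> = 1 - t * \<beta>" using t3 by simp
    ultimately have "s = p + of_real (1 - t * \<beta>) * (z - p) + of_real (t * \<beta>) * (y - p)" by (simp only:)
    then show ?thesis by (simp add: algebra_simps)
  qed
  have "0 < t * \<beta>" "0 < t * \<alpha>" using t assms by auto
  then have "s \<in> closed_segment z y"
    unfolding in_segment s using t3 \<open>0 < t * \<alpha>\<close> \<open>0 < t * \<beta>\<close> by (intro exI[of _ "t * \<beta>"]) (simp add: scaleR_conv_of_real algebra_simps)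
  with 1 show ?thesis by (rule that)
qed

lemma cross_rotate: "cross (b - a) (c - a) = cross (c - b) (a - b)"
  by (simp add: cross_def algebra_simps)

lemma frontier_interior_triangle:
  fixes a b c :: complex
  assumes "p \<in> frontier (interior (convex hull {a, b, c}))"
  shows "p \<in> closed_segment a b \<union> closed_segment b c \<union> closed_segment c a" "p \<in> convex hull {a, b, c}"
proof -
  have "p \<in> frontier (convex hull {a, b, c})" using assms frontier_interior_subset by blast
  moreover have "closed (convex hull {a, b, c})"
    by (intro compact_imp_closed finite_imp_compact_convex_hull) simp
  ultimately show "p \<in> closed_segment a b \<union> closed_segment b c \<union> closed_segment c a" "p \<in> convex hull {a, b, c}"
    using frontier_of_triangle[of a b c] by (simp_all add: frontier_subset_closed[THEN subsetD])
qed

context disc_packing begin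

lemma outer_cen:
  assumes "t \<in> B"
  shows "0 < cmod (cen t)" "t \<in> V" "rad t = 1 - cmod (cen t)"
  using outer_tangent[OF assms] B_sub assms by auto

text \<open>An outer disc touches the unit circle in the direction of its centre, so it contains the
  part of the radius from its centre outwards.\<close>

lemma radial_in_ball:
  assumes t: "t \<in> B" and k: "1 \<le> k" "cmod (of_real k * cen t) < 1"
  shows "dist (cen t) (of_real k * cen t) < rad t"
proof -
  have "cen t - of_real k * cen t = - (of_real (k - 1) * cen t)" by (simp add: algebra_simps)
  then have "dist (cen t) (of_real k * cen t) = (k - 1) * cmod (cen t)"
    unfolding dist_norm using k(1) by (simp add: norm_mult del: of_real_diff)
  also have "\<dots> = cmod (of_real k * cen t) - cmod (cen t)" using k(1) by (simp add: norm_mult algebra_simps)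
  finally show ?thesis using k(2) outer_cen(3)[OF t] by simp
qed

lemma face_cross_nonzero:
  assumes f: "(x, y, z) \<in> T"
  shows "cross (cen y - cen x) (cen z - cen x) \<noteq> 0"
proof
  assume c: "cross (cen y - cen x) (cen z - cen x) = 0"
  note d = facesE[OF f]
  have "cen y \<noteq> cen x" using cen_inj d by blast
  then obtain k where k: "cen z - cen x = of_real k * (cen y - cen x)"
    using cross_zero_parallel[OF c] by auto
  have "k \<noteq> 0" using k cen_inj[of z x] d by auto
  then consider "0 < k" | "k < 0" by linarith
  then show False
  proof cases
    case 1
    then show ?thesis using neighbours_directions[OF d(1) E_sym[OF d(3)] _ 1 k] d by blast
  next
    case 2
    have "cen z - cen y = (cen z - cen x) - (cen y - cen x)" by simp
    also have "\<dots> = of_real (1 - k) * (cen x - cen y)" unfolding k by (simp add: algebra_simps)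
    finally show ?thesis using neighbours_directions[OF E_sym[OF d(1)] d(2), of "1 - k"] d 2 by auto
  qed
qed

text \<open>In a clockwise triangle the directions that \<open>rotation\<close> leaves to
  \<open>w\<close> are those inside the angle at \<open>x\<close>. The edge to \<open>w\<close>
  cannot cross the opposite side, which keeps \<open>cen w\<close> in the triangle.\<close>

lemma neighbour_in_negative_face:
  assumes f: "(x, y, z) \<in> T" and neg: "cross (cen y - cen x) (cen z - cen x) < 0"
    and w: "(x, w) \<in> E" "w \<notin> {y, z}"
  shows "cen w \<in> interior (convex hull {cen x, cen y, cen z})"
proof -
  note d = facesE[OF f]
  have xz: "(x, z) \<in> E" using E_sym[OF d(3)] .
  have pos: "0 < cross (cen z - cen x) (cen y - cen x)" using neg cross_commute[of "cen z - cen x"] by simp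
  have wx: "cen w \<noteq> cen x" using cen_inj[of w x] in_V[OF w(1)] E_irrefl[OF w(1)] by blast
  have nz: "cen w - cen x \<noteq> of_real k * (cen z - cen x)" if "0 < k" for k
    using neighbours_directions[OF xz w(1) _ that] w(2) by blast
  have ny: "cen w - cen x \<noteq> of_real k * (cen y - cen x)" if "0 < k" for k
    using neighbours_directions[OF d(1) w(1) _ that] w(2) by blast
  obtain \<alpha> \<beta> where ab: "0 < \<alpha>" "0 < \<beta>"
    "cen w - cen x = of_real \<alpha> * (cen z - cen x) + of_real \<beta> * (cen y - cen x)"
    using cone_of_not_ccw[OF pos wx nz ny rotation[OF f w]] by blast
  have "\<alpha> + \<beta> < 1"
  proof (rule ccontr)
    assume "\<not> \<alpha> + \<beta> < 1"
    then obtain s where s: "s \<in> closed_segment (cen x) (cen w)" "s \<in> closed_segment (cen z) (cen y)"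
      using on_segment_of_cone[OF ab(1,2) _ ab(3)] by auto
    have "{x, w} \<noteq> {z, y}" using d(4-6) by (auto simp: doubleton_eq_iff)
    then obtain u where "u \<in> {x, w}" "u \<in> {z, y}"
      using segments_meet[OF w(1) E_sym[OF d(2)] _ s] by blast
    then show False using d(4-6) w(2) by auto
  qed
  then show ?thesis
    unfolding interior_triangle_iff[OF face_cross_nonzero[OF f]] using ab
    by (intro exI[of _ \<beta>] exI[of _ \<alpha>]) simp
qed

text \<open>
  In a negatively oriented triangle all other vertices would be trapped, as every neighbour of a
  corner lies inside the triangle; but outer circles touch the unit circle.
\<close>

lemma face_positive:
  assumes f: "(x, y, z) \<in> T"
  shows "0 < cross (cen y - cen x) (cen z - cen x)"
proof (rule ccontr)
  assume "\<not> ?thesis"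
  then have neg: "cross (cen y - cen x) (cen z - cen x) < 0" using face_cross_nonzero[OF f] by simp
  note d = facesE[OF f]
  let ?H = "convex hull {cen x, cen y, cen z}"
  let ?I = "interior ?H"
  have trap: "cen w \<in> ?I" if "u \<in> {x, y, z}" "(u, w) \<in> E" "w \<notin> {x, y, z}" for u w
  proof -
    have neg2: "cross (cen z - cen y) (cen x - cen y) < 0" using neg cross_rotate[of "cen y" "cen x" "cen z"] by simp
    have neg3: "cross (cen x - cen z) (cen y - cen z) < 0" using neg2 cross_rotate[of "cen z" "cen y" "cen x"] by simp
    have h: "{cen y, cen z, cen x} = {cen x, cen y, cen z}" "{cen z, cen x, cen y} = {cen x, cen y, cen z}" by auto
    show ?thesis
      using that neighbour_in_negative_face[OF f neg, of w] neighbour_in_negative_face[OF rot[OF f] neg2, of w]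
        neighbour_in_negative_face[OF rot[OF rot[OF f]] neg3, of w]
      unfolding h by blast
  qed
  have side: "p \<in> closed_segment (cen a) (cen b) \<Longrightarrow> (a, b) \<in> E" if "(a, b) \<in> {(x, y), (y, z), (z, x)}" for a b p
    using that d by auto
  have step: "cen w \<in> ?I" if uw: "cen u \<in> ?I" "u \<notin> {x, y, z}" "(u, w) \<in> E" "w \<notin> {x, y, z}" for u w
  proof (rule ccontr)
    assume nw: "cen w \<notin> ?I"
    have "closed_segment (cen u) (cen w) \<inter> frontier ?I \<noteq> {}"
    proof (rule connected_Int_frontier)
      show "closed_segment (cen u) (cen w) \<inter> ?I \<noteq> {}" using uw(1) by auto
      show "closed_segment (cen u) (cen w) - ?I \<noteq> {}" using nw by auto
    qed simp
    then obtain p where p: "p \<in> closed_segment (cen u) (cen w)" "p \<in> frontier ?I" by blast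
    then obtain a b where ab: "(a, b) \<in> {(x, y), (y, z), (z, x)}" "p \<in> closed_segment (cen a) (cen b)"
      using frontier_interior_triangle(1)[OF p(2)] by blast
    have abE: "(a, b) \<in> E" using ab(1) d by auto
    have "{u, w} \<noteq> {a, b}" using ab(1) uw by (auto simp: doubleton_eq_iff)
    then obtain v where "v \<in> {u, w}" "v \<in> {a, b}" using segments_meet[OF uw(3) abE _ p(1) ab(2)] by blast
    then show False using ab(1) uw by auto
  qed
  define Z where "Z = {u \<in> V. u \<in> {x, y, z} \<or> cen u \<in> ?I}"
  have "Z = V"
  proof (rule E_conn)
    fix a b assume ab: "a \<in> Z" "(a, b) \<in> E"
    show "b \<in> Z"
    proof (cases "b \<in> {x, y, z}")
      case False
      have "cen b \<in> ?I"
      proof (cases "a \<in> {x, y, z}")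
        case True
        then show ?thesis using trap ab(2) False by blast
      next
        case a: False
        then show ?thesis using step[OF _ a ab(2) False] ab(1) by (simp add: Z_def)
      qed
      then show ?thesis using in_V(2)[OF ab(2)] by (simp add: Z_def)
    qed (use in_V(2)[OF ab(2)] in \<open>auto simp: Z_def\<close>)
  qed (use d in \<open>auto simp: Z_def\<close>)
  obtain t where t: "t \<in> B" "t \<notin> {x, y, z}" using outer_off_face[OF f] by blast
  note ot = outer_cen[OF t(1)]
  have ct: "cen t \<in> ?I" using \<open>Z = V\<close> ot(2) t(2) by (auto simp: Z_def)
  have H1: "cmod p < 1" if "p \<in> ?H" for p
  proof -
    have "?H \<subseteq> ball 0 1" using cen_less_1 d by (intro hull_minimal) auto
    then show ?thesis using that by auto
  qed
  \<comment> \<open>Along the radius through \<open>cen t\<close> one leaves the triangle while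
    still in the open disc of \<open>t\<close>. The exit point is on a side and so also in the disc
    of a corner, which is different from \<open>t\<close>.\<close>
  define e where "e = of_real (1 / cmod (cen t)) * cen t"
  have e1: "cmod e = 1" using ot(1) by (simp add: e_def norm_mult norm_divide)
  then have "e \<notin> ?I" using H1[of e] interior_subset by fastforce
  have "closed_segment (cen t) e \<inter> frontier ?I \<noteq> {}"
  proof (rule connected_Int_frontier)
    show "closed_segment (cen t) e \<inter> ?I \<noteq> {}" using ct by auto
    show "closed_segment (cen t) e - ?I \<noteq> {}" using \<open>e \<notin> ?I\<close> by auto
  qed simp
  then obtain p where p: "p \<in> closed_segment (cen t) e" "p \<in> frontier ?I" by blast
  have p1: "cmod p < 1" using H1 frontier_interior_triangle(2)[OF p(2)] by blast
  obtain s where s: "0 \<le> s" "s \<le> 1" "p = (1 - s) *\<^sub>R cen t + s *\<^sub>R e" using p(1) by (auto simp: in_segment)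
  have pk: "p = of_real ((1 - s) + s * (1 / cmod (cen t))) * cen t"
    unfolding s(3) e_def by (simp add: scaleR_conv_of_real algebra_simps)
  have "1 \<le> (1 - s) + s * (1 / cmod (cen t))"
  proof -
    have "1 \<le> 1 / cmod (cen t)" using ot cen_less_1[OF ot(2)] by (simp add: field_simps)
    then have "s * 1 \<le> s * (1 / cmod (cen t))" using s(1) by (intro mult_left_mono) auto
    then show ?thesis by simp
  qed
  then have dt: "dist (cen t) p < rad t" using radial_in_ball[OF t(1)] pk p1 by metis
  obtain a b where ab: "(a, b) \<in> {(x, y), (y, z), (z, x)}" "p \<in> closed_segment (cen a) (cen b)"
    using frontier_interior_triangle(1)[OF p(2)] by blast
  have abE: "(a, b) \<in> E" "a \<noteq> t" "b \<noteq> t" using ab(1) d t(2) by auto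
  then show False
    using segment_point(2)[OF abE(1) ab(2)] ball_cball_disjoint[OF ot(2) in_V(1)[OF abE(1)] _ dt]
      ball_cball_disjoint[OF ot(2) in_V(2)[OF abE(1)] _ dt] by blast
qed

end

text \<open>The signed angle, in full turns, under which the segment from \<open>a\<close> to
  \<open>b\<close> is seen from \<open>q\<close>. The imaginary part of the winding number only
  records the change of the distance to \<open>q\<close>.\<close>

definition turn :: "complex \<Rightarrow> complex \<Rightarrow> complex \<Rightarrow> real" where
  "turn q a b = Re (winding_number (linepath a b) q)"

lemma turn_anti: "q \<notin> closed_segment a b \<Longrightarrow> turn q b a = - turn q a b"
  using winding_number_reversepath[of "linepath a b" q] by (simp add: turn_def)

lemma isCont_turn:
  assumes "q \<notin> closed_segment a b"
  shows "isCont (\<lambda>q. turn q a b) q"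
  unfolding turn_def using assms by (intro isCont_Re continuous_at_winding_number) auto

lemma turn_triangle:
  assumes pos: "0 < cross (b - a) (c - a)"
    and q: "q \<notin> closed_segment a b" "q \<notin> closed_segment b c" "q \<notin> closed_segment c a"
  shows "turn q a b + turn q b c + turn q c a = (if q \<in> interior (convex hull {a, b, c}) then 1 else 0)"
proof -
  let ?g = "linepath a b +++ linepath b c +++ linepath c a"
  have im: "path_image ?g = closed_segment a b \<union> closed_segment b c \<union> closed_segment c a"
    by (simp add: path_image_join Un_assoc)
  have sum: "turn q a b + turn q b c + turn q c a = Re (winding_number ?g q)"
    using q by (simp add: turn_def winding_number_join path_image_join)
  show ?thesis
  proof (cases "q \<in> interior (convex hull {a, b, c})")
    case True
    then obtain \<beta> \<gamma> where bc: "0 < \<gamma>" "q - a = of_real \<beta> * (b - a) + of_real \<gamma> * (c - a)"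
      using interior_triangle_iff[of b a c q] pos by auto
    have "b - q = (b - a) - (q - a)" by simp
    also have "\<dots> = of_real (1 - \<beta>) * (b - a) - of_real \<gamma> * (c - a)"
      unfolding bc(2) by (simp add: algebra_simps)
    finally have "cross (b - a) (b - q) = - (\<gamma> * cross (b - a) (c - a))" by (simp only: cross_linear cross_simps)
    moreover have "Im ((b - a) * cnj (b - q)) = - cross (b - a) (b - q)" by (simp add: cross_def algebra_simps)
    ultimately have "0 < Im ((b - a) * cnj (b - q))" using pos bc(1) by simp
    then show ?thesis using True sum winding_number_triangle[OF True] by simp
  next
    case False
    then have "q \<notin> convex hull {a, b, c}" using q interior_of_triangle[of a b c] by auto
    moreover have "path_image ?g \<subseteq> convex hull {a, b, c}"
      unfolding im by (intro Un_least closed_segment_subset) (auto intro: hull_inc)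
    ultimately have "winding_number ?g q = 0"
      by (intro winding_number_zero_outside[of _ "convex hull {a, b, c}"]) auto
    then show ?thesis using False sum by simp
  qed
qed

lemma interior_triangle_nonempty:
  assumes "0 < cross (b - a) (c - a)" "e > 0"
  obtains p where "p \<in> interior (convex hull {a, b, c})" "dist a p < e"
proof -
  define m where "m = cmod (b - a) + cmod (c - a) + 1"
  define t where "t = min (1/3) (e / (2 * m))"
  have m: "m > 0" by (simp add: m_def add_nonneg_pos)
  have t: "0 < t" "t \<le> 1/3" "t \<le> e / (2 * m)" using m assms(2) by (auto simp: t_def)
  let ?p = "a + of_real t * (b - a) + of_real t * (c - a)"
  have "dist a ?p = cmod (of_real t * (b - a) + of_real t * (c - a))"
    unfolding dist_norm norm_minus_commute[of a] by (simp add: add.assoc)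
  also have "\<dots> \<le> t * cmod (b - a) + t * cmod (c - a)"
    using norm_triangle_ineq[of "of_real t * (b - a)" "of_real t * (c - a)"] t(1) by (simp add: norm_mult)
  also have "\<dots> \<le> t * m" using t(1) by (simp add: m_def algebra_simps)
  also have "\<dots> \<le> e / (2 * m) * m" using t(3) m by (intro mult_right_mono) auto
  also have "\<dots> < e" using m assms(2) by simp
  finally have "dist a ?p < e" .
  moreover have "?p \<in> interior (convex hull {a, b, c})"
    using assms t by (subst interior_triangle_iff) (auto intro!: exI[of _ t])
  ultimately show ?thesis using that by blast
qed

lemma interior_finite_Union_closed:
  assumes "finite \<A>" "\<And>A. A \<in> \<A> \<Longrightarrow> closed A" "\<And>A. A \<in> \<A> \<Longrightarrow> interior A = {}"
  shows "interior (\<Union>\<A>) = {}"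
  using assms
proof (induction rule: finite_induct)
  case (insert A \<A>)
  then show ?case using interior_closed_Un_empty_interior[of A "\<Union>\<A>"] by simp
qed simp

text \<open>Off all segments between points of \<open>P\<close>, every \<open>turn\<close> is
  antisymmetric and \<open>turn_triangle\<close> applies. Such points are dense when
  \<open>P\<close> is finite, and continuity carries the counts over to other points.\<close>

definition generic :: "complex set \<Rightarrow> complex \<Rightarrow> bool" where
  "generic P q \<longleftrightarrow> (\<forall>x\<in>P. \<forall>y\<in>P. q \<notin> closed_segment x y)"

lemma generic_dense:
  assumes "finite P" "open N" "N \<noteq> {}"
  obtains q where "q \<in> N" "generic P q"
proof -
  let ?A = "(\<lambda>(x, y). closed_segment x y) ` (P \<times> P)"
  have "interior (\<Union>?A) = {}"
    using assms(1) by (intro interior_finite_Union_closed) (auto simp: interior_closed_segment_ge2)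
  then have "\<not> N \<subseteq> \<Union>?A" using assms(2,3) by (metis interior_maximal subset_empty)
  then show ?thesis using that unfolding generic_def by fastforce
qed

context disc_packing begin

lemma link_in_X_nbr: "(a, b, c) \<in> link X \<Longrightarrow> (c, a) \<in> E \<and> (c, b) \<in> E \<and> (a, b) \<in> E \<and> a \<notin> X \<and> b \<notin> X \<and> c \<in> X"
  using facesE[of a b c] E_sym unfolding link_def by blast

lemma touching_sub: "touching X \<subseteq> T"
  by (auto simp: touching_def)

text \<open>The factor 3 appears because the right-hand side counts each triangle in its three
  rotations.\<close>

lemma sum_turn_touching:
  assumes q: "generic (cen ` V) q"
  shows "3 * (\<Sum>(a, b, c)\<in>touching X. turn q (cen a) (cen b)) =
    real (card {(a, b, c) \<in> touching X. q \<in> interior (convex hull {cen a, cen b, cen c})})"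
proof -
  have "3 * (\<Sum>(a, b, c)\<in>touching X. turn q (cen a) (cen b)) = (\<Sum>(a, b, c)\<in>touching X.
      turn q (cen a) (cen b) + turn q (cen b) (cen c) + turn q (cen c) (cen a))"
    by (rule touching_sum_thrice)
  also have "\<dots> = (\<Sum>(a, b, c)\<in>touching X. if q \<in> interior (convex hull {cen a, cen b, cen c}) then 1 else 0)"
  proof (rule sum.cong[OF refl], clarify)
    fix a b c assume "(a, b, c) \<in> touching X"
    then have f: "(a, b, c) \<in> T" using touching_sub by blast
    show "turn q (cen a) (cen b) + turn q (cen b) (cen c) + turn q (cen c) (cen a) =
        (if q \<in> interior (convex hull {cen a, cen b, cen c}) then 1 else 0)"
      using q facesE(7-9)[OF f] by (intro turn_triangle face_positive[OF f]) (auto simp: generic_def)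
  qed
  also have "\<dots> = real (card {t \<in> touching X. case t of (a, b, c) \<Rightarrow> q \<in> interior (convex hull {cen a, cen b, cen c})})"
    unfolding case_prod_unfold by (subst sum.inter_filter[symmetric]) auto
  finally show ?thesis by (simp add: case_prod_unfold)
qed

lemma sum_turn_touching_ge_1:
  assumes q: "generic (cen ` V) q" and f: "(a, b, c) \<in> touching X" "q \<in> interior (convex hull {cen a, cen b, cen c})"
  shows "1 \<le> (\<Sum>(a, b, c)\<in>touching X. turn q (cen a) (cen b))"
proof -
  let ?S = "{(a, b, c) \<in> touching X. q \<in> interior (convex hull {cen a, cen b, cen c})}"
  have h: "{cen b, cen c, cen a} = {cen a, cen b, cen c}" "{cen c, cen a, cen b} = {cen a, cen b, cen c}" by auto
  have "{(a, b, c), (b, c, a), (c, a, b)} \<subseteq> ?S"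
    using f touching_rot[OF f(1)] touching_rot[OF touching_rot[OF f(1)]] by (simp add: h)
  moreover have "finite ?S" by (rule finite_subset[OF _ finite_sub(1)[of X]]) auto
  ultimately have "card {(a, b, c), (b, c, a), (c, a, b)} \<le> card ?S" by (rule card_mono[rotated])
  moreover have "(a, b, c) \<in> T" using f touching_sub by blast
  then have "card {(a, b, c), (b, c, a), (c, a, b)} = 3" using facesE(4-6) by simp
  ultimately show ?thesis using sum_turn_touching[OF q, of X] by linarith
qed

lemma exits_inner_set:
  assumes "X \<subseteq> V" "X \<noteq> {}" "X \<inter> B = {}"
  obtains a b c where "(a, b, c) \<in> T" "a \<in> X"
proof -
  have "X \<noteq> V" using assms(3) B_nonempty B_sub by blast
  then obtain a b where "a \<in> X" "(a, b) \<in> E" using E_conn[OF assms(1,2)] by blast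
  then show ?thesis using inner_edge_face[of a b] assms(3) that by blast
qed

text \<open>No boundary edge is incident to \<open>X\<close>, so the triangles touching
  \<open>X\<close> have as total boundary their edges opposite \<open>X\<close>. These all join
  \<open>a\<close> and \<open>b\<close> and contribute multiples of a single angle. The total
  multiple is the sum of a coboundary and vanishes, although a point in a triangle at
  \<open>X\<close> is counted at least once.\<close>

lemma no_trapped_component:
  assumes X: "X \<subseteq> V" "X \<noteq> {}" "X \<inter> B = {}"
    and nbr: "\<And>u w. u \<in> X \<Longrightarrow> (u, w) \<in> E \<Longrightarrow> w \<in> X \<union> {a, b}"
  shows False
proof -
  obtain x y z where f: "(x, y, z) \<in> T" "x \<in> X" using exits_inner_set[OF X] .
  obtain q0 where "q0 \<in> interior (convex hull {cen x, cen y, cen z})"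
    using interior_triangle_nonempty[OF face_positive[OF f(1)], of 1] by auto
  then obtain q where q: "q \<in> interior (convex hull {cen x, cen y, cen z})" "generic (cen ` V) q"
    using generic_dense[of "cen ` V" "interior (convex hull {cen x, cen y, cen z})"] finite_V by blast
  have bal: "{(a, b) \<in> bdry. a \<in> X \<or> b \<in> X} = {}"
    using inner_edge_face E_sym T_edges X(3) unfolding bdry_def by blast
  have lk: "(\<Sum>(x, y, z)\<in>touching X. f x y) = (\<Sum>(x, y, z)\<in>link X. f x y)"
    if "\<And>x y. (x, y) \<in> edges \<Longrightarrow> f y x = - f x y" for f :: "'v \<Rightarrow> 'v \<Rightarrow> real"
    using sum_touching[of X f] that bal by simp
  define g where "g x = (if x = b then 1 else 0 :: real)" for x
  define \<kappa> where "\<kappa> = turn q (cen a) (cen b)"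
  have anti: "turn q (cen y) (cen x) = - turn q (cen x) (cen y)" if "x \<in> V" "y \<in> V" for x y
    using turn_anti[of q "cen x" "cen y"] q(2) that by (simp add: generic_def)
  have "(\<Sum>(x, y, z)\<in>touching X. turn q (cen x) (cen y)) = (\<Sum>(x, y, z)\<in>link X. turn q (cen x) (cen y))"
  proof (rule lk)
    fix x y assume "(x, y) \<in> edges"
    then have "x \<in> V" "y \<in> V" using facesE(7,8) by (auto simp: edges_def)
    then show "turn q (cen y) (cen x) = - turn q (cen x) (cen y)" by (rule anti)
  qed
  also have "\<dots> = (\<Sum>(x, y, z)\<in>link X. \<kappa> * (g y - g x))"
  proof (rule sum.cong[OF refl], clarify)
    fix x y z assume l: "(x, y, z) \<in> link X"
    note n = link_in_X_nbr[OF l]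
    then have xy: "x \<in> {a, b}" "y \<in> {a, b}" "x \<noteq> y" using nbr[of z x] nbr[of z y] E_irrefl[of x y] by blast+
    have "x \<in> V" "y \<in> V" using in_V[of x y] n by blast+
    then show "turn q (cen x) (cen y) = \<kappa> * (g y - g x)"
      using anti[of a b] xy by (auto simp: \<kappa>_def g_def)
  qed
  also have "\<dots> = \<kappa> * (\<Sum>(x, y, z)\<in>link X. g y - g x)" by (simp add: sum_distrib_left case_prod_unfold)
  also have "(\<Sum>(x, y, z)\<in>link X. g y - g x) = (\<Sum>(x, y, z)\<in>touching X. g y - g x)"
    by (rule lk[symmetric]) simp
  also have "\<dots> = 0"
    using touching_sum_thrice[of "\<lambda>x y. g y - g x" X] by (simp add: case_prod_unfold)
  finally have "(\<Sum>(x, y, z)\<in>touching X. turn q (cen x) (cen y)) = 0" by simp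
  moreover have "(x, y, z) \<in> touching X" using f by (simp add: touching_def)
  ultimately show False using sum_turn_touching_ge_1[OF q(2) _ q(1)] by fastforce
qed

section \<open>Boundary edges and the region beyond them\<close>

lemma bdryD:
  assumes "(a, b) \<in> bdry"
  shows "(a, b) \<in> E" "a \<in> B" "b \<in> B" "a \<in> V" "b \<in> V" "a \<noteq> b" "\<rho> \<notin> {a, b}"
proof -
  show e: "(a, b) \<in> E" using assms T_edges by (auto simp: bdry_def)
  show B: "a \<in> B" "b \<in> B"
    using inner_edge_face[OF E_sym[OF e]] assms by (auto simp: bdry_def)
  show "a \<in> V" "b \<in> V" "a \<noteq> b" "\<rho> \<notin> {a, b}" using e B in_V E_irrefl root by blast+
qed

lemma no_radial:
  assumes a: "a \<in> B" and u: "u \<in> V" "u \<noteq> a" "dist (cen u) p \<le> rad u" and k: "1 \<le> k" "p = of_real k * cen a" "cmod p < 1"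
  shows False
  using radial_in_ball[OF a k(1)] k(2,3) ball_cball_disjoint[OF _ u(1) _ _ u(3)] u(2) outer_cen(2)[OF a] by blast

text \<open>If the centres were on one ray from the origin, one of the discs would contain the
  centre of the other. If they were on opposite rays, the edge would pass through the origin, inside
  the disc of the root.\<close>

lemma bdry_cross_nonzero:
  assumes ab: "(a, b) \<in> bdry"
  shows "cross (cen a) (cen b) \<noteq> 0"
proof
  assume c: "cross (cen a) (cen b) = 0"
  note d = bdryD[OF ab]
  have pos: "0 < rad a" "0 < rad b" using d rad_pos by blast+
  have "cen a \<noteq> 0" "cen b \<noteq> 0" using outer_cen(1)[OF d(2)] outer_cen(1)[OF d(3)] by auto
  then obtain k where k: "cen b = of_real k * cen a" using cross_zero_parallel[OF c] by blast
  have "k \<noteq> 0" using k \<open>cen b \<noteq> 0\<close> by auto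
  then consider "1 \<le> k" | "0 < k" "k < 1" | "k < 0" by linarith
  then show False
  proof cases
    case 1
    then show ?thesis using no_radial[OF d(2,5) _ _ 1 k] pos cen_less_1[OF d(5)] d(6) by auto
  next
    case 2
    then have "cen a = of_real (1 / k) * cen b" "1 \<le> 1 / k" using k by auto
    then show ?thesis using no_radial[OF d(3,4) _ _ _ \<open>cen a = _\<close>] pos cen_less_1[OF d(4)] d(6) by auto
  next
    case 3
    define t where "t = 1 / (1 - k)"
    have t: "0 \<le> t" "t \<le> 1" "(1 - t) + t * k = 0" using 3 by (auto simp: t_def field_simps)
    have "(1 - t) *\<^sub>R cen a + t *\<^sub>R cen b = of_real ((1 - t) + t * k) * cen a"
      unfolding k by (simp add: scaleR_conv_of_real algebra_simps)
    then have "(1 - t) *\<^sub>R cen a + t *\<^sub>R cen b = 0" unfolding t(3) by simp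
    then have "0 \<in> closed_segment (cen a) (cen b)" using t(1,2) unfolding in_segment by metis
    moreover have "dist (cen \<rho>) 0 < rad \<rho>" using root_centre rad_pos root by simp
    ultimately show ?thesis
      using segment_point(2)[OF d(1)] ball_cball_disjoint[of \<rho> a 0] ball_cball_disjoint[of \<rho> b 0] d root by blast
  qed
qed

text \<open>Together with \<open>coord2\<close>, the coordinates in the basis \<open>cen a\<close>,
  \<open>cen b\<close> by Cramer's rule; they add up to 1 on the line through the two
  centres.\<close>

definition coord1 :: "'v \<Rightarrow> 'v \<Rightarrow> complex \<Rightarrow> real" where
  "coord1 a b p = cross p (cen b) / cross (cen a) (cen b)"

definition coord2 :: "'v \<Rightarrow> 'v \<Rightarrow> complex \<Rightarrow> real" where
  "coord2 a b p = cross (cen a) p / cross (cen a) (cen b)"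

lemma coords:
  assumes "cross (cen a) (cen b) \<noteq> 0"
  shows "p = of_real (coord1 a b p) * cen a + of_real (coord2 a b p) * cen b"
    "coord1 a b (of_real \<alpha> * cen a + of_real \<beta> * cen b) = \<alpha>"
    "coord2 a b (of_real \<alpha> * cen a + of_real \<beta> * cen b) = \<beta>"
  using cross_decompose[OF assms, of p] assms by (simp_all add: coord1_def coord2_def cross_linear)

lemma on_bdry_segment:
  assumes c: "cross (cen a) (cen b) \<noteq> 0" and "0 \<le> coord1 a b p" "0 \<le> coord2 a b p" "coord1 a b p + coord2 a b p = 1"
  shows "p \<in> closed_segment (cen a) (cen b)"
proof -
  have "coord1 a b p = 1 - coord2 a b p" using assms by simp
  then have "p = (1 - coord2 a b p) *\<^sub>R cen a + coord2 a b p *\<^sub>R cen b"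
    using coords(1)[OF c, of p] by (simp add: scaleR_conv_of_real)
  then show ?thesis using assms unfolding in_segment by (intro exI[of _ "coord2 a b p"]) auto
qed

definition beyond :: "'v \<Rightarrow> 'v \<Rightarrow> complex set" where
  "beyond a b = {p. 0 < coord1 a b p \<and> 0 < coord2 a b p \<and> 1 < coord1 a b p + coord2 a b p}"

lemma continuous_coords: "continuous_on UNIV (coord1 a b)" "continuous_on UNIV (coord2 a b)"
  unfolding coord1_def coord2_def cross_def divide_inverse by (intro continuous_intros)+

lemma frontier_beyond:
  assumes "p \<in> frontier (beyond a b)"
  shows "0 \<le> coord1 a b p" "0 \<le> coord2 a b p" "1 \<le> coord1 a b p + coord2 a b p"
    "coord1 a b p = 0 \<or> coord2 a b p = 0 \<or> coord1 a b p + coord2 a b p = 1"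
proof -
  note c = continuous_coords[of a b]
  have "open (beyond a b)" unfolding beyond_def
    by (intro open_Collect_conj open_Collect_less continuous_intros c)
  then have "p \<notin> beyond a b" using assms by (simp add: frontier_def interior_open)
  moreover have "closed {p. 0 \<le> coord1 a b p \<and> 0 \<le> coord2 a b p \<and> 1 \<le> coord1 a b p + coord2 a b p}"
    by (intro closed_Collect_conj closed_Collect_le continuous_intros c)
  then have "closure (beyond a b) \<subseteq> {p. 0 \<le> coord1 a b p \<and> 0 \<le> coord2 a b p \<and> 1 \<le> coord1 a b p + coord2 a b p}"
    by (rule closure_minimal[rotated]) (auto simp: beyond_def)
  then have "p \<in> {p. 0 \<le> coord1 a b p \<and> 0 \<le> coord2 a b p \<and> 1 \<le> coord1 a b p + coord2 a b p}"
    using assms by (auto simp: frontier_def)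
  ultimately show "0 \<le> coord1 a b p" "0 \<le> coord2 a b p" "1 \<le> coord1 a b p + coord2 a b p"
    "coord1 a b p = 0 \<or> coord2 a b p = 0 \<or> coord1 a b p + coord2 a b p = 1"
    by (auto simp: beyond_def)
qed

lemma edge_in_disc:
  assumes "(u, w) \<in> E" "p \<in> closed_segment (cen u) (cen w)"
  shows "cmod p < 1"
proof -
  have "closed_segment (cen u) (cen w) \<subseteq> ball 0 1"
    using cen_less_1 in_V[OF assms(1)] by (intro closed_segment_subset) auto
  then show ?thesis using assms(2) by auto
qed

text \<open>Inside the unit disc, the radii from \<open>cen a\<close> and \<open>cen b\<close>
  outwards lie in the open discs of \<open>a\<close> and \<open>b\<close>, while each point of an
  edge is in the disc of one of its ends.\<close>

lemma edge_avoids_rays: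
  assumes ab: "(a, b) \<in> bdry" and uw: "(u, w) \<in> E" "p \<in> closed_segment (cen u) (cen w)"
    and c: "0 \<le> coord1 a b p" "0 \<le> coord2 a b p" "1 \<le> coord1 a b p + coord2 a b p"
  shows "coord1 a b p = 0 \<Longrightarrow> b \<in> {u, w}" "coord2 a b p = 0 \<Longrightarrow> a \<in> {u, w}"
proof -
  note d = bdryD[OF ab] and p1 = edge_in_disc[OF uw] and co = coords(1)[OF bdry_cross_nonzero[OF ab], of p]
  show "b \<in> {u, w}" if "coord1 a b p = 0"
    using that co c segment_point(2)[OF uw] no_radial[OF d(3), of _ p "coord2 a b p"] p1 in_V[OF uw(1)] by auto
  show "a \<in> {u, w}" if "coord2 a b p = 0"
    using that co c segment_point(2)[OF uw] no_radial[OF d(2), of _ p "coord1 a b p"] p1 in_V[OF uw(1)] by auto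
qed

text \<open>
  The region cut off from the disc by a boundary edge together with the radii through its ends
  contains no centre: it is separated from the rest, and one of the two sides misses all outer
  circles.
\<close>

lemma nothing_beyond:
  assumes ab: "(a, b) \<in> bdry" and u: "u \<in> V" "u \<notin> {a, b}"
  shows "cen u \<notin> beyond a b"
proof
  assume ub: "cen u \<in> beyond a b"
  note d = bdryD[OF ab] and cn = bdry_cross_nonzero[OF ab]
  define U where "U = {u \<in> V. u \<notin> {a, b} \<and> cen u \<in> beyond a b}"
  define W where "W = V - U - {a, b}"
  have stepU: "w \<in> U \<union> {a, b}" if x: "x \<in> U" "(x, w) \<in> E" for x w
  proof (rule ccontr)
    assume w: "w \<notin> U \<union> {a, b}"
    have "closed_segment (cen x) (cen w) \<inter> frontier (beyond a b) \<noteq> {}"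
    proof (rule connected_Int_frontier)
      show "closed_segment (cen x) (cen w) \<inter> beyond a b \<noteq> {}" using x by (auto simp: U_def)
      show "closed_segment (cen x) (cen w) - beyond a b \<noteq> {}"
        using w in_V(2)[OF x(2)] by (auto simp: U_def)
    qed simp
    then obtain p where p: "p \<in> closed_segment (cen x) (cen w)" "p \<in> frontier (beyond a b)" by blast
    note fb = frontier_beyond[OF p(2)]
    have dis: "{x, w} \<inter> {a, b} = {}" using x(1) w by (auto simp: U_def)
    \<comment> \<open>Leaving the region means crossing the boundary edge, which
      \<open>segments_meet\<close> excludes, or one of the two radii.\<close>
    show False
    proof (cases "coord1 a b p + coord2 a b p = 1")
      case True
      then have "p \<in> closed_segment (cen a) (cen b)" using on_bdry_segment[OF cn fb(1,2)] by blast
      moreover have "{x, w} \<noteq> {a, b}" using dis by auto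
      ultimately show ?thesis using segments_meet[OF x(2) d(1) _ p(1)] dis by blast
    next
      case False
      then show ?thesis using edge_avoids_rays[OF ab x(2) p(1) fb(1-3)] fb(4) dis by blast
    qed
  qed
  have stepW: "w \<in> W \<union> {a, b}" if "x \<in> W" "(x, w) \<in> E" for x w
    using stepU[of w x] E_sym[OF that(2)] in_V(2)[OF that(2)] that(1) by (auto simp: W_def)
  have "u \<in> U" using u ub by (simp add: U_def)
  have "\<rho> \<in> W" using d(7) root root_centre by (auto simp: W_def U_def beyond_def coord1_def)
  show False
  proof (cases "U \<inter> B = {}")
    case True
    then show ?thesis using no_trapped_component[of U a b] stepU \<open>u \<in> U\<close> by (auto simp: U_def)
  next
    case False
    then obtain t where t: "t \<in> U" "t \<in> B" by blast
    then have "t \<notin> {a, b}" by (auto simp: U_def)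
    then have "B \<subseteq> U \<union> {a, b}" using outer_conn[of a b U t] ab stepU t by blast
    then have "W \<inter> B = {}" by (auto simp: W_def)
    then show ?thesis using no_trapped_component[of W a b] stepW \<open>\<rho> \<in> W\<close> by (auto simp: W_def)
  qed
qed

text \<open>With the opposite sign, the counterclockwise triangle on the boundary edge would have
  its third corner on the far side of the edge as seen from the origin. By
  \<open>nothing_beyond\<close> that corner is outside the region between the radii, so a side of
  the triangle would cross one of them.\<close>

lemma bdry_cross_pos:
  assumes ab: "(a, b) \<in> bdry"
  shows "0 < cross (cen a) (cen b)"
proof (rule ccontr)
  note d = bdryD[OF ab] and cn = bdry_cross_nonzero[OF ab]
  assume "\<not> ?thesis"
  then have neg: "cross (cen a) (cen b) < 0" using cn by simp
  obtain z where f: "(a, b, z) \<in> T" using ab by (auto simp: bdry_def)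
  note e = facesE[OF f]
  define \<alpha> \<beta> where "\<alpha> = coord1 a b (cen z)" and "\<beta> = coord2 a b (cen z)"
  have cz: "cen z = of_real \<alpha> * cen a + of_real \<beta> * cen b" unfolding \<alpha>_def \<beta>_def by (rule coords(1)[OF cn])
  have "cross (cen b - cen a) (cen z - cen a) = - (\<alpha> + \<beta> - 1) * cross (cen a) (cen b)"
    unfolding cz by (simp add: cross_linear cross_commute[of "cen b" "cen a"] algebra_simps)
  then have gt: "1 < \<alpha> + \<beta>" using face_positive[OF f] neg by (simp add: zero_less_mult_iff)
  have "0 < \<alpha>"
  proof (rule ccontr)
    assume "\<not> 0 < \<alpha>"
    \<comment> \<open>Chosen such that the point at parameter \<open>s\<close> on the segment from
      \<open>cen a\<close> to \<open>cen z\<close> has first coordinate 0.\<close>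
    define s where "s = 1 / (1 - \<alpha>)"
    have s: "0 \<le> s" "s \<le> 1" "(1 - s) + s * \<alpha> = 0" "1 \<le> s * \<beta>"
      using \<open>\<not> 0 < \<alpha>\<close> gt by (auto simp: s_def field_simps)
    let ?p = "(1 - s) *\<^sub>R cen a + s *\<^sub>R cen z"
    have p: "?p = of_real ((1 - s) + s * \<alpha>) * cen a + of_real (s * \<beta>) * cen b"
      unfolding cz by (simp add: scaleR_conv_of_real algebra_simps)
    have "coord1 a b ?p = 0" "coord2 a b ?p = s * \<beta>" unfolding p coords(2,3)[OF cn] by (rule s(3), rule refl)
    moreover have "?p \<in> closed_segment (cen a) (cen z)" using s unfolding in_segment by blast
    ultimately have "b \<in> {a, z}" using edge_avoids_rays(1)[OF ab E_sym[OF e(3)]] s by simp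
    then show False using e by auto
  qed
  moreover have "0 < \<beta>"
  proof (rule ccontr)
    assume "\<not> 0 < \<beta>"
    define s where "s = 1 / (1 - \<beta>)"
    have s: "0 \<le> s" "s \<le> 1" "(1 - s) + s * \<beta> = 0" "1 \<le> s * \<alpha>"
      using \<open>\<not> 0 < \<beta>\<close> gt by (auto simp: s_def field_simps)
    let ?p = "(1 - s) *\<^sub>R cen b + s *\<^sub>R cen z"
    have p: "?p = of_real (s * \<alpha>) * cen a + of_real ((1 - s) + s * \<beta>) * cen b"
      unfolding cz by (simp add: scaleR_conv_of_real algebra_simps)
    have "coord2 a b ?p = 0" "coord1 a b ?p = s * \<alpha>" unfolding p coords(2,3)[OF cn] by (rule s(3), rule refl)
    moreover have "?p \<in> closed_segment (cen b) (cen z)" using s unfolding in_segment by blast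
    ultimately have "a \<in> {b, z}" using edge_avoids_rays(2)[OF ab e(2)] s by simp
    then show False using e by auto
  qed
  ultimately have "cen z \<in> beyond a b" using gt by (simp add: beyond_def \<alpha>_def \<beta>_def)
  then show False using nothing_beyond[OF ab e(9)] e by auto
qed

text \<open>By \<open>nothing_beyond\<close> such a centre would be on the near side of the edge.
  Its outward radius stays in its own disc up to the edge, whose points belong to the discs of
  \<open>a\<close> and \<open>b\<close>.\<close>

lemma no_outer_in_cone:
  assumes ab: "(a, b) \<in> bdry" and u: "u \<in> B" "cen u = of_real \<alpha> * cen a + of_real \<beta> * cen b" "0 < \<alpha>" "0 < \<beta>"
  shows False
proof -
  note d = bdryD[OF ab] and cn = bdry_cross_nonzero[OF ab] and ou = outer_cen[OF u(1)]
  have co: "coord1 a b (cen u) = \<alpha>" "coord2 a b (cen u) = \<beta>" using coords(2,3)[OF cn] u(2) by simp_all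
  have "coord2 a b (cen a) = 0" "coord1 a b (cen b) = 0" by (simp_all add: coord1_def coord2_def)
  then have uab: "u \<noteq> a" "u \<noteq> b" using co u by auto
  then have le: "\<alpha> + \<beta> \<le> 1" using nothing_beyond[OF ab ou(2)] co u by (auto simp: beyond_def)
  define k where "k = 1 / (\<alpha> + \<beta>)"
  have k: "1 \<le> k" "k * \<alpha> + k * \<beta> = 1" "0 \<le> k * \<alpha>" "0 \<le> k * \<beta>"
    using u(3,4) le by (auto simp: k_def add_divide_distrib[symmetric])
  let ?p = "of_real k * cen u"
  have p: "?p = of_real (k * \<alpha>) * cen a + of_real (k * \<beta>) * cen b" unfolding u(2) by (simp add: algebra_simps)
  have "coord1 a b ?p = k * \<alpha>" "coord2 a b ?p = k * \<beta>" unfolding p coords(2,3)[OF cn] by (rule refl)+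
  then have ps: "?p \<in> closed_segment (cen a) (cen b)" using on_bdry_segment[OF cn, of ?p] k by simp
  show False
    using segment_point(2)[OF d(1) ps] no_radial[OF u(1) d(4) _ _ k(1) refl edge_in_disc[OF d(1) ps]]
      no_radial[OF u(1) d(5) _ _ k(1) refl edge_in_disc[OF d(1) ps]] uab by blast
qed

end

section \<open>Circles met by a connected set\<close>

lemma continuous_integer_valued_constant:
  fixes f :: "complex \<Rightarrow> real"
  assumes "connected C" "continuous_on C f" "\<And>x. x \<in> C \<Longrightarrow> f x \<in> \<int>"
  shows "f constant_on C"
proof (rule continuous_discrete_range_constant[OF assms(1,2)])
  fix x assume x: "x \<in> C"
  have "1 \<le> norm (f y - f x)" if "y \<in> C" "f y \<noteq> f x" for y
  proof -
    have "f y - f x \<in> \<int>" using assms(3) x that(1) by (intro Ints_diff) auto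
    then show ?thesis using that(2) Ints_nonzero_abs_ge1[of "f y - f x"] by simp
  qed
  then show "\<exists>e>0. \<forall>y. y \<in> C \<and> f y \<noteq> f x \<longrightarrow> e \<le> norm (f y - f x)" by (intro exI[of _ 1]) auto
qed

section \<open>Extending the triangles beyond the unit circle\<close>

context disc_packing begin

lemma same_direction:
  assumes "a \<in> B" "b \<in> B" "0 < k" "cen b = of_real k * cen a"
  shows "a = b"
proof (rule ccontr)
  assume ne: "a \<noteq> b"
  note oa = outer_cen[OF assms(1)] and ob = outer_cen[OF assms(2)]
  have pos: "0 < rad a" "0 < rad b" using oa ob rad_pos by blast+
  show False
  proof (cases "1 \<le> k")
    case True
    then show ?thesis using no_radial[OF assms(1) ob(2) _ _ True assms(4)] pos cen_less_1[OF ob(2)] ne by auto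
  next
    case False
    then have "cen a = of_real (1 / k) * cen b" "1 \<le> 1 / k" using assms(3,4) by auto
    then show ?thesis using no_radial[OF assms(2) oa(2) _ _ _ \<open>cen a = _\<close>] pos cen_less_1[OF oa(2)] ne by auto
  qed
qed

text \<open>The chord between the unit vectors towards \<open>cen a\<close> and \<open>cen b\<close>
  avoids the origin because \<open>cross (cen a) (cen b)\<close> is positive. Scaling pushes these
  finitely many chords out of the open unit disc.\<close>

lemma far_radius_exists:
  "\<exists>R>1. \<forall>(a, b)\<in>bdry. \<forall>p\<in>closed_segment (of_real R * sgn (cen a)) (of_real R * sgn (cen b)). 1 \<le> cmod p"
proof -
  have ev: "\<forall>\<^sub>F R in at_top. \<forall>p\<in>closed_segment (of_real R * sgn (cen a)) (of_real R * sgn (cen b)). 1 \<le> cmod p"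
    if ab: "(a, b) \<in> bdry" for a b
  proof -
    note d = bdryD[OF ab]
    let ?S = "closed_segment (sgn (cen a)) (sgn (cen b))"
    have "0 \<notin> ?S"
    proof
      assume "0 \<in> ?S"
      then obtain u where u: "0 = (1 - u) *\<^sub>R sgn (cen a) + u *\<^sub>R sgn (cen b)" "0 \<le> u" "u \<le> 1"
        unfolding in_segment by blast
      have sg: "sgn (cen a) = of_real (1 / cmod (cen a)) * cen a" "sgn (cen b) = of_real (1 / cmod (cen b)) * cen b"
        by (simp_all add: sgn_div_norm scaleR_conv_of_real divide_inverse)
      have "cross (cen a) 0 = u / cmod (cen b) * cross (cen a) (cen b)"
        unfolding u(1) sg by (simp only: cross_linear cross_simps) simp
      moreover have "cross 0 (cen b) = (1 - u) / cmod (cen a) * cross (cen a) (cen b)"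
        unfolding u(1) sg by (simp only: cross_linear cross_simps) simp
      ultimately show False
        using bdry_cross_pos[OF ab] outer_cen(1)[OF d(2)] outer_cen(1)[OF d(3)] by auto
    qed
    then obtain \<delta> where \<delta>: "0 < \<delta>" "\<And>p. p \<in> ?S \<Longrightarrow> \<delta> \<le> dist 0 p"
      using separate_point_closed[of ?S 0] by auto
    have "\<forall>p\<in>closed_segment (of_real R * sgn (cen a)) (of_real R * sgn (cen b)). 1 \<le> cmod p" if R: "1 / \<delta> \<le> R" for R
    proof
      fix p assume "p \<in> closed_segment (of_real R * sgn (cen a)) (of_real R * sgn (cen b))"
      then obtain u where u: "p = (1 - u) *\<^sub>R (of_real R * sgn (cen a)) + u *\<^sub>R (of_real R * sgn (cen b))" "0 \<le> u" "u \<le> 1"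
        unfolding in_segment by blast
      let ?p = "(1 - u) *\<^sub>R sgn (cen a) + u *\<^sub>R sgn (cen b)"
      have "p = of_real R * ?p" unfolding u(1) by (simp add: scaleR_conv_of_real algebra_simps)
      moreover have "?p \<in> ?S" using u unfolding in_segment by blast
      then have "\<delta> \<le> cmod ?p" using \<delta>(2) by fastforce
      moreover have "0 < R" using R \<delta>(1) by (meson divide_pos_pos less_le_trans zero_less_one)
      ultimately have "R * \<delta> \<le> cmod p" by (simp add: norm_mult)
      then show "1 \<le> cmod p" using R \<delta>(1) by (simp add: field_simps)
    qed
    then show ?thesis unfolding eventually_at_top_linorder by blast
  qed
  let ?P = "\<lambda>R x. \<forall>p\<in>closed_segment (of_real R * sgn (cen (fst x))) (of_real R * sgn (cen (snd x))). 1 \<le> cmod p"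
  have "\<forall>\<^sub>F R in at_top. \<forall>x\<in>bdry. ?P R x"
    by (rule eventually_ball_finite[OF finite_sub(3)]) (use ev in auto)
  then have "\<forall>\<^sub>F R in at_top. 1 < R \<and> (\<forall>x\<in>bdry. ?P R x)"
    by (rule eventually_conj[OF eventually_gt_at_top])
  then obtain R where "1 < R" "\<forall>x\<in>bdry. ?P R x"
    using eventually_happens'[OF trivial_limit_at_top_linorder] by blast
  then show ?thesis by (intro exI[of _ R]) auto
qed

text \<open>
  The complex is extended beyond the unit circle: each boundary edge \<open>(a, b)\<close> gets a quadrilateral
  with outer corners \<open>far a\<close> and \<open>far b\<close> on the radii through the centres. The number of cells around
  \<open>X\<close> covering a point then only changes across edges that are disjoint from \<open>X\<close>.
\<close>

definition far_radius :: real where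
  "far_radius = (SOME R. R > 1 \<and> (\<forall>(a, b)\<in>bdry.
     \<forall>p\<in>closed_segment (of_real R * sgn (cen a)) (of_real R * sgn (cen b)). 1 \<le> cmod p))"

definition far :: "'v \<Rightarrow> complex" where
  "far u = of_real far_radius * sgn (cen u)"

lemma far_radius: "1 < far_radius"
  "(a, b) \<in> bdry \<Longrightarrow> p \<in> closed_segment (far a) (far b) \<Longrightarrow> 1 \<le> cmod p"
  using someI_ex[OF far_radius_exists] unfolding far_radius_def[symmetric] far_def by blast+

lemma far_eq:
  assumes "u \<in> B"
  obtains \<kappa> where "1 < \<kappa>" "far u = of_real \<kappa> * cen u"
proof
  note o = outer_cen[OF assms]
  have "cmod (cen u) < 1" using cen_less_1[OF o(2)] .
  then show "1 < far_radius / cmod (cen u)" using o far_radius(1) by (simp add: field_simps)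
  show "far u = of_real (far_radius / cmod (cen u)) * cen u"
    by (simp add: far_def sgn_div_norm scaleR_conv_of_real divide_inverse)
qed

definition corners :: "complex set" where
  "corners = insert 0 (cen ` V \<union> far ` V)"

lemma finite_corners: "finite corners"
  by (simp add: corners_def finite_V)

lemma generic_cen: "generic corners q \<Longrightarrow> generic (cen ` V) q"
  by (auto simp: generic_def corners_def)

lemma generic_anti: "generic corners q \<Longrightarrow> x \<in> corners \<Longrightarrow> y \<in> corners \<Longrightarrow> turn q y x = - turn q x y"
  using turn_anti[of q x y] by (simp add: generic_def)

lemma corners_in [simp]: "v \<in> V \<Longrightarrow> cen v \<in> corners" "v \<in> V \<Longrightarrow> far v \<in> corners" "0 \<in> corners"
  by (auto simp: corners_def)

definition quad :: "complex \<Rightarrow> 'v \<Rightarrow> 'v \<Rightarrow> real" where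
  "quad q a b = turn q (cen b) (cen a) + turn q (cen a) (far a) + turn q (far a) (far b) + turn q (far b) (cen b)"

text \<open>The diagonal from \<open>cen b\<close> to \<open>far a\<close> splits the quadrilateral
  into two counterclockwise triangles.\<close>

lemma quad_values:
  assumes ab: "(a, b) \<in> bdry" and q: "generic corners q"
  shows "quad q a b \<in> {0, 1, 2}"
proof -
  note d = bdryD[OF ab]
  obtain \<kappa> where k: "1 < \<kappa>" "far a = of_real \<kappa> * cen a" using far_eq[OF d(2)] .
  obtain \<nu> where l: "1 < \<nu>" "far b = of_real \<nu> * cen b" using far_eq[OF d(3)] .
  have "cross (cen a - cen b) (far a - cen b) = (\<kappa> - 1) * cross (cen a) (cen b)"
    unfolding k(2) by (simp add: cross_def algebra_simps)
  then have 1: "0 < cross (cen a - cen b) (far a - cen b)" using k(1) bdry_cross_pos[OF ab] by simp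
  have "cross (far a - cen b) (far b - cen b) = \<kappa> * (\<nu> - 1) * cross (cen a) (cen b)"
    unfolding k(2) l(2) by (simp add: cross_def algebra_simps)
  then have 2: "0 < cross (far a - cen b) (far b - cen b)" using k(1) l(1) bdry_cross_pos[OF ab] by simp
  have g: "q \<notin> closed_segment x y" if "x \<in> {cen a, cen b, far a, far b}" "y \<in> {cen a, cen b, far a, far b}" for x y
  proof -
    have "x \<in> corners" "y \<in> corners" using that d(4,5) by auto
    then show ?thesis using q by (simp add: generic_def)
  qed
  have "quad q a b = (turn q (cen b) (cen a) + turn q (cen a) (far a) + turn q (far a) (cen b)) +
     (turn q (cen b) (far a) + turn q (far a) (far b) + turn q (far b) (cen b))"
    using generic_anti[OF q, of "cen b" "far a"] d(4,5) by (simp add: quad_def)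
  also have "\<dots> \<in> {0, 1, 2}"
    using turn_triangle[OF 1, of q] turn_triangle[OF 2, of q] g by simp
  finally show ?thesis .
qed

definition bdry_at :: "'v set \<Rightarrow> ('v \<times> 'v) set" where
  "bdry_at X = {(a, b) \<in> bdry. a \<in> X \<or> b \<in> X}"

lemma bdry_at_sub: "bdry_at X \<subseteq> bdry" "finite (bdry_at X)"
proof -
  show "bdry_at X \<subseteq> bdry" by (auto simp: bdry_at_def)
  then show "finite (bdry_at X)" using finite_sub(3) rev_finite_subset by blast
qed

text \<open>At generic points, the number of cells around \<open>X\<close> that contain the point,
  written as a sum of angles. \<open>rim\<close> is the same sum after cancelling the segments that
  start or end at a centre in \<open>X\<close>.\<close>

definition cover :: "'v set \<Rightarrow> complex \<Rightarrow> real" where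
  "cover X q = (\<Sum>(a, b, c)\<in>touching X. turn q (cen a) (cen b)) + (\<Sum>(a, b)\<in>bdry_at X. quad q a b)"

definition rim :: "'v set \<Rightarrow> complex \<Rightarrow> real" where
  "rim X q = (\<Sum>(a, b, c)\<in>link X. turn q (cen a) (cen b)) + (\<Sum>(a, b)\<in>bdry_at X. turn q (far a) (far b) +
     (if a \<in> X then 0 else turn q (cen a) (far a)) - (if b \<in> X then 0 else turn q (cen b) (far b)))"

lemma sum_quads_nonneg:
  assumes "generic corners q" "Y \<subseteq> bdry"
  shows "0 \<le> (\<Sum>(a, b)\<in>Y. quad q a b)"
  using quad_values[OF _ assms(1)] assms(2) by (intro sum_nonneg) fastforce

lemma cover_ge_1:
  assumes q: "generic corners q" and f: "(a, b, c) \<in> touching X" "q \<in> interior (convex hull {cen a, cen b, cen c})"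
  shows "1 \<le> cover X q"
  using sum_turn_touching_ge_1[OF generic_cen[OF q] f] sum_quads_nonneg[OF q bdry_at_sub(1), of X]
  by (simp add: cover_def)

lemma cover_integer:
  assumes q: "generic corners q"
  shows "3 * cover X q \<in> \<int>"
proof -
  have "quad q a b \<in> \<int>" if "(a, b) \<in> bdry_at X" for a b
  proof -
    have "(a, b) \<in> bdry" using that by (simp add: bdry_at_def)
    then show ?thesis using quad_values[OF _ q, of a b] by auto
  qed
  then have "(\<Sum>(a, b)\<in>bdry_at X. quad q a b) \<in> \<int>" by (intro Ints_sum) auto
  then show ?thesis
    unfolding cover_def distrib_left sum_turn_touching[OF generic_cen[OF q]] by (intro Ints_add Ints_mult) auto
qed

lemma cover_eq_rim:
  assumes q: "generic corners q"
  shows "cover X q = rim X q"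
proof -
  let ?\<psi> = "\<lambda>a. turn q (cen a) (far a)" and ?D = "bdry_at X"
  \<comment> \<open>The spokes at outer vertices of \<open>X\<close> occur in neighbouring
    quadrilaterals with opposite signs and cancel as a coboundary.\<close>
  define g where "g a = (if a \<in> X then ?\<psi> a else 0)" for a
  have "turn q (cen b) (cen a) = - turn q (cen a) (cen b)" if "(a, b) \<in> edges" for a b
  proof -
    have "a \<in> V" "b \<in> V" using facesE(7,8) that by (auto simp: edges_def)
    then show ?thesis using generic_anti[OF q, of "cen a" "cen b"] by simp
  qed
  then have 1: "(\<Sum>(a, b, c)\<in>touching X. turn q (cen a) (cen b)) =
      (\<Sum>(a, b, c)\<in>link X. turn q (cen a) (cen b)) + (\<Sum>(a, b)\<in>?D. turn q (cen a) (cen b))"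
    unfolding bdry_at_def by (intro sum_touching)
  have "(\<Sum>(a, b)\<in>?D. g b - g a) = (\<Sum>(a, b)\<in>bdry. g b - g a)"
    by (rule sum.mono_neutral_left[OF finite_sub(3) bdry_at_sub(1)]) (auto simp: bdry_at_def g_def split: if_splits)
  then have 0: "(\<Sum>(a, b)\<in>?D. g b - g a) = 0" using sum_bdry_coboundary[of g] by simp
  have "(\<Sum>(a, b)\<in>?D. turn q (cen a) (cen b)) + (\<Sum>(a, b)\<in>?D. quad q a b) =
     (\<Sum>(a, b)\<in>?D. turn q (cen a) (cen b) + quad q a b)"
    by (simp add: sum.distrib case_prod_unfold)
  also have "\<dots> = (\<Sum>(a, b)\<in>?D. (turn q (far a) (far b) +
     (if a \<in> X then 0 else ?\<psi> a) - (if b \<in> X then 0 else ?\<psi> b)) - (g b - g a))"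
  proof (rule sum.cong[OF refl], clarify)
    fix a b assume "(a, b) \<in> ?D"
    then have V: "a \<in> V" "b \<in> V" using bdryD(4,5) bdry_at_sub(1) by blast+
    show "turn q (cen a) (cen b) + quad q a b = turn q (far a) (far b) +
     (if a \<in> X then 0 else ?\<psi> a) - (if b \<in> X then 0 else ?\<psi> b) - (g b - g a)"
      using generic_anti[OF q, of "cen a" "cen b"] generic_anti[OF q, of "cen b" "far b"] V
      by (simp add: quad_def g_def)
  qed
  also have "\<dots> = (\<Sum>(a, b)\<in>?D. turn q (far a) (far b) +
     (if a \<in> X then 0 else ?\<psi> a) - (if b \<in> X then 0 else ?\<psi> b))"
    using 0 by (simp add: sum_subtractf case_prod_unfold)
  finally show ?thesis unfolding cover_def rim_def 1 by simp
qed

definition rim_set :: "'v set \<Rightarrow> complex set" where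
  "rim_set X = (\<Union>(a, b, c)\<in>link X. closed_segment (cen a) (cen b)) \<union>
     (\<Union>(a, b)\<in>bdry_at X. closed_segment (far a) (far b)) \<union>
     (\<Union>(a, b)\<in>{(a, b) \<in> bdry_at X. a \<notin> X}. closed_segment (cen a) (far a)) \<union>
     (\<Union>(a, b)\<in>{(a, b) \<in> bdry_at X. b \<notin> X}. closed_segment (cen b) (far b))"

lemma closed_rim_set: "closed (rim_set X)"
proof -
  have "finite {(a, b) \<in> bdry_at X. a \<notin> X}" "finite {(a, b) \<in> bdry_at X. b \<notin> X}"
    by (auto intro: finite_subset[OF _ bdry_at_sub(2)])
  then show ?thesis unfolding rim_set_def
    by (intro closed_Un closed_UN) (auto simp: bdry_at_sub(2))
qed

lemma isCont_rim:
  assumes "q \<notin> rim_set X"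
  shows "isCont (rim X) q"
proof -
  have 1: "isCont (\<lambda>q. turn q (cen a) (cen b)) q" if "(a, b, c) \<in> link X" for a b c
    using assms that by (intro isCont_turn) (auto simp: rim_set_def)
  have 2: "isCont (\<lambda>q. turn q (far a) (far b)) q" if "(a, b) \<in> bdry_at X" for a b
    using assms that by (intro isCont_turn) (auto simp: rim_set_def)
  have 3: "isCont (\<lambda>q. if a \<in> X then 0 else turn q (cen a) (far a)) q" if "(a, b) \<in> bdry_at X" for a b
  proof (cases "a \<in> X")
    case False
    then have "(a, b) \<in> {(a, b) \<in> bdry_at X. a \<notin> X}" using that by simp
    then have "q \<notin> closed_segment (cen a) (far a)" using assms unfolding rim_set_def by blast
    then show ?thesis using False by (simp add: isCont_turn)
  qed simp
  have 4: "isCont (\<lambda>q. if b \<in> X then 0 else turn q (cen b) (far b)) q" if "(a, b) \<in> bdry_at X" for a b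
  proof (cases "b \<in> X")
    case False
    then have "(a, b) \<in> {(a, b) \<in> bdry_at X. b \<notin> X}" using that by simp
    then have "q \<notin> closed_segment (cen b) (far b)" using assms unfolding rim_set_def by blast
    then show ?thesis using False by (simp add: isCont_turn)
  qed simp
  show ?thesis unfolding rim_def
  proof (intro isCont_add isCont_sum ballI)
    fix x assume "x \<in> link X"
    then show "isCont (\<lambda>q. case x of (a, b, c) \<Rightarrow> turn q (cen a) (cen b)) q"
      by (cases x) (auto intro: 1)
  next
    fix x assume x: "x \<in> bdry_at X"
    obtain a b where ab: "x = (a, b)" by (cases x)
    show "isCont (\<lambda>q. case x of (a, b) \<Rightarrow> turn q (far a) (far b) +
        (if a \<in> X then 0 else turn q (cen a) (far a)) - (if b \<in> X then 0 else turn q (cen b) (far b))) q"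
      unfolding ab prod.case using x unfolding ab by (intro isCont_add isCont_diff 2 3 4)
  qed
qed

text \<open>At generic points this is \<open>cover_integer\<close>. A non-integral value would
  persist nearby by continuity, against the density of generic points.\<close>

lemma rim_integer:
  assumes q: "q \<notin> rim_set X"
  shows "3 * rim X q \<in> \<int>"
proof (rule ccontr)
  assume n: "3 * rim X q \<notin> \<int>"
  have "isCont (\<lambda>q. 3 * rim X q) q" using isCont_rim[OF q] by (intro continuous_intros)
  moreover have "open (- (\<int> :: real set))" by (simp add: open_Compl closed_Ints)
  ultimately obtain N where N: "open N" "q \<in> N" "\<And>x. x \<in> N \<Longrightarrow> 3 * rim X x \<in> - \<int>"
    using n unfolding continuous_at_open by (metis ComplI)
  obtain x where "x \<in> N" "generic corners x"
    using generic_dense[OF finite_corners N(1)] N(2) by blast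
  then show False using N(3)[of x] cover_integer[of x X] cover_eq_rim[of x X] by simp
qed

lemma rim_constant:
  assumes "connected C" "C \<inter> rim_set X = {}" "x \<in> C" "y \<in> C"
  shows "rim X x = rim X y"
proof -
  have "continuous_on C (\<lambda>q. 3 * rim X q)"
    using isCont_rim assms(2) by (intro continuous_at_imp_continuous_on ballI continuous_intros) auto
  then have "(\<lambda>q. 3 * rim X q) constant_on C"
    using assms(1,2) rim_integer by (intro continuous_integer_valued_constant) auto
  then have "3 * rim X x = 3 * rim X y" using assms(3,4) unfolding constant_on_def by metis
  then show ?thesis by simp
qed

section \<open>Circles hit by a curve\<close>

lemma face_at_vertex:
  assumes "v \<in> V"
  obtains b c where "(v, b, c) \<in> T"
proof -
  have "V \<noteq> {v}" using root B_nonempty B_sub by blast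
  then obtain a b where ab: "a \<in> {v}" "(a, b) \<in> E" "b \<notin> {v}" using E_conn[of "{v}"] assms by blast
  then show ?thesis using edge_face[OF ab(2)] rot that by blast
qed

definition hit :: "complex set \<Rightarrow> 'v set" where
  "hit \<Gamma> = {u \<in> V. cball (cen u) (rad u) \<inter> \<Gamma> \<noteq> {}}"

text \<open>\<open>K\<close> is a union of connected components of the graph induced on
  \<open>S\<close>.\<close>

definition saturated :: "'v set \<Rightarrow> 'v set \<Rightarrow> bool" where
  "saturated S K \<longleftrightarrow> K \<subseteq> S \<and> (\<forall>a\<in>K. \<forall>b\<in>S. (a, b) \<in> E \<longrightarrow> b \<in> K)"

text \<open>Within the unit disc the rim is covered by discs that \<open>\<Gamma>\<close> misses. An
  edge opposite \<open>K\<close> joins neighbours of \<open>K\<close> outside \<open>K\<close>,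
  which are not hit; a spoke in the rim runs in the disc of such a neighbour; the far edges lie
  outside the open unit disc.\<close>

lemma rim_set_avoids:
  assumes \<Gamma>: "\<Gamma> \<subseteq> ball 0 1" and K: "saturated (hit \<Gamma>) K"
  shows "\<Gamma> \<inter> rim_set K = {}" "v \<in> K \<Longrightarrow> ball (cen v) (rad v) \<inter> rim_set K = {}"
proof -
  have off: "b \<notin> hit \<Gamma>" if "a \<in> K" "(a, b) \<in> E" "b \<notin> K" for a b
    using K that unfolding saturated_def by blast
  have main: "p \<in> ball 0 1 \<longrightarrow> (\<exists>u\<in>V. u \<notin> hit \<Gamma> \<and> dist (cen u) p \<le> rad u)" if "p \<in> rim_set K" for p
  proof -
    have spoke: "p \<in> ball 0 1 \<longrightarrow> (\<exists>u\<in>V. u \<notin> hit \<Gamma> \<and> dist (cen u) p \<le> rad u)"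
      if u: "u \<in> B" "u \<notin> hit \<Gamma>" "p \<in> closed_segment (cen u) (far u)" for u
    proof
      assume p: "p \<in> ball 0 1"
      obtain \<kappa> where k: "1 < \<kappa>" "far u = of_real \<kappa> * cen u" using far_eq[OF u(1)] .
      obtain s where s: "0 \<le> s" "s \<le> 1" "p = (1 - s) *\<^sub>R cen u + s *\<^sub>R far u" using u(3) unfolding in_segment by blast
      have pe: "p = of_real (1 + s * (\<kappa> - 1)) * cen u"
        unfolding s(3) k(2) by (simp add: scaleR_conv_of_real algebra_simps)
      have "1 \<le> 1 + s * (\<kappa> - 1)" using s k by simp
      then have "dist (cen u) p < rad u" using radial_in_ball[OF u(1), of "1 + s * (\<kappa> - 1)"] p pe by simp
      then show "\<exists>u\<in>V. u \<notin> hit \<Gamma> \<and> dist (cen u) p \<le> rad u" using u outer_cen(2)[OF u(1)] by force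
    qed
    from that consider a b c where "(a, b, c) \<in> link K" "p \<in> closed_segment (cen a) (cen b)"
      | a b where "(a, b) \<in> bdry_at K" "p \<in> closed_segment (far a) (far b)"
      | a b where "(a, b) \<in> bdry_at K" "a \<notin> K" "p \<in> closed_segment (cen a) (far a)"
      | a b where "(a, b) \<in> bdry_at K" "b \<notin> K" "p \<in> closed_segment (cen b) (far b)"
      unfolding rim_set_def by blast
    then show ?thesis
    proof cases
      case (1 a b c)
      note l = link_in_X_nbr[OF 1(1)]
      then have "a \<notin> hit \<Gamma>" "b \<notin> hit \<Gamma>" "a \<in> V" "b \<in> V" using off in_V by blast+
      then show ?thesis using segment_point(2)[of a b p] l 1(2) by blast
    next
      case (2 a b)
      then show ?thesis using far_radius(2)[of a b p] bdry_at_sub(1) by fastforce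
    next
      case (3 a b)
      then have d: "(a, b) \<in> bdry" "b \<in> K" by (auto simp: bdry_at_def)
      show ?thesis using spoke[OF bdryD(2)[OF d(1)] _ 3(3)] off[OF d(2) E_sym[OF bdryD(1)[OF d(1)]] 3(2)] by blast
    next
      case (4 a b)
      then have d: "(a, b) \<in> bdry" "a \<in> K" by (auto simp: bdry_at_def)
      show ?thesis using spoke[OF bdryD(3)[OF d(1)] _ 4(3)] off[OF d(2) bdryD(1)[OF d(1)] 4(2)] by blast
    qed
  qed
  show "\<Gamma> \<inter> rim_set K = {}"
    using main \<Gamma> by (fastforce simp: hit_def)
  show "ball (cen v) (rad v) \<inter> rim_set K = {}" if v: "v \<in> K"
  proof -
    have vV: "v \<in> V" "v \<in> hit \<Gamma>" using v K by (auto simp: hit_def saturated_def)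
    have "p \<notin> rim_set K" if p: "dist (cen v) p < rad v" for p
    proof
      assume pr: "p \<in> rim_set K"
      have "cmod p < 1"
        using p in_disc[OF vV(1)] dist_triangle[of 0 p "cen v"] by simp
      then obtain u where "u \<in> V" "u \<notin> hit \<Gamma>" "dist (cen u) p \<le> rad u" using main[OF pr] by auto
      then show False using ball_cball_disjoint[OF vV(1) _ _ p] vV(2) by blast
    qed
    then show ?thesis by auto
  qed
qed

text \<open>The curve, the disc of some \<open>v\<close> in \<open>K\<close> and a small ball around
  \<open>p\<close> form a connected set off the rim. Near the centre of \<open>v\<close> a triangle
  at \<open>v\<close> makes the cover at least 1, and this value is carried along the set.\<close>

lemma cover_along_curve:
  assumes \<Gamma>: "connected \<Gamma>" "\<Gamma> \<subseteq> ball 0 1" and K: "saturated (hit \<Gamma>) K" "K \<noteq> {}"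
    and p: "p \<in> \<Gamma>"
  obtains N where "open N" "p \<in> N" "\<And>q. q \<in> N \<Longrightarrow> generic corners q \<Longrightarrow> 1 \<le> cover K q"
proof -
  obtain v where v: "v \<in> K" using K(2) by blast
  then have vh: "v \<in> hit \<Gamma>" using K(1) by (auto simp: saturated_def)
  then have vV: "v \<in> V" by (simp add: hit_def)
  obtain s where s: "s \<in> \<Gamma>" "dist (cen v) s \<le> rad v" using vh by (auto simp: hit_def)
  note av = rim_set_avoids[OF \<Gamma>(2) K(1)]
  have r: "rad v > 0" using rad_pos[OF vV] .
  obtain e where e: "e > 0" "ball p e \<subseteq> - rim_set K"
  proof -
    have "open (- rim_set K)" "p \<in> - rim_set K" using closed_rim_set[of K] av(1) p by auto
    then show ?thesis using that open_contains_ball by blast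
  qed
  have "connected (insert s (ball (cen v) (rad v)))"
    by (rule connected_intermediate_closure[of "ball (cen v) (rad v)"]) (use s r in \<open>auto simp: closure_ball\<close>)
  then have "connected (\<Gamma> \<union> insert s (ball (cen v) (rad v)))"
    using \<Gamma>(1) s by (intro connected_Un) auto
  then have C: "connected ((\<Gamma> \<union> insert s (ball (cen v) (rad v))) \<union> ball p e)"
    by (rule connected_Un[OF _ connected_ball]) (use p e(1) in auto)
  let ?C = "(\<Gamma> \<union> insert s (ball (cen v) (rad v))) \<union> ball p e"
  have dis: "?C \<inter> rim_set K = {}" using av(1) av(2)[OF v] s(1) e(2) by blast
  obtain b c where f: "(v, b, c) \<in> T" using face_at_vertex[OF vV] .
  obtain q0 where "q0 \<in> interior (convex hull {cen v, cen b, cen c})" "dist (cen v) q0 < rad v"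
    using interior_triangle_nonempty[OF face_positive[OF f] r] .
  then have "interior (convex hull {cen v, cen b, cen c}) \<inter> ball (cen v) (rad v) \<noteq> {}" by auto
  then obtain q1 where q1: "q1 \<in> interior (convex hull {cen v, cen b, cen c})" "q1 \<in> ball (cen v) (rad v)" "generic corners q1"
    using generic_dense[OF finite_corners, of "interior (convex hull {cen v, cen b, cen c}) \<inter> ball (cen v) (rad v)"]
    by (metis IntE open_Int open_ball open_interior)
  have "1 \<le> rim K q1"
    using cover_ge_1[OF q1(3) _ q1(1), of K] f v cover_eq_rim[OF q1(3)] by (simp add: touching_def)
  then have "1 \<le> cover K q" if "q \<in> ball p e" "generic corners q" for q
    using rim_constant[OF C dis, of q q1] q1(2) that cover_eq_rim[OF that(2)] by simp
  then show ?thesis using that[of "ball p e"] e(1) by auto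
qed

text \<open>If two cones share \<open>q\<close>, either their sides agree in direction or a centre
  of one edge lies in the open cone of the other, which \<open>no_outer_in_cone\<close> forbids.
  Outer circles with centres in the same direction are equal.\<close>

lemma cones_disjoint:
  assumes ab: "(a, b) \<in> bdry" and ab': "(a', b') \<in> bdry"
    and q: "0 < cross (cen a) q" "0 < cross q (cen b)" "0 < cross (cen a') q" "0 < cross q (cen b')"
  shows "a = a' \<and> b = b'"
proof -
  have le1: "cross (cen a) (cen a') \<le> 0"
    if ab: "(a, b) \<in> bdry" and a': "a' \<in> B" and q: "0 < cross (cen a) q" "0 < cross q (cen b)" "0 < cross (cen a') q" for a b a'
  proof (rule ccontr)
    assume "\<not> ?thesis"
    then have pos: "0 < cross (cen a) (cen a')" by simp
    note p = bdry_cross_pos[OF ab]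
    define \<nu> \<mu> \<alpha> \<beta> where "\<nu> = cross (cen a') q / cross (cen a) q" and "\<mu> = cross (cen a) (cen a') / cross (cen a) q"
      and "\<alpha> = cross q (cen b) / cross (cen a) (cen b)" and "\<beta> = cross (cen a) q / cross (cen a) (cen b)"
    have gt: "0 < \<nu>" "0 < \<mu>" "0 < \<alpha>" "0 < \<beta>" using pos p q by (simp_all add: \<nu>_def \<mu>_def \<alpha>_def \<beta>_def)
    have "cen a' = of_real \<nu> * cen a + of_real \<mu> * q"
      unfolding \<nu>_def \<mu>_def by (rule cross_decompose) (use q in simp)
    also have "q = of_real \<alpha> * cen a + of_real \<beta> * cen b"
      unfolding \<alpha>_def \<beta>_def by (rule cross_decompose) (use p in simp)
    finally have "cen a' = of_real (\<nu> + \<mu> * \<alpha>) * cen a + of_real (\<mu> * \<beta>) * cen b" by (simp add: algebra_simps)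
    then show False by (rule no_outer_in_cone[OF ab a']) (use gt in \<open>simp_all add: add_pos_pos\<close>)
  qed
  have le2: "cross (cen b') (cen b) \<le> 0"
    if ab: "(a, b) \<in> bdry" and b': "b' \<in> B" and q: "0 < cross (cen a) q" "0 < cross q (cen b)" "0 < cross q (cen b')" for a b b'
  proof (rule ccontr)
    assume "\<not> ?thesis"
    then have pos: "0 < cross (cen b') (cen b)" by simp
    note p = bdry_cross_pos[OF ab]
    define \<nu> \<mu> \<alpha> \<beta> where "\<nu> = cross (cen b') (cen b) / cross q (cen b)" and "\<mu> = cross q (cen b') / cross q (cen b)"
      and "\<alpha> = cross q (cen b) / cross (cen a) (cen b)" and "\<beta> = cross (cen a) q / cross (cen a) (cen b)"
    have gt: "0 < \<nu>" "0 < \<mu>" "0 < \<alpha>" "0 < \<beta>" using pos p q by (simp_all add: \<nu>_def \<mu>_def \<alpha>_def \<beta>_def)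
    have "cen b' = of_real \<nu> * q + of_real \<mu> * cen b"
      unfolding \<nu>_def \<mu>_def by (rule cross_decompose) (use q in simp)
    also have "q = of_real \<alpha> * cen a + of_real \<beta> * cen b"
      unfolding \<alpha>_def \<beta>_def by (rule cross_decompose) (use p in simp)
    finally have "cen b' = of_real (\<nu> * \<alpha>) * cen a + of_real (\<nu> * \<beta> + \<mu>) * cen b" by (simp add: algebra_simps)
    then show False by (rule no_outer_in_cone[OF ab b']) (use gt in \<open>simp_all add: add_pos_pos\<close>)
  qed
  note d = bdryD[OF ab] and d' = bdryD[OF ab']
  have "cross (cen a) (cen a') = 0"
    using le1[OF ab d'(2) q(1,2,3)] le1[OF ab' d(2) q(3,4,1)] cross_commute[of "cen a"] by simp
  moreover have "cen a \<noteq> 0" using outer_cen(1)[OF d(2)] by auto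
  ultimately obtain k where k: "cen a' = of_real k * cen a" using cross_zero_parallel by blast
  then have "0 < k" using q(1,3) by (simp add: cross_linear zero_less_mult_iff)
  then have "a = a'" using same_direction[OF d(2) d'(2) _ k] by blast
  have "cross (cen b) (cen b') = 0"
    using le2[OF ab d'(3) q(1,2,4)] le2[OF ab' d(3) q(3,4,2)] cross_commute[of "cen b"] by simp
  moreover have "cen b \<noteq> 0" using outer_cen(1)[OF d(3)] by auto
  ultimately obtain k' where k': "cen b' = of_real k' * cen b" using cross_zero_parallel by blast
  then have "0 < k'" using q(2,4) by (simp add: cross_linear zero_less_mult_iff)
  then have "b = b'" using same_direction[OF d(3) d'(3) _ k'] by blast
  then show ?thesis using \<open>a = a'\<close> by blast
qed

text \<open>For \<open>X = V\<close> only the far edges remain. Adding the segments from the origin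
  to the far corners, a coboundary, completes them to triangles at the origin, which lie in disjoint
  cones.\<close>

lemma cover_all_le_1:
  assumes q: "generic corners q"
  shows "cover V q \<le> 1"
proof -
  have lV: "link V = {}" using facesE(7) by (auto simp: link_def)
  have bV: "bdry_at V = bdry" using bdryD(4) by (auto simp: bdry_at_def)
  let ?P = "\<lambda>a b. q \<in> interior (convex hull {0, far a, far b})"
  have "cover V q = (\<Sum>(a, b)\<in>bdry. turn q (far a) (far b))"
    unfolding cover_eq_rim[OF q] rim_def lV bV
    by (simp, rule sum.cong[OF refl]) (use bdryD(4,5) in auto)
  also have "\<dots> = (\<Sum>(a, b)\<in>bdry. turn q (far a) (far b)) - (\<Sum>(a, b)\<in>bdry. turn q 0 (far b) - turn q 0 (far a))"
    using sum_bdry_coboundary[of "\<lambda>a. turn q 0 (far a)"] by simp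
  also have "\<dots> = (\<Sum>(a, b)\<in>bdry. turn q (far a) (far b) - (turn q 0 (far b) - turn q 0 (far a)))"
    by (simp add: sum_subtractf case_prod_unfold)
  also have "\<dots> = (\<Sum>(a, b)\<in>bdry. if ?P a b then 1 else 0)"
  proof (rule sum.cong[OF refl], clarify)
    fix a b assume ab: "(a, b) \<in> bdry"
    note d = bdryD[OF ab]
    obtain \<kappa> where k: "1 < \<kappa>" "far a = of_real \<kappa> * cen a" using far_eq[OF d(2)] .
    obtain \<nu> where l: "1 < \<nu>" "far b = of_real \<nu> * cen b" using far_eq[OF d(3)] .
    have pos: "0 < cross (far a - 0) (far b - 0)" unfolding k(2) l(2) using k(1) l(1) bdry_cross_pos[OF ab] by (simp add: cross_linear)
    have "turn q 0 (far a) + turn q (far a) (far b) + turn q (far b) 0 = (if ?P a b then 1 else 0)"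
      using q d(4,5) by (intro turn_triangle[OF pos]) (auto simp: generic_def)
    then show "turn q (far a) (far b) - (turn q 0 (far b) - turn q 0 (far a)) = (if ?P a b then 1 else 0)"
      using generic_anti[OF q, of 0 "far b"] d(5) by simp
  qed
  also have "\<dots> \<le> 1"
  proof (cases "\<exists>a b. (a, b) \<in> bdry \<and> ?P a b")
    case True
    then obtain a b where ab: "(a, b) \<in> bdry" "?P a b" by blast
    have cone: "0 < cross (cen a) q \<and> 0 < cross q (cen b)" if ab: "(a, b) \<in> bdry" "?P a b" for a b
    proof -
      note d = bdryD[OF ab(1)] and p = bdry_cross_pos[OF ab(1)]
      obtain \<kappa> where k: "1 < \<kappa>" "far a = of_real \<kappa> * cen a" using far_eq[OF d(2)] .
      obtain \<nu> where l: "1 < \<nu>" "far b = of_real \<nu> * cen b" using far_eq[OF d(3)] .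
      have "cross (far a - 0) (far b - 0) \<noteq> 0" unfolding k(2) l(2) using k(1) l(1) p by (simp add: cross_linear)
      then obtain \<beta> \<gamma> where bc: "0 < \<beta>" "0 < \<gamma>" "q - 0 = of_real \<beta> * (far a - 0) + of_real \<gamma> * (far b - 0)"
        using ab(2) interior_triangle_iff by blast
      then have "q = of_real (\<beta> * \<kappa>) * cen a + of_real (\<gamma> * \<nu>) * cen b" unfolding k(2) l(2) by simp
      then have "cross (cen a) q = \<gamma> * \<nu> * cross (cen a) (cen b)" "cross q (cen b) = \<beta> * \<kappa> * cross (cen a) (cen b)"
        by (simp_all only: cross_linear cross_simps)
      then show ?thesis using bc k l p by simp
    qed
    have "{x \<in> bdry. case x of (a, b) \<Rightarrow> ?P a b} \<subseteq> {(a, b)}"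
      using cones_disjoint[OF _ ab(1)] cone[OF ab] cone by blast
    then have "card {x \<in> bdry. case x of (a, b) \<Rightarrow> ?P a b} \<le> 1"
      using card_mono[of "{(a, b)}"] by fastforce
    moreover have "(\<Sum>(a, b)\<in>bdry. if ?P a b then 1 else 0 :: real) = real (card {x \<in> bdry. case x of (a, b) \<Rightarrow> ?P a b})"
      unfolding case_prod_unfold by (subst sum.inter_filter[symmetric]) auto
    ultimately show ?thesis by simp
  next
    case False
    then have "(\<Sum>(a, b)\<in>bdry. if ?P a b then 1 else 0 :: real) = 0" by (intro sum.neutral) auto
    then show ?thesis by simp
  qed
  finally show ?thesis .
qed

text \<open>
  Two components of the set of circles hit by a curve would both cover the points of the curve,
  contradicting \<open>cover_all_le_1\<close>.
\<close>

lemma hit_connected: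
  assumes \<Gamma>: "connected \<Gamma>" "\<Gamma> \<subseteq> ball 0 1" and K: "saturated (hit \<Gamma>) K" "K \<noteq> {}"
  shows "K = hit \<Gamma>"
proof (rule ccontr)
  assume "K \<noteq> hit \<Gamma>"
  define L where "L = hit \<Gamma> - K"
  have KS: "K \<subseteq> hit \<Gamma>" and Kc: "\<And>a b. a \<in> K \<Longrightarrow> b \<in> hit \<Gamma> \<Longrightarrow> (a, b) \<in> E \<Longrightarrow> b \<in> K"
    using K(1) unfolding saturated_def by blast+
  have L: "saturated (hit \<Gamma>) L" "L \<noteq> {}"
    using KS Kc E_sym \<open>K \<noteq> hit \<Gamma>\<close> unfolding L_def saturated_def by blast+
  have no: "\<not> (u \<in> K \<and> w \<in> L)" if "(u, w) \<in> E \<or> (w, u) \<in> E \<or> u = w" for u w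
    using Kc[of u w] E_sym[of w u] that unfolding L_def by blast
  obtain p where p: "p \<in> \<Gamma>" using KS K(2) by (force simp: hit_def)
  obtain N where N: "open N" "p \<in> N" "\<And>q. q \<in> N \<Longrightarrow> generic corners q \<Longrightarrow> 1 \<le> cover K q"
    using cover_along_curve[OF \<Gamma> K p] by blast
  obtain M where M: "open M" "p \<in> M" "\<And>q. q \<in> M \<Longrightarrow> generic corners q \<Longrightarrow> 1 \<le> cover L q"
    using cover_along_curve[OF \<Gamma> L p] by blast
  obtain q where q: "q \<in> N" "q \<in> M" "generic corners q"
  proof -
    have "open (N \<inter> M)" "N \<inter> M \<noteq> {}" using N(1,2) M(1,2) by auto
    then show ?thesis using that generic_dense[OF finite_corners] by blast
  qed
  let ?c = "\<lambda>X. {(a, b, c) \<in> touching X. q \<in> interior (convex hull {cen a, cen b, cen c})}"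
  have fin: "finite (?c X)" for X by (rule finite_subset[OF _ finite_sub(1)[of X]]) auto
  \<comment> \<open>A triangle touching both parts would contain an edge between them, so the covers
    of \<open>K\<close> and \<open>L\<close> count disjoint families of cells.\<close>
  have tKL: "touching K \<inter> touching L = {}"
  proof -
    have "(a, b, c) \<notin> touching L" if t: "(a, b, c) \<in> touching K" for a b c
    proof -
      have f: "(a, b, c) \<in> T" using t touching_sub by blast
      have "\<not> (u \<in> K \<and> w \<in> L)" if "u \<in> {a, b, c}" "w \<in> {a, b, c}" for u w
        using no[of u w] facesE(1-3)[OF f] that by blast
      then show ?thesis using t unfolding touching_def by blast
    qed
    then show ?thesis by auto
  qed
  have tV: "touching K \<union> touching L \<subseteq> touching V" using facesE(7) by (auto simp: touching_def)
  have "card (?c K) + card (?c L) = card (?c K \<union> ?c L)"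
  proof (rule card_Un_disjoint[symmetric, OF fin fin])
    have "?c K \<inter> ?c L \<subseteq> touching K \<inter> touching L" by auto
    then show "?c K \<inter> ?c L = {}" using tKL by simp
  qed
  also have "\<dots> \<le> card (?c V)" using tV by (intro card_mono fin) auto
  finally have "real (card (?c K)) + real (card (?c L)) \<le> real (card (?c V))" by linarith
  then have 1: "(\<Sum>(a, b, c)\<in>touching K. turn q (cen a) (cen b)) + (\<Sum>(a, b, c)\<in>touching L. turn q (cen a) (cen b)) \<le>
      (\<Sum>(a, b, c)\<in>touching V. turn q (cen a) (cen b))"
    using sum_turn_touching[OF generic_cen[OF q(3)], of K] sum_turn_touching[OF generic_cen[OF q(3)], of L]
      sum_turn_touching[OF generic_cen[OF q(3)], of V] by linarith
  have bKL: "bdry_at K \<inter> bdry_at L = {}"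
    using no bdryD(1) unfolding bdry_at_def by blast
  have "(\<Sum>(a, b)\<in>bdry_at K. quad q a b) + (\<Sum>(a, b)\<in>bdry_at L. quad q a b) = (\<Sum>(a, b)\<in>bdry_at K \<union> bdry_at L. quad q a b)"
    using bKL bdry_at_sub(2) by (intro sum.union_disjoint[symmetric]) auto
  also have "\<dots> \<le> (\<Sum>(a, b)\<in>bdry_at V. quad q a b)"
  proof (rule sum_mono2[OF bdry_at_sub(2)])
    show "bdry_at K \<union> bdry_at L \<subseteq> bdry_at V" using bdryD(4) by (auto simp: bdry_at_def)
    show "0 \<le> (case x of (a, b) \<Rightarrow> quad q a b)" if "x \<in> bdry_at V - (bdry_at K \<union> bdry_at L)" for x
    proof -
      obtain a b where x: "x = (a, b)" by (cases x)
      then have "(a, b) \<in> bdry" using that bdry_at_sub(1)[of V] by blast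
      then show ?thesis using quad_values[OF _ q(3), of a b] x by auto
    qed
  qed
  finally have "cover K q + cover L q \<le> cover V q" using 1 by (simp add: cover_def)
  then show False using N(3)[OF q(1,3)] M(3)[OF q(2,3)] cover_all_le_1[OF q(3)] by linarith
qed

text \<open>Without outer vertices in \<open>K\<close> the cover consists of triangles alone, and
  these lie in the hull of the centres. The curve has a point farther out than all centres, and
  there nothing is counted.\<close>

lemma hit_reaches_boundary:
  assumes \<Gamma>: "connected \<Gamma>" "\<Gamma> \<subseteq> ball 0 1" and K: "saturated (hit \<Gamma>) K" "K \<noteq> {}"
    and far: "\<And>s. s < 1 \<Longrightarrow> \<exists>p\<in>\<Gamma>. s < cmod p"
  shows "K \<inter> B \<noteq> {}"
proof
  assume KB: "K \<inter> B = {}"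
  define s where "s = Max ((\<lambda>u. cmod (cen u)) ` V)"
  have ne: "V \<noteq> {}" using root by blast
  have s: "cmod (cen u) \<le> s" if "u \<in> V" for u using that finite_V by (simp add: s_def)
  have "s < 1" unfolding s_def using finite_V ne cen_less_1 by (subst Max_less_iff) auto
  then obtain p where p: "p \<in> \<Gamma>" "s < cmod p" using far by blast
  obtain N where N: "open N" "p \<in> N" "\<And>q. q \<in> N \<Longrightarrow> generic corners q \<Longrightarrow> 1 \<le> cover K q"
    using cover_along_curve[OF \<Gamma> K p(1)] by blast
  have "open (N \<inter> - cball 0 s)" "p \<in> N \<inter> - cball 0 s" using N p(2) by (auto simp: open_Compl)
  then obtain q where "q \<in> N \<inter> - cball 0 s" "generic corners q"
    using generic_dense[OF finite_corners, of "N \<inter> - cball 0 s"] by blast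
  then have q: "q \<in> N" "s < cmod q" "generic corners q" by auto
  have "bdry_at K = {}" using bdryD(2,3) KB by (auto simp: bdry_at_def)
  moreover have "card {(a, b, c) \<in> touching K. q \<in> interior (convex hull {cen a, cen b, cen c})} = 0"
  proof -
    have "q \<notin> interior (convex hull {cen a, cen b, cen c})" if "(a, b, c) \<in> T" for a b c
    proof -
      have "convex hull {cen a, cen b, cen c} \<subseteq> cball 0 s"
        using s facesE(7-9)[OF that] by (intro hull_minimal) auto
      then show ?thesis using q(2) interior_subset by fastforce
    qed
    then have "{(a, b, c) \<in> touching K. q \<in> interior (convex hull {cen a, cen b, cen c})} = {}"
      by (auto dest!: subsetD[OF touching_sub])
    then show ?thesis by (simp only: card.empty)
  qed
  then have "(\<Sum>(a, b, c)\<in>touching K. turn q (cen a) (cen b)) = 0"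
    using sum_turn_touching[OF generic_cen[OF q(3)], of K] by linarith
  ultimately have "cover K q = 0" by (simp add: cover_def)
  then show False using N(3)[OF q(1,3)] by simp
qed

end

section \<open>Short rays and short circles\<close>

text \<open>As all \<open>f u\<close> are indicators, the weighted sum takes finitely many values.
  Its minimum over the open interval is therefore attained, and it is at most the mean.\<close>

lemma averaging:
  fixes f :: "'v \<Rightarrow> real \<Rightarrow> real"
  assumes ab: "a < b" and V: "finite V" "\<And>u. u \<in> V \<Longrightarrow> 0 \<le> m u"
    and f: "\<And>u. u \<in> V \<Longrightarrow> (f u has_integral I u) {a..b}" "\<And>u t. u \<in> V \<Longrightarrow> f u t \<in> {0, 1}"
  obtains t where "a < t" "t < b" "(b - a) * (\<Sum>u\<in>V. m u * f u t) \<le> (\<Sum>u\<in>V. m u * I u)"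
proof -
  define L where "L t = (\<Sum>u\<in>V. m u * f u t)" for t
  have "L ` {a<..<b} \<subseteq> sum m ` Pow V"
  proof
    fix y assume "y \<in> L ` {a<..<b}"
    then obtain t where y: "y = L t" by blast
    have "L t = (\<Sum>u\<in>V. if f u t = 1 then m u else 0)"
      unfolding L_def using f(2) by (intro sum.cong) fastforce+
    also have "\<dots> = sum m {u \<in> V. f u t = 1}" using V(1) by (simp add: sum.inter_filter)
    finally show "y \<in> sum m ` Pow V" using y by blast
  qed
  then have fin: "finite (L ` {a<..<b})" using V(1) by (meson finite_Pow_iff finite_imageI finite_subset)
  have "L ` {a<..<b} \<noteq> {}" using ab by auto
  then have "Min (L ` {a<..<b}) \<in> L ` {a<..<b}" using fin by (rule Min_in[rotated])
  then obtain t where t: "t \<in> {a<..<b}" "L t = Min (L ` {a<..<b})" by auto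
  have le: "L t \<le> L s" if "s \<in> {a<..<b}" for s using that fin unfolding t(2) by simp
  have "(L has_integral (\<Sum>u\<in>V. m u * I u)) {a..b}"
    unfolding L_def using V(1) f(1) by (intro has_integral_sum has_integral_mult_right) auto
  then have 1: "(L has_integral (\<Sum>u\<in>V. m u * I u)) {a<..<b}"
    using has_integral_open_interval[of L _ a b] by simp
  have 2: "((\<lambda>_. L t) has_integral (b - a) * L t) {a<..<b}"
    using has_integral_const_real[of "L t" a b] ab has_integral_open_interval[of "\<lambda>_. L t" _ a b] by simp
  have "(b - a) * L t \<le> (\<Sum>u\<in>V. m u * I u)" by (rule has_integral_le[OF 2 1 le])
  then show ?thesis using that[of t] t(1) by (simp add: L_def)
qed

section \<open>Integrals over the directions of a ray\<close>

lemma has_integral_interval_indicator: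
  fixes c d :: real
  assumes "a \<le> b"
  shows "((\<lambda>t. if c \<le> t \<and> t \<le> d then 1 else 0 :: real) has_integral max 0 (min b d - max a c)) {a..b}"
proof -
  have "((\<lambda>t. 1 :: real) has_integral max 0 (min b d - max a c)) {max a c..min b d}"
  proof (cases "max a c \<le> min b d")
    case True
    then have "max 0 (min b d - max a c) = min b d - max a c" by linarith
    then show ?thesis using has_integral_const_real[of "1 :: real" "max a c" "min b d"] True by simp
  next
    case False
    then have "{max a c..min b d} = {}" "max 0 (min b d - max a c) = 0" by auto
    then show ?thesis by simp
  qed
  then have "((\<lambda>t. if t \<in> {max a c..min b d} then 1 else 0 :: real) has_integral max 0 (min b d - max a c)) {a..b}"
    by (subst has_integral_restrict) auto
  then show ?thesis
    by (rule has_integral_eq[rotated]) auto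
qed

lemma jordan_inequality:
  assumes "0 \<le> x" "x \<le> pi / 2"
  shows "2 / pi * x \<le> sin x"
proof -
  have "convex_on {0..pi/2} (\<lambda>x. - sin x)"
  proof (rule f''_ge0_imp_convex)
    show "((\<lambda>x. - sin x) has_real_derivative - cos x) (at x)" for x :: real
      by (auto intro!: derivative_eq_intros)
    show "((\<lambda>x. - cos x) has_real_derivative sin x) (at x)" for x :: real
      by (auto intro!: derivative_eq_intros)
    show "0 \<le> sin x" if "x \<in> {0..pi/2}" for x using that by (intro sin_ge_zero) auto
  qed simp
  then have "- sin ((1 - 2 / pi * x) *\<^sub>R 0 + (2 / pi * x) *\<^sub>R (pi / 2)) \<le>
     (1 - 2 / pi * x) * - sin 0 + (2 / pi * x) * - sin (pi / 2)"
    using assms by (intro convex_onD) (auto simp: field_simps)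
  then show ?thesis by simp
qed

lemma arcsin_le_linear:
  assumes "0 \<le> x" "x \<le> 1"
  shows "arcsin x \<le> pi / 2 * x"
proof -
  have "0 \<le> arcsin x" using arcsin_le_arcsin[of 0 x] assms by simp
  then have "2 / pi * arcsin x \<le> sin (arcsin x)"
    using arcsin_ubound[of x] assms by (intro jordan_inequality) auto
  then show ?thesis using assms by (simp add: field_simps)
qed

lemma two_times_le_ln_quotient:
  fixes y :: real
  assumes "0 \<le> y" "y < 1"
  shows "2 * y \<le> ln (1 + y) - ln (1 - y)"
proof -
  let ?g = "\<lambda>t. ln (1 + t) - ln (1 - t) - 2 * t :: real"
  have "?g 0 \<le> ?g y"
  proof (rule DERIV_nonneg_imp_nondecreasing[OF assms(1)])
    fix t assume t: "0 \<le> t" "t \<le> y"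
    then have "0 < 1 - t * t" using assms(2) by (metis abs_of_nonneg abs_square_less_1 diff_gt_0_iff_gt le_less_trans power2_eq_square)
    then have "0 \<le> 2 * t\<^sup>2 / (1 - t * t)" by simp
    moreover have "1 / (1 + t) + 1 / (1 - t) - 2 = 2 * t\<^sup>2 / (1 - t * t)"
      using t assms(2) \<open>0 < 1 - t * t\<close> by (simp add: field_simps power2_eq_square)
    moreover have "(?g has_real_derivative 1 / (1 + t) + 1 / (1 - t) - 2) (at t)"
      using t assms(2) by (auto intro!: derivative_eq_intros)
    ultimately show "\<exists>y. (?g has_real_derivative y) (at t) \<and> 0 \<le> y" by metis
  qed
  then show ?thesis by simp
qed

lemma has_integral_translate:
  fixes f :: "real \<Rightarrow> real"
  assumes "(f has_integral I) {a..b}"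
  shows "((\<lambda>x. f (x + c)) has_integral I) {a - c..b - c}"
  using has_integral_affinity[of f I a b 1 c] assms by simp

lemma has_integral_periodic_shift:
  fixes f :: "real \<Rightarrow> real"
  assumes f: "(f has_integral I) {c..c + p}" and per: "\<And>t. f (t + p) = f t" and d: "c \<le> d" "d \<le> c + p"
  shows "(f has_integral I) {d..d + p}"
proof -
  have i: "f integrable_on {c..d}" "f integrable_on {d..c + p}"
    using f d by (auto intro: integrable_on_subinterval simp: has_integral_integrable)
  obtain I1 I2 where I: "(f has_integral I1) {c..d}" "(f has_integral I2) {d..c + p}"
    using i by (auto simp: integrable_on_def)
  have "I1 + I2 = I"
    using has_integral_combine[OF d I] f has_integral_unique by blast
  have "((\<lambda>t. f (t + - p)) has_integral I1) {c - - p..d - - p}"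
    by (rule has_integral_translate[OF I(1)])
  moreover have "f (t + - p) = f t" for t using per[of "t - p"] by simp
  ultimately have "(f has_integral I1) {c + p..d + p}" by simp
  then have "(f has_integral I2 + I1) {d..d + p}" using d by (intro has_integral_combine[OF _ _ I(2)]) auto
  then show ?thesis using \<open>I1 + I2 = I\<close> by (simp add: add.commute)
qed

text \<open>Let a disc have radius \<open>x\<close> times the distance of its centre, seen at the
  angle \<open>\<psi>\<close> from the ray. Its chord has logarithmic length
  \<open>ln ((c + h) / (c - h))\<close> with \<open>c = cos \<psi>\<close> and
  \<open>h = sqrt (x\<^sup>2 - (sin \<psi>)\<^sup>2)\<close>, which is at least
  \<open>2 * h / c\<close>, hence at least \<open>2 * h * c\<close>. The last bound is taken because
  substituting \<open>sin \<psi>\<close> turns its integral into the area of a disc of radius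
  \<open>x\<close>. The truncations make it vanish on rays that miss the disc.\<close>

definition kern :: "real \<Rightarrow> real \<Rightarrow> real" where
  "kern x \<psi> = 2 * sqrt (max 0 (x\<^sup>2 - (sin \<psi>)\<^sup>2)) * max 0 (cos \<psi>)"

lemma sector_iff:
  assumes x: "0 \<le> x" "x < 1" and \<psi>: "- pi \<le> \<psi>" "\<psi> \<le> pi"
  shows "0 < cos \<psi> \<and> \<bar>sin \<psi>\<bar> \<le> x \<longleftrightarrow> - arcsin x \<le> \<psi> \<and> \<psi> \<le> arcsin x"
proof
  have a: "arcsin x < pi / 2" using arcsin_less_arcsin[of x 1] x by simp
  assume *: "0 < cos \<psi> \<and> \<bar>sin \<psi>\<bar> \<le> x"
  have "\<bar>\<psi>\<bar> < pi / 2"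
  proof (rule ccontr)
    assume "\<not> \<bar>\<psi>\<bar> < pi / 2"
    then have "cos \<bar>\<psi>\<bar> \<le> cos (pi / 2)" using \<psi> by (intro cos_monotone_0_pi_le) auto
    then show False using * by simp
  qed
  then have "arcsin (sin \<psi>) = \<psi>" by (intro arcsin_sin) auto
  moreover have "arcsin (sin \<psi>) \<le> arcsin x" "arcsin (- x) \<le> arcsin (sin \<psi>)"
    using * x by (intro arcsin_le_arcsin; auto)+
  ultimately show "- arcsin x \<le> \<psi> \<and> \<psi> \<le> arcsin x" using x by (simp add: arcsin_minus)
next
  have a: "arcsin x < pi / 2" using arcsin_less_arcsin[of x 1] x by simp
  assume *: "- arcsin x \<le> \<psi> \<and> \<psi> \<le> arcsin x"
  have "sin \<psi> \<le> sin (arcsin x)" "sin (- arcsin x) \<le> sin \<psi>"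
    using * a by (intro sin_monotone_2pi_le; simp)+
  moreover have "0 < cos \<psi>" using * a by (intro cos_gt_zero_pi) auto
  ultimately show "0 < cos \<psi> \<and> \<bar>sin \<psi>\<bar> \<le> x" using x by simp
qed

lemma has_integral_sector:
  assumes x: "0 \<le> x" "x < 1"
  shows "((\<lambda>\<psi>. if 0 < cos \<psi> \<and> \<bar>sin \<psi>\<bar> \<le> x then 1 else 0 :: real) has_integral 2 * arcsin x) {- pi..pi}"
proof -
  have a: "arcsin x \<le> pi / 2" "0 \<le> arcsin x" using arcsin_ubound[of x] arcsin_le_arcsin[of 0 x] x by auto
  have "((\<lambda>\<psi>. if - arcsin x \<le> \<psi> \<and> \<psi> \<le> arcsin x then 1 else 0 :: real) has_integral
      max 0 (min pi (arcsin x) - max (- pi) (- arcsin x))) {- pi..pi}"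
    by (rule has_integral_interval_indicator) simp
  moreover have "max 0 (min pi (arcsin x) - max (- pi) (- arcsin x)) = 2 * arcsin x"
    using a pi_gt_zero by (simp add: min_def max_def)
  ultimately show ?thesis
    using sector_iff[OF x] by (auto elim!: has_integral_eq[rotated])
qed

lemma has_integral_kern:
  assumes x: "0 < x" "x < 1"
  shows "(kern x has_integral pi * x\<^sup>2) {- pi..pi}"
proof -
  let ?a = "arcsin x"
  \<comment> \<open>With \<open>s = sin \<psi>\<close> this is an antiderivative of
    \<open>2 * sqrt (x\<^sup>2 - s\<^sup>2)\<close>. It is differentiated only in the interior,
    since the argument of \<open>arcsin\<close> reaches 1 and -1 at the end angles.\<close>
  let ?F = "\<lambda>\<psi>. sin \<psi> * sqrt (x\<^sup>2 - (sin \<psi>)\<^sup>2) + x\<^sup>2 * arcsin (sin \<psi> / x)"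
  have a: "0 < ?a" "?a < pi / 2" using arcsin_less_arcsin[of 0 x] arcsin_less_arcsin[of x 1] x by auto
  have "((\<lambda>\<psi>. 2 * sqrt (x\<^sup>2 - (sin \<psi>)\<^sup>2) * cos \<psi>) has_integral ?F ?a - ?F (- ?a)) {- ?a..?a}"
  proof (rule fundamental_theorem_of_calculus_interior)
    show "- ?a \<le> ?a" using a by simp
    have le: "\<bar>sin \<psi> / x\<bar> \<le> 1" if "\<psi> \<in> {- ?a..?a}" for \<psi>
      using sector_iff[of x \<psi>] that x a by (auto simp: abs_le_iff field_simps)
    have "- 1 \<le> sin \<psi> / x \<and> sin \<psi> / x \<le> 1" if "\<psi> \<in> {- ?a..?a}" for \<psi>
      using le[OF that] by linarith
    then show "continuous_on {- ?a..?a} ?F"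
      using x by (intro continuous_intros) auto
    show "(?F has_vector_derivative 2 * sqrt (x\<^sup>2 - (sin \<psi>)\<^sup>2) * cos \<psi>) (at \<psi>)" if \<psi>: "\<psi> \<in> {- ?a<..<?a}" for \<psi>
    proof -
      have "sin \<psi> < sin ?a" "sin (- ?a) < sin \<psi>" using \<psi> a by (intro sin_monotone_2pi; simp)+
      then have s: "\<bar>sin \<psi>\<bar> < x" using x by simp
      then have s2: "(sin \<psi>)\<^sup>2 < x\<^sup>2" using x by (metis abs_ge_zero abs_of_pos power2_abs power_strict_mono zero_less_numeral)
      define q where "q = sqrt (x\<^sup>2 - (sin \<psi>)\<^sup>2)"
      have q: "q > 0" "q * q = x\<^sup>2 - (sin \<psi>)\<^sup>2" using s2 by (simp_all add: q_def)
      have "sqrt (1 - (sin \<psi> / x)\<^sup>2) = q / x"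
      proof -
        have "1 - (sin \<psi> / x)\<^sup>2 = (x\<^sup>2 - (sin \<psi>)\<^sup>2) / x\<^sup>2" using x by (simp add: field_simps power2_eq_square)
        then show ?thesis using x by (simp add: q_def real_sqrt_divide)
      qed
      moreover have "- 1 < sin \<psi> / x" "sin \<psi> / x < 1" using s x by (auto simp: abs_less_iff field_simps)
      ultimately have d1: "((\<lambda>\<psi>. arcsin (sin \<psi> / x)) has_real_derivative inverse (q / x) * (cos \<psi> / x)) (at \<psi>)"
        using x by (auto intro!: derivative_eq_intros DERIV_chain2[OF DERIV_arcsin])
      have d2: "((\<lambda>\<psi>. sqrt (x\<^sup>2 - (sin \<psi>)\<^sup>2)) has_real_derivative inverse q / 2 * (- (2 * sin \<psi> * cos \<psi>))) (at \<psi>)"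
        unfolding q_def using s2
        by (auto intro!: derivative_eq_intros DERIV_chain2[OF DERIV_real_sqrt] simp: power2_eq_square)
      have d: "(?F has_real_derivative cos \<psi> * q + sin \<psi> * (inverse q / 2 * (- (2 * sin \<psi> * cos \<psi>))) +
           x\<^sup>2 * (inverse (q / x) * (cos \<psi> / x))) (at \<psi>)"
        unfolding q_def by (rule derivative_eq_intros d1[unfolded q_def] d2[unfolded q_def] refl)+ simp
      have "cos \<psi> * q + sin \<psi> * (inverse q / 2 * (- (2 * sin \<psi> * cos \<psi>))) + x\<^sup>2 * (inverse (q / x) * (cos \<psi> / x))
          = cos \<psi> * (q * q - (sin \<psi>)\<^sup>2 + x\<^sup>2) / q"
        using q(1) x by (simp add: field_simps power2_eq_square)
      also have "q * q - (sin \<psi>)\<^sup>2 + x\<^sup>2 = 2 * (q * q)" using q(2) by simp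
      also have "cos \<psi> * (2 * (q * q)) / q = 2 * q * cos \<psi>" using q(1) by simp
      finally have e: "cos \<psi> * q + sin \<psi> * (inverse q / 2 * (- (2 * sin \<psi> * cos \<psi>))) + x\<^sup>2 * (inverse (q / x) * (cos \<psi> / x))
          = 2 * q * cos \<psi>" .
      show ?thesis
        using d[unfolded e] unfolding has_real_derivative_iff_has_vector_derivative[symmetric] q_def .
    qed
  qed
  moreover have "?F ?a - ?F (- ?a) = pi * x\<^sup>2" using x by (simp add: algebra_simps)
  ultimately have 1: "((\<lambda>\<psi>. 2 * sqrt (x\<^sup>2 - (sin \<psi>)\<^sup>2) * cos \<psi>) has_integral pi * x\<^sup>2) {- ?a..?a}" by simp
  have k1: "kern x \<psi> = 2 * sqrt (x\<^sup>2 - (sin \<psi>)\<^sup>2) * cos \<psi>" if "\<psi> \<in> {- ?a..?a}" for \<psi>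
  proof -
    have "0 < cos \<psi>" "\<bar>sin \<psi>\<bar> \<le> x" using sector_iff[of x \<psi>] that x a by auto
    moreover have "(sin \<psi>)\<^sup>2 \<le> x\<^sup>2" using calculation x by (metis abs_ge_zero power2_abs power_mono)
    ultimately show ?thesis by (simp add: kern_def)
  qed
  have k0: "kern x \<psi> = 0" if "\<psi> \<in> {- pi..pi} - {- ?a..?a}" for \<psi>
  proof -
    have "\<not> (0 < cos \<psi> \<and> \<bar>sin \<psi>\<bar> \<le> x)" using sector_iff[of x \<psi>] that x by auto
    then consider "cos \<psi> \<le> 0" | "x < \<bar>sin \<psi>\<bar>" by linarith
    then show ?thesis
    proof cases
      case 2
      then have "x\<^sup>2 \<le> (sin \<psi>)\<^sup>2" using x by (metis less_imp_le power2_abs power_mono)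
      then show ?thesis by (simp add: kern_def)
    qed (simp add: kern_def)
  qed
  have "(kern x has_integral pi * x\<^sup>2) {- ?a..?a}" using has_integral_eq[OF _ 1] k1 by simp
  then have "((\<lambda>\<psi>. if \<psi> \<in> {- ?a..?a} then kern x \<psi> else 0) has_integral pi * x\<^sup>2) {- pi..pi}"
    using a by (subst has_integral_restrict) auto
  then show ?thesis by (rule has_integral_eq[rotated]) (use k0 in auto)
qed

lemma kern_periodic: "kern x (t + 2 * pi) = kern x t"
  by (simp add: kern_def)

text \<open>Pythagoras, with the foot of the perpendicular from \<open>w\<close> to the line of the
  ray.\<close>

lemma ray_dist:
  "(cmod (of_real s * cis \<theta> - w))\<^sup>2 =
     (s - cmod w * cos (\<theta> - Arg w))\<^sup>2 + (cmod w)\<^sup>2 * (sin (\<theta> - Arg w))\<^sup>2"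
proof -
  define a where "a = Arg w"
  have w: "w = rcis (cmod w) a" unfolding a_def by (simp add: rcis_cmod_Arg)
  have "(cmod (of_real s * cis \<theta> - rcis (cmod w) a))\<^sup>2 = (s * cos \<theta> - cmod w * cos a)\<^sup>2 + (s * sin \<theta> - cmod w * sin a)\<^sup>2"
    by (simp add: cmod_power2)
  also have "\<dots> = s\<^sup>2 * ((sin \<theta>)\<^sup>2 + (cos \<theta>)\<^sup>2) + (cmod w)\<^sup>2 * ((sin a)\<^sup>2 + (cos a)\<^sup>2) - 2 * s * cmod w * (cos \<theta> * cos a + sin \<theta> * sin a)"
    by algebra
  also have "\<dots> = s\<^sup>2 + (cmod w)\<^sup>2 - 2 * s * cmod w * cos (\<theta> - a)"
    by (simp add: cos_diff)
  also have "\<dots> = (s - cmod w * cos (\<theta> - a))\<^sup>2 + (cmod w)\<^sup>2 * (sin (\<theta> - a))\<^sup>2"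
    unfolding sin_squared_eq by (simp add: power2_eq_square algebra_simps)
  finally show ?thesis using w by (simp add: a_def)
qed

lemma ray_hits_imp:
  assumes "0 \<le> s" "r < cmod w" "0 < r" "cmod (of_real s * cis \<theta> - w) \<le> r"
  shows "0 < cos (\<theta> - Arg w) \<and> \<bar>sin (\<theta> - Arg w)\<bar> \<le> r / cmod w"
proof -
  let ?c = "cos (\<theta> - Arg w)" and ?s = "sin (\<theta> - Arg w)"
  have le: "(s - cmod w * ?c)\<^sup>2 + (cmod w)\<^sup>2 * ?s\<^sup>2 \<le> r\<^sup>2"
    using power_mono[OF assms(4), of 2] unfolding ray_dist by simp
  moreover have "(cmod w * \<bar>?s\<bar>)\<^sup>2 = (cmod w)\<^sup>2 * ?s\<^sup>2" by (simp add: power_mult_distrib)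
  ultimately have "(cmod w * \<bar>?s\<bar>)\<^sup>2 \<le> r\<^sup>2"
    using zero_le_power2[of "s - cmod w * ?c"] by linarith
  then have "cmod w * \<bar>?s\<bar> \<le> r" using assms(3) by (simp add: power2_le_iff_abs_le abs_mult)
  moreover have w0: "0 < cmod w" using assms by linarith
  moreover have "0 < ?c"
  proof (rule ccontr)
    assume "\<not> 0 < ?c"
    then have "0 \<le> s * cmod w * - ?c" using assms(1) by (intro mult_nonneg_nonneg) auto
    moreover have "(s - cmod w * ?c)\<^sup>2 = s\<^sup>2 + 2 * (s * cmod w * - ?c) + (cmod w)\<^sup>2 * ?c\<^sup>2"
      by (simp add: power2_eq_square algebra_simps)
    moreover have "(cmod w)\<^sup>2 * ?s\<^sup>2 + (cmod w)\<^sup>2 * ?c\<^sup>2 = (cmod w)\<^sup>2"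
      by (simp add: distrib_left[symmetric])
    ultimately have "(cmod w)\<^sup>2 \<le> r\<^sup>2" using le zero_le_power2[of s] by linarith
    then show False using assms(2,3) power_strict_mono[of r "cmod w" 2] by simp
  qed
  ultimately show ?thesis by (simp add: field_simps)
qed

lemma ray_chord:
  assumes "0 < r" "r < cmod w" and c: "0 < cos (\<theta> - Arg w)" and s: "\<bar>sin (\<theta> - Arg w)\<bar> < r / cmod w"
  obtains s1 s2 where "0 < s1" "s1 < s2" "kern (r / cmod w) (\<theta> - Arg w) \<le> ln s2 - ln s1"
    "\<And>t. s1 < t \<Longrightarrow> t < s2 \<Longrightarrow> cmod (of_real t * cis \<theta> - w) < r"
proof -
  define C S x D where "C = cos (\<theta> - Arg w)" and "S = sin (\<theta> - Arg w)" and "x = r / cmod w" and "D = cmod w"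
  have D: "0 < D" "r = x * D" using assms(1,2) by (auto simp: x_def D_def)
  have x: "0 < x" "x < 1" using assms(1,2) D(1) by (auto simp: x_def D_def divide_less_eq_1)
  have CS: "S\<^sup>2 + C\<^sup>2 = 1" by (simp add: C_def S_def)
  have c': "0 < C" "C \<le> 1" using c by (simp_all add: C_def)
  have s': "S\<^sup>2 < x\<^sup>2" using s x(1) power_strict_mono[of "\<bar>S\<bar>" x 2] by (simp add: S_def x_def)
  define h where "h = sqrt (x\<^sup>2 - S\<^sup>2)"
  have h: "0 < h" "h\<^sup>2 = x\<^sup>2 - S\<^sup>2" using s' by (simp_all add: h_def)
  have "h\<^sup>2 < C\<^sup>2" using h(2) CS x power_strict_mono[of x 1 2] by simp
  then have hC: "h < C" using c' by (simp add: power2_less_imp_less)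
  \<comment> \<open>The distances at which the ray enters and leaves the disc: the foot of the
    perpendicular is at distance \<open>D * C\<close>, and half the chord has length
    \<open>D * h\<close>.\<close>
  define s1 s2 where "s1 = D * (C - h)" and "s2 = D * (C + h)"
  show ?thesis
  proof
    show s1: "0 < s1" using D hC by (simp add: s1_def)
    show s12: "s1 < s2" using D h by (simp add: s1_def s2_def)
    show "kern (r / cmod w) (\<theta> - Arg w) \<le> ln s2 - ln s1"
    proof -
      have y: "0 \<le> h / C" "h / C < 1" using h c' hC by auto
      have "ln s2 - ln s1 = ln (C + h) - ln (C - h)"
        unfolding s1_def s2_def using D h c' hC by (simp add: ln_mult)
      also have "C + h = C * (1 + h / C)" using c' by (simp add: field_simps)
      also have "C - h = C * (1 - h / C)" using c' by (simp add: field_simps)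
      also have "ln (C * (1 + h / C)) - ln (C * (1 - h / C)) = ln (1 + h / C) - ln (1 - h / C)"
        using c' y by (subst (1 2) ln_mult) auto
      finally have "2 * (h / C) \<le> ln s2 - ln s1" using two_times_le_ln_quotient[OF y] by simp
      moreover have "h * C \<le> h / C"
        using h c' mult_left_le[of "C * C" h] mult_le_one[of C C] by (simp add: field_simps)
      moreover have "kern (r / cmod w) (\<theta> - Arg w) = 2 * h * C"
        using h c' s' by (simp add: kern_def h_def x_def C_def S_def)
      ultimately show ?thesis by simp
    qed
    fix t assume t: "s1 < t" "t < s2"
    have "\<bar>t - D * C\<bar> < D * h" using t by (auto simp: s1_def s2_def abs_less_iff algebra_simps)
    then have "(t - D * C)\<^sup>2 < (D * h)\<^sup>2" by (metis abs_ge_zero power2_abs power_strict_mono zero_less_numeral)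
    moreover have "(D * h)\<^sup>2 = D\<^sup>2 * (x\<^sup>2 - S\<^sup>2)" using h(2) by (simp add: power_mult_distrib)
    moreover have "r\<^sup>2 = D\<^sup>2 * x\<^sup>2" unfolding D(2) by (simp add: power_mult_distrib)
    ultimately have "(cmod (of_real t * cis \<theta> - w))\<^sup>2 < r\<^sup>2"
      unfolding ray_dist C_def[symmetric] S_def[symmetric] D_def[symmetric] by (simp add: algebra_simps)
    then show "cmod (of_real t * cis \<theta> - w) < r" using assms(1) by (simp add: power2_less_imp_less)
  qed
qed

lemma disjoint_intervals_length_le:
  fixes lo hi :: "'a \<Rightarrow> real"
  assumes "finite A" "A1 \<le> B1" and lh: "\<And>i. i \<in> A \<Longrightarrow> lo i \<le> hi i" "\<And>i. i \<in> A \<Longrightarrow> {lo i<..<hi i} \<subseteq> {A1..B1}"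
    and disj: "\<And>i j. i \<in> A \<Longrightarrow> j \<in> A \<Longrightarrow> i \<noteq> j \<Longrightarrow> {lo i<..<hi i} \<inter> {lo j<..<hi j} = {}"
  shows "(\<Sum>i\<in>A. hi i - lo i) \<le> B1 - A1"
proof -
  have "(\<Sum>i\<in>A. hi i - lo i) = (\<Sum>i\<in>A. measure lborel {lo i<..<hi i})"
    using lh(1) by (intro sum.cong) auto
  also have "\<dots> = measure lborel (\<Union>i\<in>A. {lo i<..<hi i})"
    using disj lh(1) by (intro measure_UNION'[symmetric] assms(1))
      (auto simp: pairwise_def disjnt_def fmeasurable_def)
  also have "\<dots> \<le> measure lborel {A1..B1}"
    using lh(2) assms(1) by (intro measure_mono_fmeasurable) (auto simp: fmeasurable_def emeasure_lborel_Icc_eq)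
  also have "\<dots> = B1 - A1" using assms(2) by simp
  finally show ?thesis .
qed

section \<open>Rays from the centre of a circle\<close>

context disc_packing begin

definition dir :: "'v \<Rightarrow> 'v \<Rightarrow> complex" where
  "dir v u = cen u - cen v"

definition ratio :: "'v \<Rightarrow> 'v \<Rightarrow> real" where
  "ratio v u = rad u / cmod (dir v u)"

lemma dir_gt: "u \<in> V \<Longrightarrow> v \<in> V \<Longrightarrow> u \<noteq> v \<Longrightarrow> rad u + rad v \<le> cmod (dir v u)"
  using sep[of v u] by (simp add: dir_def dist_norm norm_minus_commute)

lemma ratio_bounds:
  assumes "u \<in> V" "v \<in> V" "u \<noteq> v"
  shows "0 < ratio v u" "ratio v u < 1" "rad u < cmod (dir v u)"
proof -
  note r = dir_gt[OF assms] rad_pos[OF assms(1)] rad_pos[OF assms(2)]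
  then show "rad u < cmod (dir v u)" by linarith
  moreover from this have "0 < cmod (dir v u)" using r by linarith
  ultimately show "0 < ratio v u" "ratio v u < 1" using r by (auto simp: ratio_def divide_less_eq_1)
qed

text \<open>The positive root of the quadratic equation for the distance at which the ray from
  \<open>cen v\<close> reaches the unit circle.\<close>

definition exit_time :: "'v \<Rightarrow> real \<Rightarrow> real" where
  "exit_time v \<theta> = sqrt ((Re (cen v * cnj (cis \<theta>)))\<^sup>2 + 1 - (cmod (cen v))\<^sup>2) - Re (cen v * cnj (cis \<theta>))"

lemma exit_time_less:
  assumes v: "v \<in> V" and s: "cmod (cen v + of_real s * cis \<theta>) < 1"
  shows "s < exit_time v \<theta>"
proof -
  define b where "b = Re (cen v * cnj (cis \<theta>))"
  have "(cmod (cen v + of_real s * cis \<theta>))\<^sup>2 = (cmod (cen v))\<^sup>2 + 2 * b * s + s\<^sup>2 * ((sin \<theta>)\<^sup>2 + (cos \<theta>)\<^sup>2)"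
    unfolding b_def cmod_power2 by (simp add: power2_eq_square algebra_simps del: sin_cos_squared_add3)
  moreover have "(cmod (cen v + of_real s * cis \<theta>))\<^sup>2 < 1" using s by (simp add: abs_square_less_1)
  ultimately have "(s + b)\<^sup>2 < b\<^sup>2 + 1 - (cmod (cen v))\<^sup>2" by (simp add: power2_eq_square algebra_simps)
  then have "s + b < sqrt (b\<^sup>2 + 1 - (cmod (cen v))\<^sup>2)" by (rule real_less_rsqrt)
  then show ?thesis by (simp add: exit_time_def b_def)
qed

text \<open>Up to sign the product is the power of the point \<open>cen v\<close> with respect to
  the unit circle, \<open>1 - (cmod (cen v))\<^sup>2\<close>.\<close>

lemma exit_times_product:
  assumes "v \<in> V"
  shows "exit_time v \<theta> * exit_time v (\<theta> + pi) \<le> 1"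
proof -
  define b where "b = Re (cen v * cnj (cis \<theta>))"
  have nb: "Re (cen v * cnj (cis (\<theta> + pi))) = - b" by (simp add: b_def)
  have "exit_time v \<theta> * exit_time v (\<theta> + pi) = (sqrt (b\<^sup>2 + 1 - (cmod (cen v))\<^sup>2) - b) * (sqrt (b\<^sup>2 + 1 - (cmod (cen v))\<^sup>2) + b)"
    unfolding exit_time_def nb b_def[symmetric] by simp
  also have "\<dots> = (sqrt (b\<^sup>2 + 1 - (cmod (cen v))\<^sup>2))\<^sup>2 - b\<^sup>2" by (simp add: power2_eq_square algebra_simps)
  also have "\<dots> = 1 - (cmod (cen v))\<^sup>2"
  proof -
    have "0 \<le> b\<^sup>2 + 1 - (cmod (cen v))\<^sup>2"
    proof -
      have "(cmod (cen v))\<^sup>2 < 1" using cen_less_1[OF assms] by (simp add: abs_square_less_1)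
      then show ?thesis using zero_le_power2[of b] by linarith
    qed
    then show ?thesis by simp
  qed
  finally show ?thesis by simp
qed

lemma rad_le_exit_time:
  assumes v: "v \<in> V"
  shows "rad v \<le> exit_time v \<theta>"
proof (rule dense_le)
  fix s assume s: "s < rad v"
  have "max 0 s < exit_time v \<theta>"
  proof (rule exit_time_less[OF v])
    have "cmod (of_real (max 0 s) * cis \<theta>) = max 0 s" by (simp add: norm_mult)
    then show "cmod (cen v + of_real (max 0 s) * cis \<theta>) < 1"
      using norm_triangle_ineq[of "cen v" "of_real (max 0 s) * cis \<theta>"] in_disc[OF v] rad_pos[OF v] s by simp
  qed
  then show "s \<le> exit_time v \<theta>" by simp
qed

text \<open>On the logarithmic scale all chords fit between \<open>ln (rad v)\<close> and
  \<open>ln (exit_time v \<theta>)\<close>: the other open discs miss the disc of \<open>v\<close>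
  and lie in the unit disc.\<close>

lemma sum_kern_le:
  assumes v: "v \<in> V"
  shows "(\<Sum>u\<in>V - {v}. kern (ratio v u) (\<theta> - Arg (dir v u))) \<le> ln (exit_time v \<theta>) - ln (rad v)"
proof -
  define A where "A = {u \<in> V - {v}. 0 < cos (\<theta> - Arg (dir v u)) \<and> \<bar>sin (\<theta> - Arg (dir v u))\<bar> < ratio v u}"
  have A: "u \<in> V" "u \<noteq> v" if "u \<in> A" for u using that by (auto simp: A_def)
  have finA: "finite A" using finite_V by (simp add: A_def)
  have r: "0 < rad v" using rad_pos[OF v] .
  have "\<exists>s1 s2. 0 < s1 \<and> s1 < s2 \<and> kern (ratio v u) (\<theta> - Arg (dir v u)) \<le> ln s2 - ln s1 \<and>
      (\<forall>t. s1 < t \<longrightarrow> t < s2 \<longrightarrow> cmod (of_real t * cis \<theta> - dir v u) < rad u)" if u: "u \<in> A" for u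
  proof -
    have c: "0 < cos (\<theta> - Arg (dir v u))" "\<bar>sin (\<theta> - Arg (dir v u))\<bar> < rad u / cmod (dir v u)"
      using u by (simp_all add: A_def ratio_def)
    show ?thesis unfolding ratio_def
      by (rule ray_chord[OF rad_pos[OF A(1)[OF u]] ratio_bounds(3)[OF A(1)[OF u] v A(2)[OF u]] c]) blast
  qed
  then obtain s1 s2 where s: "\<And>u. u \<in> A \<Longrightarrow> 0 < s1 u \<and> s1 u < s2 u \<and>
      kern (ratio v u) (\<theta> - Arg (dir v u)) \<le> ln (s2 u) - ln (s1 u) \<and>
      (\<forall>t. s1 u < t \<longrightarrow> t < s2 u \<longrightarrow> cmod (of_real t * cis \<theta> - dir v u) < rad u)" by metis
  have s_pos: "0 < s1 u" "0 < s2 u" "s1 u < s2 u" if "u \<in> A" for u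
    using s[OF that, THEN conjunct1] s[OF that, THEN conjunct2, THEN conjunct1] by simp_all
  have in_ball: "dist (cen u) (cen v + of_real (exp y) * cis \<theta>) < rad u"
    if u: "u \<in> A" and y: "ln (s1 u) < y" "y < ln (s2 u)" for u y
  proof -
    have "s1 u < exp y" "exp y < s2 u"
    proof -
      have "exp (ln (s1 u)) < exp y" "exp y < exp (ln (s2 u))" using y by simp_all
      then show "s1 u < exp y" "exp y < s2 u" using s_pos[OF u] by simp_all
    qed
    then have "cmod (of_real (exp y) * cis \<theta> - dir v u) < rad u"
      using s[OF u, THEN conjunct2, THEN conjunct2, THEN conjunct2] by blast
    moreover have "cen v + of_real (exp y) * cis \<theta> - cen u = of_real (exp y) * cis \<theta> - dir v u" by (simp add: dir_def)
    ultimately show ?thesis by (metis dist_commute dist_norm)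
  qed
  have "(\<Sum>u\<in>V - {v}. kern (ratio v u) (\<theta> - Arg (dir v u))) = (\<Sum>u\<in>A. kern (ratio v u) (\<theta> - Arg (dir v u)))"
  proof (rule sum.mono_neutral_right)
    show "\<forall>u\<in>V - {v} - A. kern (ratio v u) (\<theta> - Arg (dir v u)) = 0"
    proof
      fix u assume u: "u \<in> V - {v} - A"
      then have x: "0 < ratio v u" using ratio_bounds(1) v by blast
      from u have "cos (\<theta> - Arg (dir v u)) \<le> 0 \<or> ratio v u \<le> \<bar>sin (\<theta> - Arg (dir v u))\<bar>" by (auto simp: A_def)
      then show "kern (ratio v u) (\<theta> - Arg (dir v u)) = 0"
      proof
        assume "ratio v u \<le> \<bar>sin (\<theta> - Arg (dir v u))\<bar>"
        then have "(ratio v u)\<^sup>2 \<le> (sin (\<theta> - Arg (dir v u)))\<^sup>2" using x by (metis less_imp_le power2_abs power_mono)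
        then show ?thesis by (simp add: kern_def)
      qed (simp add: kern_def)
    qed
  qed (use finite_V in \<open>auto simp: A_def\<close>)
  also have "\<dots> \<le> (\<Sum>u\<in>A. ln (s2 u) - ln (s1 u))" using s by (intro sum_mono) blast
  also have "\<dots> \<le> ln (exit_time v \<theta>) - ln (rad v)"
  proof (rule disjoint_intervals_length_le[OF finA])
    show "ln (rad v) \<le> ln (exit_time v \<theta>)" using rad_le_exit_time[OF v, of \<theta>] r by simp
    show "ln (s1 u) \<le> ln (s2 u)" if "u \<in> A" for u using s_pos[OF that] by simp
    show "{ln (s1 u)<..<ln (s2 u)} \<subseteq> {ln (rad v)..ln (exit_time v \<theta>)}" if u: "u \<in> A" for u
    proof
      fix y assume "y \<in> {ln (s1 u)<..<ln (s2 u)}"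
      then have b: "dist (cen u) (cen v + of_real (exp y) * cis \<theta>) < rad u" using in_ball[OF u] by simp
      have "cmod (cen v + of_real (exp y) * cis \<theta>) < 1"
        using b in_disc[OF A(1)[OF u]] dist_triangle[of 0 "cen v + of_real (exp y) * cis \<theta>" "cen u"] by simp
      then have e: "exp y < exit_time v \<theta>" by (rule exit_time_less[OF v])
      have "rad v \<le> exp y"
      proof (rule ccontr)
        assume "\<not> rad v \<le> exp y"
        then have "dist (cen v) (cen v + of_real (exp y) * cis \<theta>) \<le> rad v" by (simp add: dist_norm norm_mult)
        then show False using ball_cball_disjoint[OF A(1)[OF u] v A(2)[OF u] b] by blast
      qed
      then have "ln (rad v) \<le> y" using r by (metis exp_gt_zero ln_exp ln_le_cancel_iff)
      moreover have "y \<le> ln (exit_time v \<theta>)" using e by (metis exp_gt_zero less_imp_le less_trans ln_exp ln_le_cancel_iff)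
      ultimately show "y \<in> {ln (rad v)..ln (exit_time v \<theta>)}" by simp
    qed
    show "{ln (s1 u)<..<ln (s2 u)} \<inter> {ln (s1 w)<..<ln (s2 w)} = {}" if uw: "u \<in> A" "w \<in> A" "u \<noteq> w" for u w
    proof -
      have "False" if "y \<in> {ln (s1 u)<..<ln (s2 u)}" "y \<in> {ln (s1 w)<..<ln (s2 w)}" for y
        using ball_cball_disjoint[OF A(1)[OF uw(1)] A(1)[OF uw(2)] uw(3)] in_ball[OF uw(1), of y] in_ball[OF uw(2), of y] that
        by fastforce
      then show ?thesis by blast
    qed
  qed
  finally show ?thesis .
qed

lemma has_integral_rotated:
  fixes f :: "real \<Rightarrow> real"
  assumes "(f has_integral I) {- pi..pi}" "\<And>t. f (t + 2 * pi) = f t"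
  shows "((\<lambda>\<theta>. f (\<theta> - Arg w)) has_integral I) {0..2 * pi}"
proof -
  have "(f has_integral I) {- Arg w..- Arg w + 2 * pi}"
    using has_integral_periodic_shift[of f I "- pi" "2 * pi" "- Arg w"] assms Arg_bounded[of w] by simp
  from has_integral_translate[OF this, of "- Arg w"] show ?thesis by simp
qed

lemma sum_ratio_squared_le:
  assumes v: "v \<in> V"
  shows "(\<Sum>u\<in>V - {v}. (ratio v u)\<^sup>2) \<le> 2 * ln (1 / rad v)"
proof -
  define k where "k u \<theta> = kern (ratio v u) (\<theta> - Arg (dir v u))" for u \<theta>
  define S where "S \<theta> = (\<Sum>u\<in>V - {v}. k u \<theta>)" for \<theta>
  let ?I = "\<Sum>u\<in>V - {v}. pi * (ratio v u)\<^sup>2"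
  have r: "0 < rad v" using rad_pos[OF v] .
  have "(k u has_integral pi * (ratio v u)\<^sup>2) {0..2 * pi}" if "u \<in> V - {v}" for u
    unfolding k_def using that ratio_bounds[of u v] v
    by (intro has_integral_rotated has_integral_kern kern_periodic) auto
  then have S: "(S has_integral ?I) {0..2 * pi}"
    unfolding S_def using finite_V by (intro has_integral_sum) auto
  have per: "S (t + 2 * pi) = S t" for t
  proof -
    have "k u (t + 2 * pi) = k u t" for u
      using kern_periodic[of "ratio v u" "t - Arg (dir v u)"] by (simp add: k_def algebra_simps)
    then show ?thesis by (simp add: S_def)
  qed
  \<comment> \<open>Since \<open>S\<close> has period \<open>2 * pi\<close>, the opposite ray
    contributes the same integral. Adding the two replaces a single exit time by the product of two
    opposite ones.\<close>
  have "(S has_integral ?I) {pi..pi + 2 * pi}"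
    using has_integral_periodic_shift[of S ?I 0 "2 * pi" pi] S per by simp
  from has_integral_translate[OF this, of pi] have "((\<lambda>\<theta>. S (\<theta> + pi)) has_integral ?I) {0..2 * pi}" by simp
  then have 1: "((\<lambda>\<theta>. S \<theta> + S (\<theta> + pi)) has_integral ?I + ?I) {0..2 * pi}" by (rule has_integral_add[OF S])
  have 2: "((\<lambda>_. 2 * ln (1 / rad v)) has_integral (2 * pi) * (2 * ln (1 / rad v))) {0..2 * pi}"
    using has_integral_const_real[of "2 * ln (1 / rad v)" 0 "2 * pi"] by simp
  have "?I + ?I \<le> (2 * pi) * (2 * ln (1 / rad v))"
  proof (rule has_integral_le[OF 1 2])
    fix \<theta> :: real
    let ?R = "exit_time v \<theta>" and ?R' = "exit_time v (\<theta> + pi)"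
    have R: "0 < ?R" "0 < ?R'" using rad_le_exit_time[OF v, of \<theta>] rad_le_exit_time[OF v, of "\<theta> + pi"] r by auto
    have "S \<theta> + S (\<theta> + pi) \<le> (ln ?R - ln (rad v)) + (ln ?R' - ln (rad v))"
      unfolding S_def k_def by (intro add_mono sum_kern_le v)
    also have "\<dots> = ln (?R * ?R') - 2 * ln (rad v)" using R by (simp add: ln_mult)
    also have "\<dots> \<le> - 2 * ln (rad v)"
      using exit_times_product[OF v, of \<theta>] R by (simp add: ln_le_zero_iff)
    also have "\<dots> = 2 * ln (1 / rad v)" using r by (simp add: ln_div)
    finally show "S \<theta> + S (\<theta> + pi) \<le> 2 * ln (1 / rad v)" .
  qed
  then have "pi * (2 * (\<Sum>u\<in>V - {v}. (ratio v u)\<^sup>2)) \<le> pi * (2 * (2 * ln (1 / rad v)))"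
    by (simp add: sum_distrib_left[symmetric] algebra_simps)
  then show ?thesis by (simp add: mult_le_cancel_left_pos)
qed

text \<open>Cut off at the unit circle, because a curve is known to avoid the rim only inside the
  open unit disc.\<close>

definition ray :: "'v \<Rightarrow> real \<Rightarrow> complex set" where
  "ray v \<theta> = {cen v + of_real s * cis \<theta> | s. 0 \<le> s} \<inter> ball 0 1"

lemma short_ray:
  assumes v: "v \<in> V" and m: "\<And>u. u \<in> V \<Longrightarrow> 0 \<le> m u"
  obtains \<theta> where "(\<Sum>u\<in>hit (ray v \<theta>). m u)\<^sup>2 \<le> (1 + 1 / 2 * ln (1 / rad v)) * (\<Sum>u\<in>V. (m u)\<^sup>2)"
proof -
  define f :: "'v \<Rightarrow> real \<Rightarrow> real" where "f u \<theta> = (if u = v \<or> 0 < cos (\<theta> - Arg (dir v u)) \<and> \<bar>sin (\<theta> - Arg (dir v u))\<bar> \<le> ratio v u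
     then 1 else 0)" for u \<theta>
  define I where "I u = (if u = v then 2 * pi else 2 * arcsin (ratio v u))" for u
  define p where "p u = I u / (2 * pi)" for u
  have f: "(f u has_integral I u) {0..2 * pi}" if u: "u \<in> V" for u
  proof (cases "u = v")
    case True
    then have "f u = (\<lambda>_. 1)" by (intro ext) (simp add: f_def)
    then show ?thesis using has_integral_const_real[of "1 :: real" 0 "2 * pi"] True by (simp add: I_def)
  next
    case False
    have "((\<lambda>\<theta>. if 0 < cos (\<theta> - Arg (dir v u)) \<and> \<bar>sin (\<theta> - Arg (dir v u))\<bar> \<le> ratio v u then 1 else 0 :: real)
        has_integral 2 * arcsin (ratio v u)) {0..2 * pi}"
      using ratio_bounds[OF u v False]
      by (intro has_integral_rotated[where f = "\<lambda>\<psi>. if 0 < cos \<psi> \<and> \<bar>sin \<psi>\<bar> \<le> ratio v u then 1 else 0"] has_integral_sector) auto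
    moreover have "f u = (\<lambda>\<theta>. if 0 < cos (\<theta> - Arg (dir v u)) \<and> \<bar>sin (\<theta> - Arg (dir v u))\<bar> \<le> ratio v u then 1 else 0)"
      by (intro ext) (simp add: f_def False)
    ultimately show ?thesis using False by (simp add: I_def)
  qed
  have f01: "f u t \<in> {0, 1}" for u t by (simp add: f_def)
  obtain \<theta> where \<theta>: "(2 * pi - 0) * (\<Sum>u\<in>V. m u * f u \<theta>) \<le> (\<Sum>u\<in>V. m u * I u)"
    by (rule averaging[of 0 "2 * pi" V m f I]) (use finite_V m f f01 in simp_all)
  have "(\<Sum>u\<in>hit (ray v \<theta>). m u) \<le> (\<Sum>u\<in>V. m u * f u \<theta>)"
  proof -
    have "f u \<theta> = 1" if u: "u \<in> hit (ray v \<theta>)" for u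
    proof (cases "u = v")
      case False
      have uV: "u \<in> V" using u by (simp add: hit_def)
      obtain s where s: "0 \<le> s" "dist (cen u) (cen v + of_real s * cis \<theta>) \<le> rad u"
        using u by (auto simp: hit_def ray_def)
      have "cmod (of_real s * cis \<theta> - dir v u) \<le> rad u"
        using s(2) by (simp add: dist_norm dir_def norm_minus_commute algebra_simps)
      then show ?thesis
        using ray_hits_imp[OF s(1) ratio_bounds(3)[OF uV v False] rad_pos[OF uV]] by (simp add: f_def ratio_def)
    qed (simp add: f_def)
    then have "(\<Sum>u\<in>hit (ray v \<theta>). m u) = (\<Sum>u\<in>hit (ray v \<theta>). m u * f u \<theta>)" by (intro sum.cong) auto
    also have "\<dots> \<le> (\<Sum>u\<in>V. m u * f u \<theta>)"
      using finite_V m by (intro sum_mono2) (auto simp: hit_def f_def)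
    finally show ?thesis .
  qed
  also have "\<dots> \<le> (\<Sum>u\<in>V. m u * p u)"
  proof -
    have "(\<Sum>u\<in>V. m u * p u) = (\<Sum>u\<in>V. m u * I u) / (2 * pi)" by (simp add: p_def sum_divide_distrib)
    then show ?thesis using \<theta> by (simp add: pos_le_divide_eq mult.commute)
  qed
  finally have le: "(\<Sum>u\<in>hit (ray v \<theta>). m u) \<le> (\<Sum>u\<in>V. m u * p u)" .
  have "0 \<le> (\<Sum>u\<in>hit (ray v \<theta>). m u)" using m by (intro sum_nonneg) (auto simp: hit_def)
  with le have "(\<Sum>u\<in>hit (ray v \<theta>). m u)\<^sup>2 \<le> (\<Sum>u\<in>V. m u * p u)\<^sup>2" by (rule power_mono)
  also have "\<dots> \<le> (\<Sum>u\<in>V. (m u)\<^sup>2) * (\<Sum>u\<in>V. (p u)\<^sup>2)" by (rule Cauchy_Schwarz_ineq_sum)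
  also have "\<dots> \<le> (\<Sum>u\<in>V. (m u)\<^sup>2) * (1 + 1 / 2 * ln (1 / rad v))"
  proof (rule mult_left_mono)
    have pu: "(p u)\<^sup>2 \<le> 1 / 4 * (ratio v u)\<^sup>2" if u: "u \<in> V - {v}" for u
    proof -
      have x: "0 < ratio v u" "ratio v u < 1" using ratio_bounds[of u v] u v by auto
      have pe: "p u = arcsin (ratio v u) / pi" using u by (simp add: p_def I_def)
      have "arcsin (ratio v u) \<le> pi / 2 * ratio v u" using x by (intro arcsin_le_linear) auto
      then have "p u \<le> (pi / 2 * ratio v u) / pi" unfolding pe by (rule divide_right_mono) simp
      then have "p u \<le> 1 / 2 * ratio v u" by simp
      moreover have "0 \<le> p u" using pe arcsin_le_arcsin[of 0 "ratio v u"] x by simp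
      ultimately have "(p u)\<^sup>2 \<le> (1 / 2 * ratio v u)\<^sup>2" by (rule power_mono)
      then show ?thesis by (simp add: power2_eq_square)
    qed
    \<comment> \<open>\<open>p u\<close> bounds the probability that the ray meets the disc of
      \<open>u\<close>, and \<open>p v = 1\<close>. For the others the square of 1/2 gives the
      factor 1/4, and 1/4 times 2 is the 1/2 of the final bound.\<close>
    have "(\<Sum>u\<in>V. (p u)\<^sup>2) = (p v)\<^sup>2 + (\<Sum>u\<in>V - {v}. (p u)\<^sup>2)"
      using finite_V v by (simp add: sum.remove)
    also have "\<dots> \<le> 1 + (\<Sum>u\<in>V - {v}. 1 / 4 * (ratio v u)\<^sup>2)"
      using pu by (intro add_mono sum_mono) (auto simp: p_def I_def)
    also have "\<dots> = 1 + 1 / 4 * (\<Sum>u\<in>V - {v}. (ratio v u)\<^sup>2)" by (simp only: sum_distrib_left)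
    also have "\<dots> \<le> 1 + 1 / 4 * (2 * ln (1 / rad v))" using sum_ratio_squared_le[OF v] by simp
    finally show "(\<Sum>u\<in>V. (p u)\<^sup>2) \<le> 1 + 1 / 2 * ln (1 / rad v)" by simp
  qed (simp add: sum_nonneg)
  finally show ?thesis using that[of \<theta>] by (simp add: mult.commute)
qed

lemma ray_props:
  assumes v: "v \<in> V"
  shows "connected (ray v \<theta>)" "ray v \<theta> \<subseteq> ball 0 1" "v \<in> hit (ray v \<theta>)"
    "s < 1 \<Longrightarrow> \<exists>p\<in>ray v \<theta>. s < cmod p"
proof -
  have "convex {cen v + of_real s * cis \<theta> | s. 0 \<le> s}"
  proof -
    have "{cen v + of_real s * cis \<theta> | s. 0 \<le> s} = (\<lambda>x. cen v + x) ` ((\<lambda>s. s *\<^sub>R cis \<theta>) ` {0..})"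
      by (auto simp: scaleR_conv_of_real)
    moreover have "convex ((\<lambda>s. s *\<^sub>R cis \<theta>) ` {0..})"
      by (intro convex_linear_image bounded_linear.linear bounded_linear_scaleR_left) auto
    ultimately show ?thesis using convex_translation by metis
  qed
  then show "connected (ray v \<theta>)" unfolding ray_def by (intro convex_connected convex_Int) auto
  show "ray v \<theta> \<subseteq> ball 0 1" by (auto simp: ray_def)
  have "cen v \<in> ray v \<theta>" using cen_less_1[OF v] by (auto simp: ray_def intro: exI[of _ 0])
  then have "cen v \<in> cball (cen v) (rad v) \<inter> ray v \<theta>" using rad_pos[OF v] by simp
  then show "v \<in> hit (ray v \<theta>)" using v unfolding hit_def by blast
  show "\<exists>p\<in>ray v \<theta>. s < cmod p" if s: "s < 1"
  proof -
    let ?g = "\<lambda>t. cmod (cen v + of_real t * cis \<theta>)"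
    define r where "r = max ((1 + s) / 2) ((1 + cmod (cen v)) / 2)"
    have r: "s < r" "cmod (cen v) < r" "r < 1" using s cen_less_1[OF v] by (auto simp: r_def less_max_iff_disj)
    have "?g 0 \<le> r" using r by simp
    moreover have "r \<le> ?g 2"
      using norm_triangle_ineq2[of "of_real 2 * cis \<theta>" "- cen v"] cen_less_1[OF v] r(3) by (simp add: norm_mult add.commute)
    ultimately obtain t where "0 \<le> t" "?g t = r"
      using IVT'[of ?g 0 r 2] by (force intro!: continuous_intros)
    then show ?thesis using r by (intro bexI[of _ "cen v + of_real t * cis \<theta>"]) (auto simp: ray_def)
  qed
qed

text \<open>For \<open>v\<close> other than the root, the length of the set of radii for which the
  circle around 0 meets the discs of both \<open>u\<close> and \<open>v\<close>. Divided by
  \<open>2 * rad v\<close> it is the probability that a random circle meeting the disc of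
  \<open>v\<close> also meets that of \<open>u\<close>.\<close>

definition circle_window :: "'v \<Rightarrow> 'v \<Rightarrow> real" where
  "circle_window v u = max 0 (min (cmod (cen v) + rad v) (cmod (cen u) + rad u) - max (cmod (cen v) - rad v) (cmod (cen u) - rad u))"

text \<open>
  The part of the disc of \<open>u\<close> lying over its window contains a disc whose diameter is the length of
  the window, and these discs are disjoint subsets of an annulus.
\<close>

lemma sum_windows_le:
  assumes v: "v \<in> V" "v \<noteq> \<rho>"
  shows "(\<Sum>u\<in>V. (circle_window v u)\<^sup>2) \<le> 16 * cmod (cen v) * rad v"
proof -
  define d r where "d = cmod (cen v)" and "r = rad v"
  have r: "0 < r" and rho: "0 < rad \<rho>" "\<rho> \<in> V" using rad_pos v root by (auto simp: r_def)
  have dr: "rad \<rho> + r \<le> d" using sep[OF rho(2) v(1)] v(2) root_centre by (simp add: d_def r_def)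
  define A where "A = {u \<in> V. 0 < circle_window v u}"
  have finA: "finite A" using finite_V by (simp add: A_def)
  \<comment> \<open>\<open>D u\<close> is centred on the ray through \<open>cen u\<close>, half way
    along the window. It stays in the disc of \<open>u\<close> because its diameter on that ray is
    part of a diameter of the disc.\<close>
  define lo hi e where "lo u = max (d - r) (cmod (cen u) - rad u)" and "hi u = min (d + r) (cmod (cen u) + rad u)"
    and "e u = of_real ((lo u + hi u) / 2) * sgn (cen u)" for u
  define D where "D u = ball (e u) ((hi u - lo u) / 2)" for u
  have A: "u \<in> V" "u \<noteq> \<rho>" "cen u \<noteq> 0" "lo u < hi u" "circle_window v u = hi u - lo u" "0 < lo u" if u: "u \<in> A" for u
  proof -
    show uV: "u \<in> V" using u by (simp add: A_def)
    show w: "lo u < hi u" "circle_window v u = hi u - lo u"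
      using u by (auto simp: A_def circle_window_def lo_def hi_def d_def r_def)
    \<comment> \<open>The disc of the root does not reach beyond the radius \<open>d - r\<close>, so
      its window has length 0. For all other circles \<open>sgn (cen u)\<close> is a
      direction.\<close>
    show "u \<noteq> \<rho>" using w(1) dr root_centre rho by (auto simp: lo_def hi_def)
    then show "cen u \<noteq> 0" using cen_inj[OF uV rho(2)] root_centre by auto
    show "0 < lo u" using dr rho by (auto simp: lo_def)
  qed
  have Dsub: "dist (cen u) x < rad u" "d - r < cmod x" "cmod x < d + r" if u: "u \<in> A" and x: "x \<in> D u" for u x
  proof -
    let ?m = "(lo u + hi u) / 2"
    have nsg: "cmod (sgn (cen u)) = 1" using A(3)[OF u] by (simp add: norm_sgn)
    have xe: "cmod (e u - x) < (hi u - lo u) / 2" using x by (simp add: D_def dist_norm)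
    have ce: "cmod (e u) = ?m" 
    proof -
      have "0 \<le> ?m" using A(4,6)[OF u] by simp
      then show ?thesis unfolding e_def norm_mult norm_of_real nsg by simp
    qed
    have "cen u - e u = of_real (cmod (cen u) - ?m) * sgn (cen u)"
    proof -
      have "cen u = of_real (cmod (cen u)) * sgn (cen u)" using A(3)[OF u] by (simp add: sgn_div_norm scaleR_conv_of_real)
      then show ?thesis unfolding e_def by (simp add: algebra_simps)
    qed
    then have "cmod (cen u - e u) = \<bar>cmod (cen u) - ?m\<bar>" using nsg by (simp only: norm_mult norm_of_real)  simp
    moreover have "dist (cen u) x \<le> cmod (cen u - e u) + cmod (e u - x)"
      unfolding dist_norm using norm_triangle_ineq[of "cen u - e u" "e u - x"] by simp
    moreover have "cmod (cen u) - rad u \<le> lo u" "hi u \<le> cmod (cen u) + rad u" by (simp_all add: lo_def hi_def)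
    ultimately show "dist (cen u) x < rad u" using xe A(4)[OF u] by (simp add: abs_if field_simps split: if_splits)
    have "\<bar>cmod (e u) - cmod x\<bar> \<le> cmod (e u - x)" by (rule norm_triangle_ineq3)
    then have "lo u < cmod x \<and> cmod x < hi u" using xe unfolding ce abs_le_iff by (simp add: field_simps)
    then show "d - r < cmod x" "cmod x < d + r" by (simp_all add: lo_def hi_def)
  qed
  let ?R = "ball 0 (d + r) - cball 0 (d - r) :: complex set"
  have area: "measure lebesgue (ball x s) = pi * s\<^sup>2" "measure lebesgue (cball x s) = pi * s\<^sup>2" if "0 \<le> s" for x :: complex and s
    using that content_ball[OF that, of x] content_cball_conv_ball[of x s] by (simp_all add: unit_ball_vol_2)
  have fm: "ball x s \<in> lmeasurable" "cball x s \<in> lmeasurable" for x :: complex and s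
    by (simp_all add: lmeasurable_ball lmeasurable_cball)
  have "(\<Sum>u\<in>A. measure lebesgue (D u)) = measure lebesgue (\<Union>u\<in>A. D u)"
  proof (rule measure_UNION'[symmetric, OF finA])
    show "D u \<in> lmeasurable" for u using fm by (simp add: D_def)
    show "pairwise (\<lambda>u w. disjnt (D u) (D w)) A"
    proof (rule pairwiseI)
      fix u w assume uw: "u \<in> A" "w \<in> A" "u \<noteq> w"
      then show "disjnt (D u) (D w)"
        using Dsub(1)[of u] Dsub(1)[of w] ball_cball_disjoint[OF A(1)[OF uw(1)] A(1)[OF uw(2)] uw(3)]
        unfolding disjnt_def by (meson disjoint_iff less_imp_le)
    qed
  qed
  also have "\<dots> \<le> measure lebesgue ?R"
  proof (rule measure_mono_fmeasurable)
    show "(\<Union>u\<in>A. D u) \<subseteq> ?R" 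
    proof
      fix x assume "x \<in> (\<Union>u\<in>A. D u)"
      then obtain u where "u \<in> A" "x \<in> D u" by blast
      from Dsub(2,3)[OF this] show "x \<in> ?R" by simp
    qed
    show "(\<Union>u\<in>A. D u) \<in> sets lebesgue" using finA fm(1) by (intro sets.finite_UN) (auto simp: D_def)
    show "?R \<in> lmeasurable" using fm by (intro fmeasurable.Diff)
  qed
  also have "\<dots> = measure lebesgue (ball (0 :: complex) (d + r)) - measure lebesgue (cball (0 :: complex) (d - r))"
    by (rule measurable_measure_Diff) (use fm r in auto)
  also have "\<dots> = pi * (d + r)\<^sup>2 - pi * (d - r)\<^sup>2"
    using dr rho r area[of "d + r" 0] area[of "d - r" 0] by simp
  \<comment> \<open>Against this area of the annulus stand discs of area \<open>pi / 4\<close> times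
    the squared window; this is the origin of the factor 16.\<close>
  also have "\<dots> = 4 * pi * d * r" by (simp add: power2_eq_square algebra_simps)
  finally have "(\<Sum>u\<in>A. measure lebesgue (D u)) \<le> 4 * pi * d * r" .
  moreover have "measure lebesgue (D u) = pi / 4 * (circle_window v u)\<^sup>2" if "u \<in> A" for u
    using A(4,5)[OF that] area(1)[of "(hi u - lo u) / 2" "e u"] by (simp add: D_def power_divide)
  ultimately have "pi / 4 * (\<Sum>u\<in>A. (circle_window v u)\<^sup>2) \<le> 4 * pi * d * r" by (simp add: sum_distrib_left)
  then have "(\<Sum>u\<in>A. (circle_window v u)\<^sup>2) \<le> 16 * d * r"
    by (simp add: field_simps)
  moreover have "(\<Sum>u\<in>V. (circle_window v u)\<^sup>2) = (\<Sum>u\<in>A. (circle_window v u)\<^sup>2)"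
  proof (rule sum.mono_neutral_right[OF finite_V])
    show "\<forall>u\<in>V - A. (circle_window v u)\<^sup>2 = 0" by (auto simp: A_def circle_window_def max_def)
  qed (auto simp: A_def)
  ultimately show ?thesis by (simp add: d_def r_def)
qed

lemma hit_circle:
  assumes u: "u \<in> hit (sphere 0 t)"
  shows "u \<in> V" "cmod (cen u) - rad u \<le> t" "t \<le> cmod (cen u) + rad u"
proof -
  obtain p where p: "u \<in> V" "dist (cen u) p \<le> rad u" "cmod p = t"
  proof -
    from u obtain p where "u \<in> V" "p \<in> cball (cen u) (rad u)" "p \<in> sphere 0 t" unfolding hit_def by blast
    then show ?thesis using that by simp
  qed
  then show "u \<in> V" by blast
  show "cmod (cen u) - rad u \<le> t" "t \<le> cmod (cen u) + rad u"
    using p norm_triangle_ineq3[of "cen u" p] by (auto simp: dist_norm)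
qed

lemma short_circle:
  assumes v: "v \<in> V" "v \<noteq> \<rho>" and m: "\<And>u. u \<in> V \<Longrightarrow> 0 \<le> m u"
  obtains t where "cmod (cen v) - rad v < t" "t < cmod (cen v) + rad v"
    "(\<Sum>u\<in>hit (sphere 0 t). m u)\<^sup>2 \<le> 4 * inverse (rad v) * (\<Sum>u\<in>V. (m u)\<^sup>2)"
proof -
  define d r where "d = cmod (cen v)" and "r = rad v"
  have r: "0 < r" using rad_pos v by (auto simp: r_def)
  have d: "0 \<le> d" "d \<le> 1" using cen_less_1[OF v(1)] by (auto simp: d_def)
  define f :: "'v \<Rightarrow> real \<Rightarrow> real" where "f u t = (if cmod (cen u) - rad u \<le> t \<and> t \<le> cmod (cen u) + rad u then 1 else 0)" for u t
  have f: "(f u has_integral circle_window v u) {d - r..d + r}" for u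
    unfolding f_def circle_window_def d_def[symmetric] r_def[symmetric]
    using has_integral_interval_indicator[of "d - r" "d + r" "cmod (cen u) - rad u" "cmod (cen u) + rad u"] r by simp
  obtain t where t: "d - r < t" "t < d + r" "((d + r) - (d - r)) * (\<Sum>u\<in>V. m u * f u t) \<le> (\<Sum>u\<in>V. m u * circle_window v u)"
    by (rule averaging[of "d - r" "d + r" V m f "circle_window v"]) (use finite_V m f r in \<open>simp_all add: f_def\<close>)
  let ?L = "\<Sum>u\<in>hit (sphere 0 t). m u"
  have "?L = (\<Sum>u\<in>hit (sphere 0 t). m u * f u t)" using hit_circle[of _ t] by (intro sum.cong) (auto simp: f_def)
  also have "\<dots> \<le> (\<Sum>u\<in>V. m u * f u t)"
    using finite_V m by (intro sum_mono2) (auto simp: hit_def f_def)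
  finally have "2 * r * ?L \<le> 2 * r * (\<Sum>u\<in>V. m u * f u t)" using r by simp
  then have le: "2 * r * ?L \<le> (\<Sum>u\<in>V. m u * circle_window v u)" using t(3) by simp
  have "0 \<le> ?L" using m by (intro sum_nonneg) (auto simp: hit_def)
  then have "(2 * r * ?L)\<^sup>2 \<le> (\<Sum>u\<in>V. m u * circle_window v u)\<^sup>2" using le r by (intro power_mono) auto
  also have "\<dots> \<le> (\<Sum>u\<in>V. (m u)\<^sup>2) * (\<Sum>u\<in>V. (circle_window v u)\<^sup>2)" by (rule Cauchy_Schwarz_ineq_sum)
  also have "\<dots> \<le> (\<Sum>u\<in>V. (m u)\<^sup>2) * (16 * d * r)"
    using sum_windows_le[OF v] by (intro mult_left_mono sum_nonneg) (auto simp: d_def r_def)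
  \<comment> \<open>Here \<open>d \<le> 1\<close> enters. Dividing by the square of
    \<open>2 * r\<close> leaves the constant 4.\<close>
  also have "\<dots> \<le> (\<Sum>u\<in>V. (m u)\<^sup>2) * (16 * r)" using d r by (intro mult_left_mono sum_nonneg) auto
  finally have "r * (r * ?L\<^sup>2) \<le> r * (4 * (\<Sum>u\<in>V. (m u)\<^sup>2))" by (simp add: power2_eq_square algebra_simps)
  then have "r * ?L\<^sup>2 \<le> 4 * (\<Sum>u\<in>V. (m u)\<^sup>2)" using r by simp
  then have "?L\<^sup>2 \<le> 4 * inverse r * (\<Sum>u\<in>V. (m u)\<^sup>2)" using r by (simp add: field_simps)
  then show ?thesis using that[of t] t by (simp add: d_def r_def)
qed

end

section \<open>The extremal length bounds\<close>

text \<open>At 0, where \<open>sgn\<close> vanishes, a direction has to be chosen; the root is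
  centred there.\<close>

lemma polar:
  fixes z :: complex
  obtains e where "cmod e = 1" "z = of_real (cmod z) * e"
proof (cases "z = 0")
  case True
  then show ?thesis using that[of 1] by simp
next
  case False
  then have "cmod (sgn z) = 1" by (simp only: norm_sgn if_False)
  moreover have "z = of_real (cmod z) * sgn z" using False by (simp add: sgn_eq)
  ultimately show ?thesis using that by blast
qed

context disc_packing begin

lemma walk_to_reachable:
  assumes "(v, u) \<in> (E \<inter> S \<times> S)\<^sup>*" "v \<in> S"
  shows "\<exists>p. p \<noteq> [] \<and> hd p = v \<and> last p = u \<and> set p \<subseteq> S \<and> set (vwalk_arcs p) \<subseteq> E"
  using assms
proof (induction rule: converse_rtrancl_induct)
  case base
  then show ?case by (intro exI[of _ "[u]"]) auto
next
  case (step y z)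
  then obtain p where p: "p \<noteq> []" "hd p = z" "last p = u" "set p \<subseteq> S" "set (vwalk_arcs p) \<subseteq> E" by auto
  then obtain p' where "p = z # p'" by (cases p) auto
  then show ?case using p step by (intro exI[of _ "y # p"]) auto
qed

lemma saturated_reachable:
  assumes "v \<in> S"
  shows "saturated S {u. (v, u) \<in> (E \<inter> S \<times> S)\<^sup>*}"
proof -
  have "u \<in> S" if "(v, u) \<in> (E \<inter> S \<times> S)\<^sup>*" for u using that assms by (induction rule: rtrancl_induct) auto
  moreover have "(v, w) \<in> (E \<inter> S \<times> S)\<^sup>*"
    if "(v, u) \<in> (E \<inter> S \<times> S)\<^sup>*" "(u, w) \<in> E" "u \<in> S" "w \<in> S" for u w
    using that by (meson IntI SigmaI rtrancl.rtrancl_into_rtrancl)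
  ultimately show ?thesis unfolding saturated_def by blast
qed

text \<open>On the line through the origin and \<open>cen u\<close> the disc covers every
  nonnegative distance from \<open>cmod (cen u) - rad u\<close> to
  \<open>cmod (cen u) + rad u\<close>. If \<open>t\<close> were in this range, the circle of radius
  \<open>t\<close> would meet the disc.\<close>

lemma disc_near_centre:
  assumes "u \<in> V" "u \<notin> hit (sphere 0 t)" "0 \<le> t" "cmod (cen u) - rad u \<le> t"
  shows "cmod (cen u) + rad u < t"
proof (rule ccontr)
  assume "\<not> ?thesis"
  then have ge: "t \<le> cmod (cen u) + rad u" by simp
  obtain e where e: "cmod e = 1" "cen u = of_real (cmod (cen u)) * e" by (rule polar)
  have "cen u - of_real t * e = of_real (cmod (cen u) - t) * e"
    by (subst e(2)) (simp add: algebra_simps)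
  then have "dist (cen u) (of_real t * e) = \<bar>cmod (cen u) - t\<bar>"
    using e(1) by (metis dist_norm mult.right_neutral norm_mult norm_of_real)
  then have "of_real t * e \<in> cball (cen u) (rad u)" using assms(4) ge by (simp add: abs_le_iff)
  moreover have "of_real t * e \<in> sphere 0 t" using e(1) assms(3) by (simp add: norm_mult)
  ultimately show False using assms(1,2) unfolding hit_def by blast
qed

end

lemma (in planar_map) adjacency_closed_imp_all:
  assumes X: "X \<subseteq> pverts G" "X \<noteq> {}" "\<And>a b. a \<in> X \<Longrightarrow> (a, b) \<in> parcs G \<Longrightarrow> b \<in> X"
  shows "X = pverts G"
proof -
  obtain x where x: "x \<in> X" using X(2) by blast
  have "y \<in> X" if y: "y \<in> pverts G" for y
  proof -
    have "strongly_connected (with_proj G)" 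
      using graph_connected symmetric_connected_imp_strongly_connected[OF sym_arcs] by blast
    then have "x \<rightarrow>\<^sup>*\<^bsub>with_proj G\<^esub> y" using x y X(1) by (auto simp: strongly_connected_def)
    then have "(x, y) \<in> rtrancl_on (pverts G) (parcs G)" by (simp add: reachable_def)
    then show ?thesis using x X(3) by (induction rule: rtrancl_on_induct) auto
  qed
  then show ?thesis using X(1) by blast
qed

locale rooted_packing = rooted_triangulation + circle_packing_in_disc +
  assumes root_at_origin: "cen \<rho> = 0"

sublocale rooted_packing \<subseteq> disc_packing faces "pverts G" "outer_verts G dr" "parcs G" cen rad \<rho>
proof
  show "finite (pverts G)" by simp
  show "outer_verts G dr \<subseteq> pverts G" by (simp add: outer_verts_def)
  show "parcs G \<subseteq> pverts G \<times> pverts G" using in_arcsD1 in_arcsD2 by auto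
  show "(b, a) \<in> parcs G" if "(a, b) \<in> parcs G" for a b using arcs_sym[OF that] .
  show "a \<noteq> b" if "(a, b) \<in> parcs G" for a b using arcs_neq[OF that] .
  show "X = pverts G" if "X \<subseteq> pverts G" "X \<noteq> {}" "\<And>a b. a \<in> X \<Longrightarrow> (a, b) \<in> parcs G \<Longrightarrow> b \<in> X" for X
    by (rule adjacency_closed_imp_all[OF that])
  show "0 < rad v" if "v \<in> pverts G" for v using rad_pos[OF that] .
  show "ball (cen u) (rad u) \<inter> ball (cen v) (rad v) = {}" if "u \<in> pverts G" "v \<in> pverts G" "u \<noteq> v" for u v
    using disjoint_interiors[OF that] .
  show "(u, v) \<in> parcs G \<longleftrightarrow> u \<in> pverts G \<and> v \<in> pverts G \<and> u \<noteq> v \<and> dist (cen u) (cen v) = rad u + rad v" for u v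
    using tangent_iff[of u v] arcs_neq[of u v] in_arcsD1[of u v] in_arcsD2[of u v] by blast
  show "rad v < 1 \<and> cmod (cen v) = 1 - rad v" if "v \<in> outer_verts G dr" for v using outer_tangent[OF that] .
  show "cmod (cen v) + rad v < 1" if v: "v \<in> pverts G - outer_verts G dr" for v
  proof -
    have r: "0 < rad v" using v rad_pos by blast
    obtain e where e: "cmod e = 1" "cen v = of_real (cmod (cen v)) * e" by (rule polar)
    \<comment> \<open>The point of the circle farthest from the origin; as it lies in the open unit
      disc, the inequality is strict.\<close>
    have "cen v + of_real (rad v) * e \<in> sphere (cen v) (rad v)" using r e(1) by (simp add: dist_norm norm_mult)
    then have "cen v + of_real (rad v) * e \<in> ball 0 1" using inner_contained[OF v] by blast
    moreover have "cen v + of_real (rad v) * e = of_real (cmod (cen v) + rad v) * e"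
      by (subst e(2)) (simp only: of_real_add distrib_right)
    ultimately have "cmod (of_real (cmod (cen v) + rad v) * e) < 1" by simp
    then have "\<bar>cmod (cen v) + rad v\<bar> < 1" by (simp only: norm_mult norm_of_real e(1) mult_1_right)
    then show ?thesis by linarith
  qed
  show "(a, b) \<in> parcs G" if "(a, b, c) \<in> faces" for a b c using facesD(1)[OF that] .
  show "\<exists>c. (a, b, c) \<in> faces" if "(a, b) \<in> parcs G" "a \<notin> outer_verts G dr \<or> b \<notin> outer_verts G dr" for a b
    using face_of_inner_edge[OF that] .
  show "(\<exists>c. (a, b, c) \<in> faces) \<or> (\<exists>c. (b, a, c) \<in> faces)" if "(a, b) \<in> parcs G" for a b
    using face_at_each_edge[OF that] .
  show "\<not> ccw (cen x) (cen z) (cen y) (cen w)"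
    if f: "(x, y, z) \<in> faces" and w: "(x, w) \<in> parcs G" "w \<notin> {y, z}" for x y z w
  proof -
    note d = facesD[OF f]
    have "ccw (cen x) (cen z) (cen y) (cen w) \<longleftrightarrow> ccw_neighbours dr x z y w"
      using d(5) w(2) by (intro cyclic_order arcs_sym[OF d(3)] d(1) w(1)) auto
    then show ?thesis using face_rotation[OF f w] by blast
  qed
  show "\<exists>t\<in>outer_verts G dr. t \<notin> {x, y, z}" if "(x, y, z) \<in> faces" for x y z
    by (rule outer_vert_off_face[OF that]) blast
  show "outer_verts G dr \<subseteq> X \<union> {a, b}"
    if "(a, b) \<in> cx.bdry" "\<And>u w. u \<in> X \<Longrightarrow> (u, w) \<in> parcs G \<Longrightarrow> w \<in> X \<union> {a, b}"
      "t \<in> X" "t \<in> outer_verts G dr" "t \<notin> {a, b}" for a b X t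
  proof (rule outer_verts_connected_off_boundary_edge[OF _ _ that(2-5)])
    show "(a, b) \<in> parcs G" "(b, a, c) \<notin> faces" for c
      using that(1) facesD(1) unfolding cx.bdry_def by blast+
  qed
  show "outer_verts G dr \<noteq> {}"
  proof -
    obtain cs where "3 \<le> length cs" "vwalk (cs @ [hd cs]) (with_proj G)"
      "frontier (outside (support G dr)) = path_image (walk_curve dr (cs @ [hd cs]))"
      by (rule outer_cycle) blast
    then show ?thesis using outer_verts_cycle[of cs] by (cases cs) auto
  qed
  show "\<rho> \<in> pverts G - outer_verts G dr" by (rule root)
  show "cen \<rho> = 0" by (rule root_at_origin)
qed

text \<open>One short path for each \<open>m\<close> suffices. It also makes the infimum over
  \<open>\<Gamma>\<close> finite, so that square and quotient can be computed in the reals.\<close>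

lemma VEL_le:
  fixes V :: "'a set"
  assumes C: "0 \<le> C" and V: "finite V"
    and short: "\<And>m :: 'a \<Rightarrow> real. (\<And>v. v \<in> V \<Longrightarrow> 0 \<le> m v) \<Longrightarrow>
      \<exists>p\<in>\<Gamma>. (path_len m p)\<^sup>2 \<le> C * area V m"
    and \<Gamma>: "\<And>p. p \<in> \<Gamma> \<Longrightarrow> set p \<subseteq> V"
  shows "VEL V \<Gamma> \<le> ereal C"
  unfolding VEL_def
proof (rule SUP_least)
  fix m :: "'a \<Rightarrow> real" assume "m \<in> {m. (\<forall>v\<in>V. 0 \<le> m v) \<and> (\<exists>v\<in>V. m v \<noteq> 0)}"
  then have m: "\<And>v. v \<in> V \<Longrightarrow> 0 \<le> m v" "\<exists>v\<in>V. m v \<noteq> 0" by blast+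
  have a: "0 < area V m"
    using m(2) V unfolding area_def by (metis sum_pos2 zero_le_power2 zero_less_power2)
  obtain p where p: "p \<in> \<Gamma>" "(path_len m p)\<^sup>2 \<le> C * area V m" using short[of m] m(1) by blast
  have nn: "0 \<le> path_len m q" if "q \<in> \<Gamma>" for q
    unfolding path_len_def using m(1) \<Gamma>[OF that] by (intro sum_nonneg) blast
  have "0 \<le> len m \<Gamma>" unfolding len_def using nn by (intro INF_greatest) simp
  moreover have le: "len m \<Gamma> \<le> ereal (path_len m p)" unfolding len_def by (rule INF_lower[OF p(1)])
  ultimately obtain l where l: "len m \<Gamma> = ereal l" "0 \<le> l"
    by (cases "len m \<Gamma>") auto
  then have "l\<^sup>2 \<le> (path_len m p)\<^sup>2" using le by (intro power_mono) auto
  then have "l\<^sup>2 \<le> C * area V m" using p(2) by simp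
  then have "l\<^sup>2 / area V m \<le> C" using a by (simp add: pos_divide_le_eq)
  moreover have "(len m \<Gamma>)\<^sup>2 / ereal (area V m) = ereal (l\<^sup>2 / area V m)"
    using a by (simp add: l(1) power2_eq_square)
  ultimately show "(len m \<Gamma>)\<^sup>2 / ereal (area V m) \<le> ereal C" by simp
qed

context rooted_packing begin

lemma vwalk_reachable:
  assumes "S \<subseteq> pverts G" "(v, u) \<in> (parcs G \<inter> S \<times> S)\<^sup>*" "v \<in> S"
  shows "\<exists>p. vwalk p (with_proj G) \<and> set p \<subseteq> S \<and> hd p = v \<and> last p = u"
  using walk_to_reachable[OF assms(2,3)] assms(1) by (auto simp: vwalk_def)

lemma hit_sub: "hit \<Gamma> \<subseteq> pverts G"
  by (auto simp: hit_def)

lemma path_len_sq_le: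
  assumes m: "\<And>u. u \<in> pverts G \<Longrightarrow> 0 \<le> m u" and p: "set p \<subseteq> hit \<Gamma>"
    and le: "(\<Sum>u\<in>hit \<Gamma>. m u)\<^sup>2 \<le> c"
  shows "(path_len m p)\<^sup>2 \<le> c"
proof -
  have "path_len m p \<le> (\<Sum>u\<in>hit \<Gamma>. m u)" "0 \<le> path_len m p"
    unfolding path_len_def using m p hit_sub[of \<Gamma>] by (auto intro!: sum_mono2 sum_nonneg intro: finite_subset[OF _ pair_finite_verts])
  then have "(path_len m p)\<^sup>2 \<le> (\<Sum>u\<in>hit \<Gamma>. m u)\<^sup>2" by (intro power_mono)
  then show ?thesis using le by simp
qed

lemma short_boundary_path:
  assumes v: "v \<in> pverts G" and m: "\<And>u. u \<in> pverts G \<Longrightarrow> 0 \<le> m u"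
  shows "\<exists>p\<in>boundary_paths G dr v. (path_len m p)\<^sup>2 \<le> (1 + 1 / 2 * ln (1 / rad v)) * area (pverts G) m"
proof -
  obtain \<theta> where \<theta>: "(\<Sum>u\<in>hit (ray v \<theta>). m u)\<^sup>2 \<le> (1 + 1 / 2 * ln (1 / rad v)) * area (pverts G) m"
    unfolding area_def by (rule short_ray[OF v m])
  let ?K = "{u. (v, u) \<in> (parcs G \<inter> hit (ray v \<theta>) \<times> hit (ray v \<theta>))\<^sup>*}"
  note ray = ray_props(1-3)[OF v, of \<theta>] ray_props(4)[OF v, of _ \<theta>]
  have K: "saturated (hit (ray v \<theta>)) ?K" by (rule saturated_reachable[OF ray(3)])
  have "?K \<noteq> {}" by blast
  then have "?K \<inter> outer_verts G dr \<noteq> {}"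
    using hit_reaches_boundary[OF ray(1,2) K _ ray(4)] by blast
  then obtain u where u: "(v, u) \<in> (parcs G \<inter> hit (ray v \<theta>) \<times> hit (ray v \<theta>))\<^sup>*" "u \<in> outer_verts G dr"
    by blast
  obtain p where p: "vwalk p (with_proj G)" "set p \<subseteq> hit (ray v \<theta>)" "hd p = v" "last p = u"
    using vwalk_reachable[OF hit_sub u(1) ray(3)] by blast
  have "p \<in> boundary_paths G dr v" using p u(2) by (simp add: boundary_paths_def)
  then show ?thesis using path_len_sq_le[OF m p(2) \<theta>] by blast
qed

text \<open>The hit discs \<open>S\<close> form a barrier between the discs \<open>X\<close>
  strictly inside the circle and the outer discs, which reach the unit circle.
  \<open>hit_connected\<close> provides the walks within \<open>S\<close> that
  \<open>closed_walk_around\<close> requires, and a closed walk within \<open>S\<close> is short by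
  the choice of the radius.\<close>

lemma short_winding_path:
  assumes v: "v \<in> pverts G" "v \<noteq> \<rho>" and m: "\<And>u. u \<in> pverts G \<Longrightarrow> 0 \<le> m u"
  shows "\<exists>p\<in>winding_paths G dr \<rho> v. (path_len m p)\<^sup>2 \<le> 4 * inverse (rad v) * area (pverts G) m"
proof -
  obtain t where t: "cmod (cen v) - rad v < t" "t < cmod (cen v) + rad v"
    and le: "(\<Sum>u\<in>hit (sphere 0 t). m u)\<^sup>2 \<le> 4 * inverse (rad v) * area (pverts G) m"
    unfolding area_def by (rule short_circle[OF v m])
  define S where "S = hit (sphere 0 t)"
  define X where "X = {u \<in> pverts G. cmod (cen u) + rad u < t}"
  have \<rho>: "\<rho> \<in> pverts G" "cen \<rho> = 0" "0 < rad \<rho>" using root root_centre rad_pos by auto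
  have "rad \<rho> + rad v \<le> cmod (cen v)" using sep[OF \<rho>(1) v(1)] v(2) \<rho>(2) by simp
  then have \<rho>t: "rad \<rho> < t" using t(1) by linarith
  then have t0: "0 \<le> t" using \<rho>(3) by linarith
  have t1: "t < 1" using t(2) in_disc[OF v(1)] by linarith
  have \<Gamma>: "connected (sphere (0 :: complex) t)" "sphere (0 :: complex) t \<subseteq> ball 0 1"
    using t1 by (auto intro: connected_sphere)
  have vS: "v \<in> S"
  proof (rule ccontr)
    assume "v \<notin> S"
    then have "cmod (cen v) + rad v < t"
      using t t0 v(1) unfolding S_def by (intro disc_near_centre) auto
    then show False using t by simp
  qed
  have reach: "(u, w) \<in> (parcs G \<inter> S \<times> S)\<^sup>*" if "u \<in> S" "w \<in> S" for u w
  proof -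
    have "{w. (u, w) \<in> (parcs G \<inter> S \<times> S)\<^sup>*} = S"
      unfolding S_def using saturated_reachable[of u "hit (sphere 0 t)"] that(1)
      by (intro hit_connected[OF \<Gamma>]) (auto simp: S_def)
    then show ?thesis using that(2) by blast
  qed
  have "\<exists>p\<in>winding_paths G dr \<rho> v. set p \<subseteq> S"
  proof (rule closed_walk_around)
    show "\<rho> \<in> X" using \<rho> \<rho>t by (simp add: X_def)
    show "X \<subseteq> pverts G" by (auto simp: X_def)
    show "X \<inter> outer_verts G dr = {}" using outer_tangent t1 by (fastforce simp: X_def)
    show "S \<subseteq> pverts G" unfolding S_def by (rule hit_sub)
    show "S \<inter> X = {}" using hit_circle(3)[of _ t] by (fastforce simp: S_def X_def)
    show "b \<in> X \<union> S" if ab: "(a, b) \<in> parcs G" "a \<in> X" for a b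
    proof (cases "b \<in> S")
      case False
      have b: "b \<in> pverts G" "dist (cen a) (cen b) = rad a + rad b" using tangent[of a b] ab(1) by auto
      \<comment> \<open>A disc tangent to one inside the circle begins inside the circle; it is hit
        unless it lies inside altogether.\<close>
      have "cmod (cen b) \<le> cmod (cen a) + dist (cen a) (cen b)"
        using norm_triangle_ineq2[of "cen b" "cen a"] by (simp add: dist_norm norm_minus_commute)
      then have "cmod (cen b) - rad b \<le> t" using b(2) ab(2) by (simp add: X_def)
      then show ?thesis using disc_near_centre[OF b(1) _ t0] False b(1) by (auto simp: X_def S_def)
    qed blast
    show "\<exists>p. vwalk p (with_proj G) \<and> set p \<subseteq> S \<and> hd p = u \<and> last p = w" if "u \<in> S" "w \<in> S" for u w
      using vwalk_reachable[OF _ reach[OF that] that(1)] hit_sub unfolding S_def by blast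
    show "v \<in> S" by (rule vS)
  qed
  then show ?thesis using path_len_sq_le[OF m _ le] unfolding S_def by blast
qed

lemma VEL_bounds:
  "v \<in> pverts G \<Longrightarrow> v \<noteq> \<rho> \<Longrightarrow> VEL (pverts G) (winding_paths G dr \<rho> v) \<le> ereal (4 * inverse (rad v))"
  "v \<in> pverts G \<Longrightarrow> VEL (pverts G) (boundary_paths G dr v) \<le> ereal (1 + 1 / 2 * ln (1 / rad v))"
proof -
  assume v: "v \<in> pverts G"
  \<comment> \<open>\<open>rad v \<le> 1\<close> makes the logarithm nonnegative, so that both
    constants are admissible in \<open>VEL_le\<close>.\<close>
  then have r: "0 < rad v" "rad v \<le> 1" using rad_pos[OF v] in_disc[OF v] norm_ge_zero[of "cen v"] by linarith+
  show "VEL (pverts G) (winding_paths G dr \<rho> v) \<le> ereal (4 * inverse (rad v))" if "v \<noteq> \<rho>"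
    by (rule VEL_le) (use r short_winding_path[OF v that] in \<open>auto simp: winding_paths_def vwalk_def\<close>)
  show "VEL (pverts G) (boundary_paths G dr v) \<le> ereal (1 + 1 / 2 * ln (1 / rad v))"
    by (rule VEL_le) (use r short_boundary_path[OF v] in \<open>auto simp: boundary_paths_def vwalk_def\<close>)
qed

end

theorem theorem1p1:
  fixes G :: "complex pair_pre_digraph" and dr :: drawing and \<rho> :: complex
    and cen :: "complex \<Rightarrow> complex" and rad :: "complex \<Rightarrow> real"
  assumes "rooted_triangulation G dr \<rho>"
    and "circle_packing_in_disc G dr cen rad"
    and "cen \<rho> = 0"
  shows "(\<forall>v\<in>pverts G. v \<noteq> \<rho> \<longrightarrow>
            VEL (pverts G) (winding_paths G dr \<rho> v) \<le> ereal (4 * inverse (rad v))) \<and>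
         (\<forall>v\<in>pverts G.
            VEL (pverts G) (boundary_paths G dr v) \<le> ereal (1 + 1 / 2 * ln (1 / rad v)))"
proof -
  interpret rooted_packing G dr \<rho> cen rad
    using assms by (intro rooted_packing.intro rooted_packing_axioms.intro)
  show ?thesis using VEL_bounds by blast
qed

end
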